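(* Consider a smooth pure exchange economy with $m$ consumers and $l$ goods, equilibrium manifold $E\subset S\times\Omega$, natural projection $\pi\colon E\to\Omega$ and set of crisis transitions $\mathcal B\subset E$ (all as defined in the context). Assume that the complement $E\setminus\mathcal B$ of the set of crisis transitions is both connected and dense in $E$. Then for every $\omega\in\Omega$ the fiber $E_\omega=\pi^{-1}(\omega)$ is a continuum, i.e., a compact connected set. In particular, if $E_\omega$ contains some regular equilibrium $e$, then $e$ is the only element of $E_\omega$.
   Context: Economy. $X=\mathbb R^l_{++}$ is the strictly positive orthant; $S=\{(p_1,\dots,p_l)\in\mathbb R^l_{++} : p_l=1\}$ is the set of normalized prices, identified with an open subset of $\mathbb R^{l-1}$. Each consumer $i=1,\dots,m$ has a fixed smooth utility function $u_i\colon X\to\mathbb R$ such that: (monotonicity) $\nabla u_i(x)\in\mathbb R^l_{++}$ for every $x\in X$; (strict quasi-concavity) the Hessian $D^2u_i(x)$ is negative definite on the tangent hyperplane at $x$ to the indifference surface through $x$; (necessity) for every $r\in\mathbb R$ the indifference surface $\{x\in X: u_i(x)=r\}$ is closed in $\mathbb R^l$. For an endowment $\omega_i\in X$ and $p\in S$, the demand $x_i(p,\omega_i)\in X$ is the unique maximizer of $u_i$ on $\{x\in X: p\cdot x\le p\cdot\omega_i\}$; it satisfies $p\cdot x_i(p,\omega_i)=p\cdot\omega_i$ and depends smoothly on $(p,\omega_i)$. An economy is $\omega=(\omega_1,\dots,\omega_m)\in\Omega=\mathbb R^{ml}_{++}$. The excess demand is $z\colon S\times\Omega\to\mathbb R^l$,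 $z(p,\omega)=\sum_{i=1}^m(x_i(p,\omega_i)-\omega_i)$. An equilibrium is a pair $(p,\omega)\in S\times\Omega$ with $z(p,\omega)=0$. The equilibrium manifold $E=\{(p,\omega): z(p,\omega)=0\}$ is a smooth $ml$-dimensional submanifold of $S\times\Omega$, diffeomorphic to Euclidean space; the natural projection $\pi\colon E\to\Omega$, $\pi(p,\omega)=\omega$, is smooth and proper. A regular equilibrium is a point $e\in E$ at which $D\pi(e)$ is an isomorphism. A crisis transition (crisis) is a point $e_*=(p_*,\omega_* )\in E$ such that on no neighbourhood of $\omega_*$ does there exist a continuous selection $\omega\mapsto p(\omega)$ of equilibrium prices with $p(\omega_* )=p_*$; equivalently, $\pi$ is not a local homeomorphism at $e_*$. $\mathcal B\subset E$ denotes the set of crisis transitions. *)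

theory Defs
  imports "HOL-Analysis.Analysis"
begin

section \<open>Smoothness, Hessians and tangent spaces\<close>

text \<open>\<open>Ck_on k f U\<close>, for open \<open>U\<close>: \<open>f\<close> is \<open>k\<close> times continuously (Frechet) differentiable on \<open>U\<close>.
  The domain is finite-dimensional, so asking this for every directional derivative is the same
  as asking it for the derivative.\<close>

primrec Ck_on :: "nat \<Rightarrow> ('a::euclidean_space \<Rightarrow> 'b::real_normed_vector) \<Rightarrow> 'a set \<Rightarrow> bool" where
  "Ck_on 0 f U \<longleftrightarrow> continuous_on U f"
| "Ck_on (Suc k) f U \<longleftrightarrow>
     (\<forall>x\<in>U. f differentiable (at x)) \<and>
     (\<forall>v. Ck_on k (\<lambda>x. frechet_derivative f (at x) v) U)"

definition smooth_on :: "('a::euclidean_space \<Rightarrow> 'b::real_normed_vector) \<Rightarrow> 'a set \<Rightarrow> bool" where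
  "smooth_on f U \<longleftrightarrow> (\<forall>k. Ck_on k f U)"

definition gradient :: "(real ^ 'n \<Rightarrow> real) \<Rightarrow> real ^ 'n \<Rightarrow> real ^ 'n" where
  "gradient f x = (\<chi> j. frechet_derivative f (at x) (axis j 1))"

definition hessian :: "(real ^ 'n \<Rightarrow> real) \<Rightarrow> real ^ 'n \<Rightarrow> real ^ 'n ^ 'n" where
  "hessian f x = jacobian (gradient f) (at x)"

text \<open>The tangent space of an embedded smooth submanifold \<open>M\<close> at a point \<open>a\<close>: the set of velocities
  at \<open>a\<close> of smooth curves in \<open>M\<close>.\<close>

definition tangent_space :: "'a::euclidean_space set \<Rightarrow> 'a \<Rightarrow> 'a set" where
  "tangent_space M a =
     {v. \<exists>\<gamma> \<epsilon>. \<epsilon> > 0 \<and> smooth_on \<gamma> {-\<epsilon><..<\<epsilon>} \<and> \<gamma> ` {-\<epsilon><..<\<epsilon>} \<subseteq> M \<and>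
             \<gamma> 0 = a \<and> (\<gamma> has_vector_derivative v) (at (0::real))}"

text \<open>Continua are nonempty by convention.\<close>

definition continuum :: "'a::topological_space set \<Rightarrow> bool" where
  "continuum C \<longleftrightarrow> compact C \<and> connected C \<and> C \<noteq> {}"


section \<open>Pure exchange economies\<close>

text \<open>The goods are indexed by the finite type \<open>'l\<close> and the consumers by the finite type \<open>'m\<close>.
  The parameter \<open>n :: 'l\<close> is the numeraire, i.e. the last good \<open>l\<close> in the normalization
  $p_l = 1$.\<close>

definition commodity_space :: "(real ^ 'l) set" where
  "commodity_space = {x. \<forall>j. x $ j > 0}"

definition price_set :: "'l::finite \<Rightarrow> (real ^ 'l) set" where
  "price_set n = {p. (\<forall>j. p $ j > 0) \<and> p $ n = 1}"

definition endowment_space :: "(real ^ 'l ^ 'm) set" where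
  "endowment_space = {\<omega>. \<forall>i. \<omega> $ i \<in> commodity_space}"

definition monotone_utility :: "(real ^ 'l \<Rightarrow> real) \<Rightarrow> bool" where
  "monotone_utility u \<longleftrightarrow> (\<forall>x\<in>commodity_space. gradient u x \<in> commodity_space)"

text \<open>The tangent hyperplane at \<open>x\<close> to the indifference surface through \<open>x\<close> is the
  orthogonal complement of the (nonzero) gradient.\<close>

definition strictly_quasiconcave_utility :: "(real ^ 'l \<Rightarrow> real) \<Rightarrow> bool" where
  "strictly_quasiconcave_utility u \<longleftrightarrow>
     (\<forall>x\<in>commodity_space. \<forall>v. gradient u x \<bullet> v = 0 \<and> v \<noteq> 0 \<longrightarrow> v \<bullet> (hessian u x *v v) < 0)"

definition necessity :: "(real ^ 'l \<Rightarrow> real) \<Rightarrow> bool" where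
  "necessity u \<longleftrightarrow> (\<forall>r. closed {x \<in> commodity_space. u x = r})"

definition budget_set :: "real ^ 'l \<Rightarrow> real ^ 'l \<Rightarrow> (real ^ 'l) set" where
  "budget_set p w = {x \<in> commodity_space. p \<bullet> x \<le> p \<bullet> w}"

text \<open>The description is proper for \<open>p \<in> price_set n\<close>, \<open>w \<in> commodity_space\<close> and \<open>u\<close> smooth with the
  three properties above: the maximizer then exists and is unique.\<close>

definition demand :: "(real ^ 'l \<Rightarrow> real) \<Rightarrow> real ^ 'l \<Rightarrow> real ^ 'l \<Rightarrow> real ^ 'l" where
  "demand u p w = (THE x. is_arg_max u (\<lambda>y. y \<in> budget_set p w) x)"

definition excess_demand ::
    "('m::finite \<Rightarrow> real ^ 'l \<Rightarrow> real) \<Rightarrow> real ^ 'l \<Rightarrow> real ^ 'l ^ 'm \<Rightarrow> real ^ 'l" where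
  "excess_demand u p \<omega> = (\<Sum>i\<in>UNIV. demand (u i) p (\<omega> $ i) - \<omega> $ i)"

definition equilibrium_manifold ::
    "'l::finite \<Rightarrow> ('m::finite \<Rightarrow> real ^ 'l \<Rightarrow> real) \<Rightarrow> ((real ^ 'l) \<times> (real ^ 'l ^ 'm)) set" where
  "equilibrium_manifold n u =
     {(p, \<omega>). p \<in> price_set n \<and> \<omega> \<in> endowment_space \<and> excess_demand u p \<omega> = 0}"

text \<open>The natural projection is the restriction of \<^const>\<open>snd\<close> to the equilibrium manifold.\<close>

definition equilibrium_fiber ::
    "'l::finite \<Rightarrow> ('m::finite \<Rightarrow> real ^ 'l \<Rightarrow> real) \<Rightarrow> real ^ 'l ^ 'm \<Rightarrow> ((real ^ 'l) \<times> (real ^ 'l ^ 'm)) set" where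
  "equilibrium_fiber n u \<omega> = {e \<in> equilibrium_manifold n u. snd e = \<omega>}"

text \<open>The natural projection is the restriction of a linear map, so its derivative at \<open>e\<close> is the
  restriction of \<^const>\<open>snd\<close> to the tangent space of the equilibrium manifold at \<open>e\<close>; the tangent
  space of the (open) endowment space is the whole ambient space.\<close>

definition regular_equilibrium ::
    "'l::finite \<Rightarrow> ('m::finite \<Rightarrow> real ^ 'l \<Rightarrow> real) \<Rightarrow> (real ^ 'l) \<times> (real ^ 'l ^ 'm) \<Rightarrow> bool" where
  "regular_equilibrium n u e \<longleftrightarrow>
     e \<in> equilibrium_manifold n u \<and>
     bij_betw snd (tangent_space (equilibrium_manifold n u) e) (UNIV :: (real ^ 'l ^ 'm) set)"

definition crisis_transitions ::
    "'l::finite \<Rightarrow> ('m::finite \<Rightarrow> real ^ 'l \<Rightarrow> real) \<Rightarrow> ((real ^ 'l) \<times> (real ^ 'l ^ 'm)) set" where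
  "crisis_transitions n u =
     {(p0, \<omega>0). (p0, \<omega>0) \<in> equilibrium_manifold n u \<and>
        \<not> (\<exists>U p. open U \<and> \<omega>0 \<in> U \<and> U \<subseteq> endowment_space \<and> continuous_on U p \<and> p \<omega>0 = p0 \<and>
                 (\<forall>\<omega>\<in>U. (p \<omega>, \<omega>) \<in> equilibrium_manifold n u))}"

end

theory Submission
  imports Defs
begin

text \<open>Replacing the endowment of one consumer by his demand gives a global chart of the equilibrium manifold,
  an open subset of the endowment space \<open>\<Omega>\<close> on which the natural projection becomes
  \<open>F(\<xi>) = \<xi> + G(\<xi>)\<close>, where \<open>G\<close> is the excess demand of the other consumers. By Walras' law the
  preimages of a compact set under all the maps \<open>\<xi> + t G(\<xi>)\<close>, \<open>0 \<le> t \<le> 1\<close>, lie in one compact set, so \<open>F\<close> has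
  degree 1.

  Degree theory is replaced by the fact that \<open>\<integral> det DT = 0\<close> for a compactly supported C1 map \<open>T\<close>: for
  large \<open>s\<close> the map \<open>s I + T\<close> is bijective, hence \<open>\<integral> det (s I + DT)\<close> over a large ball is
  \<open>s\<^sup>N\<close> times the volume of the ball; both sides are polynomials in \<open>s\<close>, so they agree at \<open>s = 0\<close>. It
  follows that integrals \<open>\<integral> (\<phi> \<circ> F) det DF\<close> over pieces of the domain are invariant when the bump
  function \<open>\<phi>\<close> is moved.

  Where \<open>F\<close> is injective, \<open>det DF\<close> cannot change sign, and by Sard's theorem it does not vanish
  on an open set. As the noncritical set is connected and dense and the degree is 1, \<open>det DF \<ge> 0\<close>
  everywhere, whence no point has two regular preimages. If a fibre split into two parts, both would
  have positive local degree, and some point nearby would have two regular preimages.\<close>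

section \<open>Maps with a continuous Jacobian matrix\<close>

text \<open>Demand is given only as a maximizer, so its differentiability has to be derived. It is
  the inverse of the explicit map from a bundle to its supporting price and income, and negative
  definiteness of the Hessian on the tangent hyperplane makes the Jacobian of that map nonsingular.
  \<open>F\<close> need not map \<Omega> into itself: the endowment that it reconstructs for the
  selected consumer may fail to be positive. So \<open>F\<close> lives on all of \<Omega>, while
  properness, the degree formula and the sign of the determinant concern only values in \<Omega>.
  Properness is where the economics enters. At every time of the homotopy the bundle recorded for
  the selected consumer is at least as good for him as the bundle that the homotopy assigns to him;
  necessity turns this lower bound on utility into a distance from the boundary. A point that is no
  crisis may still have a singular derivative, as x^3 has at 0. Hence what is tracked along the
  noncritical set is the sign of the determinant at nearby points, and injectivity near such a point
  comes from invariance of domain, not from the inverse function theorem.\<close>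

definition C1_map :: "(real^'n \<Rightarrow> real^'m) \<Rightarrow> (real^'n \<Rightarrow> real^'n^'m) \<Rightarrow> (real^'n) set \<Rightarrow> bool" where
  "C1_map f f' S \<longleftrightarrow> (\<forall>x\<in>S. (f has_derivative (\<lambda>v. f' x *v v)) (at x)) \<and> continuous_on S f'"

lemma C1_mapD:
  assumes "C1_map f f' S"
  shows "\<And>x. x \<in> S \<Longrightarrow> (f has_derivative (\<lambda>v. f' x *v v)) (at x)"
    and "continuous_on S f'" and "continuous_on S f"
proof -
  show d: "\<And>x. x \<in> S \<Longrightarrow> (f has_derivative (\<lambda>v. f' x *v v)) (at x)" and "continuous_on S f'"
    using assms by (auto simp: C1_map_def)
  show "continuous_on S f"
    using d by (meson continuous_at_imp_continuous_on has_derivative_continuous)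
qed

lemma C1_map_subset: "C1_map f f' S \<Longrightarrow> T \<subseteq> S \<Longrightarrow> C1_map f f' T"
  by (auto simp: C1_map_def intro: continuous_on_subset)

lemma continuous_on_matrix_componentwise:
  fixes A :: "'a::topological_space \<Rightarrow> real^'n^'m"
  assumes "\<And>i j. continuous_on S (\<lambda>x. A x $ i $ j)"
  shows "continuous_on S A"
proof -
  have "continuous_on S (\<lambda>x. \<chi> i j. A x $ i $ j)"
    by (intro continuous_on_vec_lambda assms)
  then show ?thesis by simp
qed

lemma continuous_on_matrix_mult:
  fixes A :: "'a::topological_space \<Rightarrow> real^'n^'m" and B :: "'a \<Rightarrow> real^'k^'n"
  assumes "continuous_on S A" "continuous_on S B"
  shows "continuous_on S (\<lambda>x. A x ** B x)"
  unfolding matrix_matrix_mult_def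
  by (intro continuous_intros assms)

lemma continuous_on_det:
  fixes A :: "'a::topological_space \<Rightarrow> real^'n^'n"
  assumes "continuous_on S A"
  shows "continuous_on S (\<lambda>x. det (A x))"
  unfolding det_def by (intro continuous_intros assms)

lemma C1_map_compose:
  fixes f :: "real^'n \<Rightarrow> real^'m" and g :: "real^'m \<Rightarrow> real^'k"
  assumes f: "C1_map f f' S" and g: "C1_map g g' T" and ST: "f ` S \<subseteq> T"
  shows "C1_map (\<lambda>x. g (f x)) (\<lambda>x. g' (f x) ** f' x) S"
  unfolding C1_map_def
proof (intro conjI ballI)
  fix x assume "x \<in> S"
  then have "((\<lambda>x. g (f x)) has_derivative (\<lambda>v. g' (f x) *v (f' x *v v))) (at x)"
    using has_derivative_compose[OF C1_mapD(1)[OF f] C1_mapD(1)[OF g]] ST by blast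
  then show "((\<lambda>x. g (f x)) has_derivative (\<lambda>v. g' (f x) ** f' x *v v)) (at x)"
    by (simp add: matrix_vector_mul_assoc)
next
  have "continuous_on S (\<lambda>x. g' (f x))"
    using continuous_on_compose2[OF C1_mapD(2)[OF g] C1_mapD(3)[OF f] ST] .
  then show "continuous_on S (\<lambda>x. g' (f x) ** f' x)"
    by (intro continuous_on_matrix_mult C1_mapD(2)[OF f])
qed

lemma C1_map_id: "C1_map (\<lambda>x. x) (\<lambda>x. mat 1) S"
  by (auto simp: C1_map_def)

lemma C1_map_add:
  assumes "C1_map f f' S" "C1_map g g' S"
  shows "C1_map (\<lambda>x. f x + g x) (\<lambda>x. f' x + g' x) S"
  using assms unfolding C1_map_def
  by (auto simp: matrix_vector_mult_add_rdistrib intro!: continuous_intros derivative_eq_intros)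

definition outer_product :: "real^'m \<Rightarrow> real^'n \<Rightarrow> real^'n^'m" where
  "outer_product a b = (\<chi> i j. a $ i * b $ j)"

lemma outer_product_mult: "outer_product a b *v v = (b \<bullet> v) *\<^sub>R a"
  by (simp add: outer_product_def matrix_vector_mult_def vec_eq_iff inner_vec_def
      sum_distrib_left sum_distrib_right mult_ac)

lemma C1_map_scaleR:
  assumes f: "C1_map f f' S"
    and c: "\<And>x. x \<in> S \<Longrightarrow> (c has_derivative (\<lambda>v. c' x \<bullet> v)) (at x)" "continuous_on S c'"
  shows "C1_map (\<lambda>x. c x *\<^sub>R f x) (\<lambda>x. c x *\<^sub>R f' x + outer_product (f x) (c' x)) S"
  unfolding C1_map_def
proof (intro conjI ballI)
  fix x assume "x \<in> S"
  then show "((\<lambda>x. c x *\<^sub>R f x) has_derivative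
     (\<lambda>v. (c x *\<^sub>R f' x + outer_product (f x) (c' x)) *v v)) (at x)"
    using f c by (auto simp: C1_map_def matrix_vector_mult_add_rdistrib outer_product_mult
        scaleR_matrix_vector_assoc[symmetric] intro!: derivative_eq_intros)
next
  have "continuous_on S c"
    using c(1) has_derivative_continuous by (blast intro: continuous_at_imp_continuous_on)
  then show "continuous_on S (\<lambda>x. c x *\<^sub>R f' x + outer_product (f x) (c' x))"
    unfolding outer_product_def
    by (intro continuous_intros C1_mapD[OF f] c(2))
qed

lemma C1_map_const: "C1_map (\<lambda>x. a) (\<lambda>x. 0) S"
  by (auto simp: C1_map_def)

lemma C1_map_cong_open:
  assumes f: "C1_map f f' S" and "open S" and eq: "\<And>x. x \<in> S \<Longrightarrow> g x = f x"
  shows "C1_map g f' S"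
  unfolding C1_map_def
proof (intro conjI ballI)
  fix x assume "x \<in> S"
  then show "(g has_derivative (\<lambda>v. f' x *v v)) (at x)"
    using has_derivative_transform_within_open[OF C1_mapD(1)[OF f] \<open>open S\<close>] eq by metis
qed (rule C1_mapD[OF f])

lemma C1_map_deriv_unique:
  assumes f: "C1_map f f' S" and g: "C1_map g g' S" and "open S"
    and eq: "\<And>x. x \<in> S \<Longrightarrow> g x = f x" and x: "x \<in> S"
  shows "f' x = g' x"
proof -
  have "(f has_derivative (\<lambda>v. g' x *v v)) (at x)"
    using has_derivative_transform_within_open[OF C1_mapD(1)[OF g x] \<open>open S\<close> x] eq by metis
  then have "(\<lambda>v. f' x *v v) = (\<lambda>v. g' x *v v)"
    using has_derivative_unique C1_mapD(1)[OF f x] by blast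
  then show ?thesis by (metis matrix_eq)
qed

lemma C1_map_deriv_cong:
  assumes "C1_map f f' S" "\<And>x. x \<in> S \<Longrightarrow> g' x = f' x"
  shows "C1_map f g' S"
  using assms by (simp add: C1_map_def cong: continuous_on_cong)

lemma C1_map_Un:
  assumes "C1_map f f' S" "C1_map f f' T" "open S" "open T"
  shows "C1_map f f' (S \<union> T)"
  using assms by (auto simp: C1_map_def intro: continuous_on_open_Un)

text \<open>The norm of a matrix is here the Frobenius norm; Cauchy-Schwarz is applied row by
  row.\<close>

lemma norm_matrix_vector_mult_le:
  fixes A :: "real^'n^'m"
  shows "norm (A *v v) \<le> norm A * norm v"
proof -
  have "norm (A *v v) = L2_set (\<lambda>i. \<bar>A $ i \<bullet> v\<bar>) UNIV"
    by (simp add: norm_vec_def matrix_vector_mult_def inner_vec_def)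
  also have "\<dots> \<le> L2_set (\<lambda>i. norm (A $ i) * norm v) UNIV"
    by (intro L2_set_mono Cauchy_Schwarz_ineq2) auto
  also have "\<dots> = norm A * norm v"
    by (simp add: L2_set_left_distrib norm_vec_def)
  finally show ?thesis .
qed

lemma det_eq_0_imp_kernel:
  fixes A :: "real^'n^'n"
  assumes "det A = 0"
  obtains v where "v \<noteq> 0" "A *v v = 0"
proof -
  have "\<not> inj ((*v) A)"
    using assms by (simp add: det_eq_0_rank less_rank_noninjective)
  then obtain x y where "x \<noteq> y" "A *v x = A *v y"
    by (auto simp: inj_def)
  then show ?thesis
    using that[of "x - y"] by (simp add: matrix_vector_mult_diff_distrib)
qed

lemma det_scaleR:
  fixes A :: "real^'n^'n"
  shows "det (c *\<^sub>R A) = c ^ CARD('n) * det A"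
  by (simp add: det_def prod.distrib sum_distrib_left mult_ac)

text \<open>On the segment from the identity to \<open>mat 1 + A\<close> the determinant starts at
  1. A zero at time \<open>t\<close> would give a kernel vector \<open>v\<close> with
  \<open>v = - t A v\<close>, against the strict contraction.\<close>

lemma det_mat1_add_pos:
  fixes A :: "real^'n^'n"
  assumes "\<And>v. v \<noteq> 0 \<Longrightarrow> norm (A *v v) < norm v"
  shows "det (mat 1 + A) > 0"
proof (rule ccontr)
  assume "\<not> ?thesis"
  then have le: "det (mat 1 + 1 *\<^sub>R A) \<le> 0" by simp
  have "\<exists>t\<ge>0. t \<le> 1 \<and> det (mat 1 + t *\<^sub>R A) = 0"
  proof (rule IVT2')
    show "continuous_on {0..1::real} (\<lambda>t. det (mat 1 + t *\<^sub>R A))"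
      by (intro continuous_on_det continuous_intros)
  qed (use le in auto)
  then obtain t where t: "0 \<le> t" "t \<le> 1" "det (mat 1 + t *\<^sub>R A) = 0" by blast
  then obtain v where v: "v \<noteq> 0" "(mat 1 + t *\<^sub>R A) *v v = 0"
    using det_eq_0_imp_kernel by blast
  then have "v = - (t *\<^sub>R (A *v v))"
    by (simp add: matrix_vector_mult_add_rdistrib scaleR_matrix_vector_assoc[symmetric] eq_neg_iff_add_eq_0)
  then have "norm v = t * norm (A *v v)"
    using t(1) by (metis abs_of_nonneg norm_minus_cancel norm_scaleR)
  also have "\<dots> \<le> norm (A *v v)"
    using t by (simp add: mult_left_le_one_le)
  finally show False using assms[OF v(1)] by simp
qed

section \<open>A null Lagrangian\<close>

text \<open>Lagrange interpolation, evaluated at 0. The weights \<open>c\<close> depend on the nodes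
  alone, not on the polynomial, so the formula can be integrated over a family of
  polynomials.\<close>

lemma poly_extrapolation:
  fixes S :: "real set"
  assumes "finite S" "d < card S"
  obtains c where "\<And>p. degree p \<le> d \<Longrightarrow> poly p 0 = (\<Sum>s\<in>S. c s * poly p s)"
proof -
  \<comment> \<open>The Lagrange basis: \<open>L s\<close> is 1 at \<open>s\<close> and 0 at every
    other node.\<close>
  define L :: "real \<Rightarrow> real poly" where "L s = (\<Prod>r\<in>S - {s}. smult (1 / (s - r)) [:-r, 1:])" for s
  have L: "poly (L s) r = (if r = s then 1 else 0)" if "s \<in> S" "r \<in> S" for s r
  proof (cases "r = s")
    case True
    then show ?thesis by (auto simp: L_def poly_prod diff_divide_distrib[symmetric] intro!: prod.neutral)
  next
    case False
    then show ?thesis using that \<open>finite S\<close> by (auto simp: L_def poly_prod prod_zero_iff)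
  qed
  have degL: "degree (L s) < card S" if "s \<in> S" for s
  proof -
    have "degree (L s) \<le> (\<Sum>r\<in>S - {s}. degree (smult (1 / (s - r)) [:-r, 1:]))"
      unfolding L_def by (rule degree_prod_sum_le[unfolded o_def]) (use assms in auto)
    also have "\<dots> \<le> (\<Sum>r\<in>S - {s}. 1)"
      by (intro sum_mono) (auto intro: order.trans[OF degree_smult_le])
    also have "\<dots> < card S"
      using that assms by (simp add: card_gt_0_iff)
    finally show ?thesis .
  qed
  show ?thesis
  proof
    fix p :: "real poly" assume p: "degree p \<le> d"
    define q where "q = (\<Sum>s\<in>S. smult (poly p s) (L s))"
    have q: "poly q r = poly p r" if "r \<in> S" for r
    proof -
      have "poly q r = (\<Sum>s\<in>S. if s = r then poly p s else 0)"
        unfolding q_def poly_sum poly_smult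
        by (intro sum.cong) (use L that in auto)
      then show ?thesis using that assms by simp
    qed
    have "degree q \<le> card S - 1"
      unfolding q_def using assms degL
      by (intro degree_sum_le) (auto intro!: order.trans[OF degree_smult_le] simp: Suc_leI less_Suc_eq_le[symmetric] intro: order.trans)
    have "q = p"
    proof (rule ccontr)
      assume "q \<noteq> p"
      then have nz: "q - p \<noteq> 0" by simp
      have "card S \<le> card {x. poly (q - p) x = 0}"
        using q poly_roots_finite[OF nz] by (intro card_mono) auto
      also have "\<dots> \<le> degree (q - p)"
        by (rule card_poly_roots_bound[OF nz])
      also have "\<dots> \<le> card S - 1"
        using p assms(2) \<open>degree q \<le> card S - 1\<close> by (intro degree_diff_le) auto
      finally show False using assms(2) by linarith
    qed
    then show "poly p 0 = (\<Sum>s\<in>S. poly (L s) 0 * poly p s)"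
      by (metis (no_types, lifting) q_def poly_smult poly_sum mult.commute sum.cong)
  qed
qed

lemma det_pencil_poly:
  fixes A :: "real^'n^'n"
  obtains p where "degree p \<le> CARD('n)" "\<And>s. poly p s = det (s *\<^sub>R mat 1 + A)"
proof
  let ?e = "\<lambda>i j::'n. [: A $ i $ j, mat 1 $ i $ j :]"
  let ?p = "\<Sum>\<sigma> | \<sigma> permutes (UNIV::'n set). [: of_int (sign \<sigma>) :] * (\<Prod>i\<in>UNIV. ?e i (\<sigma> i))"
  show "degree ?p \<le> CARD('n)"
  proof (rule degree_sum_le)
    fix \<sigma> :: "'n \<Rightarrow> 'n"
    have "degree (\<Prod>i\<in>UNIV. ?e i (\<sigma> i)) \<le> (\<Sum>i\<in>(UNIV::'n set). degree (?e i (\<sigma> i)))"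
      by (rule degree_prod_sum_le[unfolded o_def]) auto
    also have "\<dots> \<le> (\<Sum>i\<in>(UNIV::'n set). 1)"
      by (intro sum_mono) auto
    finally show "degree ([: of_int (sign \<sigma>) :] * (\<Prod>i\<in>UNIV. ?e i (\<sigma> i))) \<le> CARD('n)"
      by (intro order.trans[OF degree_mult_le]) simp
  qed (simp add: finite_permutations)
  show "poly ?p s = det (s *\<^sub>R mat 1 + A)" for s
    by (simp add: det_def poly_sum poly_prod algebra_simps)
qed

section \<open>Integration over compact sets and change of variables\<close>

lemma absolutely_integrable_continuous_compact:
  fixes f :: "'a::euclidean_space \<Rightarrow> 'b::euclidean_space"
  assumes "compact S" "continuous_on S f"
  shows "f absolutely_integrable_on S"
  using borel_integrable_compact[OF assms]
  by (simp add: set_integrable_def integrable_completion borel_measurable_integrable)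

lemma integrable_continuous_compact:
  fixes f :: "'a::euclidean_space \<Rightarrow> 'b::euclidean_space"
  assumes "compact S" "continuous_on S f"
  shows "f integrable_on S"
  using absolutely_integrable_continuous_compact[OF assms] set_lebesgue_integral_eq_integral(1) by blast

text \<open>The scalar integrand is wrapped as a vector in \<open>real^1\<close> to fit the
  vector-valued change of variables theorem.\<close>

lemma integral_change_of_variables_real:
  fixes f :: "real^'n::{finite,wellorder} \<Rightarrow> real" and g :: "real^'n::_ \<Rightarrow> real^'n::_"
  assumes S: "S \<in> sets lebesgue"
    and der: "\<And>x. x \<in> S \<Longrightarrow> (g has_derivative (\<lambda>v. g' x *v v)) (at x)"
    and inj: "inj_on g S" and f: "f absolutely_integrable_on g ` S"
  shows "(\<lambda>x. \<bar>det (g' x)\<bar> * f (g x)) absolutely_integrable_on S"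
    and "integral S (\<lambda>x. \<bar>det (g' x)\<bar> * f (g x)) = integral (g ` S) f"
proof -
  let ?f = "\<lambda>x. vec (f x) :: real^1"
  have "?f absolutely_integrable_on g ` S"
    using f by (simp add: absolutely_integrable_on_1_iff)
  then have *: "(\<lambda>x. \<bar>det (matrix (\<lambda>v. g' x *v v))\<bar> *\<^sub>R ?f (g x)) absolutely_integrable_on S \<and>
     integral S (\<lambda>x. \<bar>det (matrix (\<lambda>v. g' x *v v))\<bar> *\<^sub>R ?f (g x)) = integral (g ` S) ?f"
    using has_absolute_integral_change_of_variables[OF S has_derivative_at_withinI[OF der] inj, of ?f] by blast
  have eq: "\<bar>det (matrix (\<lambda>v. g' x *v v))\<bar> *\<^sub>R ?f (g x) = vec (\<bar>det (g' x)\<bar> * f (g x))" for x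
    by (simp add: vec_eq_iff)
  show "(\<lambda>x. \<bar>det (g' x)\<bar> * f (g x)) absolutely_integrable_on S"
    using * unfolding eq by (simp add: absolutely_integrable_on_1_iff)
  show "integral S (\<lambda>x. \<bar>det (g' x)\<bar> * f (g x)) = integral (g ` S) f"
    using * unfolding eq by (simp add: integral_on_1_eq)
qed

text \<open>For \<open>s > B\<close> the map \<open>x + T x / s\<close> perturbs the identity by a
  contraction. It is therefore a bijection of the whole space with positive Jacobian determinant,
  and it preserves the ball, so the change of variables formula returns the volume of the
  ball.\<close>

lemma integral_det_perturbed_identity:
  fixes T :: "real^'n::{finite,wellorder} \<Rightarrow> real^'n::_"
  assumes T: "C1_map T T' UNIV" and r: "\<And>x. norm x > r \<Longrightarrow> T x = 0"
    and B: "\<And>x. norm (T' x) \<le> B" and s: "B < s"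
  shows "integral (cball 0 r) (\<lambda>x. det (s *\<^sub>R mat 1 + T' x)) = s ^ CARD('n::_) * measure lebesgue (cball (0::real^'n::_) r)"
proof -
  have B0: "0 \<le> B" using B[of 0] norm_ge_zero order.trans by blast
  have s0: "s > 0" using B0 s by simp
  define M where "M x = x + (1/s) *\<^sub>R T x" for x
  define M' where "M' x = mat 1 + (1/s) *\<^sub>R T' x" for x
  have M: "(M has_derivative (\<lambda>v. M' x *v v)) (at x)" for x
    unfolding M_def M'_def using C1_mapD(1)[OF T, of x]
    by (auto simp: matrix_vector_mult_add_rdistrib scaleR_matrix_vector_assoc[symmetric] intro!: derivative_eq_intros)
  have lip: "norm (T x - T y) \<le> B * norm (x - y)" for x y
  proof (rule differentiable_bound[OF convex_UNIV])
    show "(T has_derivative (\<lambda>v. T' z *v v)) (at z within UNIV)" for z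
      using C1_mapD(1)[OF T] by simp
    show "onorm (\<lambda>v. T' z *v v) \<le> B" for z
    proof (rule onorm_le)
      show "norm (T' z *v v) \<le> B * norm v" for v
        using norm_matrix_vector_mult_le[of "T' z" v] B[of z]
        by (meson mult_right_mono norm_ge_zero order_trans)
    qed
  qed auto
  have lip2: "norm ((1/s) *\<^sub>R T x - (1/s) *\<^sub>R T y) \<le> (B/s) * norm (x - y)" for x y
  proof -
    have "norm ((1/s) *\<^sub>R T x - (1/s) *\<^sub>R T y) = (1/s) * norm (T x - T y)"
      using s0 by (simp flip: scaleR_diff_right)
    also have "\<dots> \<le> (1/s) * (B * norm (x - y))"
      using lip s0 by (intro mult_left_mono) auto
    finally show ?thesis by simp
  qed
  have Bs: "B / s < 1" "0 \<le> B / s" using s s0 B0 by auto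
  have inj: "inj M"
  proof (rule injI)
    fix x y assume "M x = M y"
    then have "x - y = (1/s) *\<^sub>R T y - (1/s) *\<^sub>R T x"
      by (simp add: M_def algebra_simps)
    then have "norm (x - y) \<le> (B/s) * norm (x - y)"
      using lip2[of y x] by (simp add: norm_minus_commute)
    then show "x = y"
      using Bs(1) by (metis eq_iff_diff_eq_0 less_le_not_le mult_le_cancel_right1 norm_le_zero_iff not_le)
  qed
  have surj: "\<exists>x. M x = y" for y
  proof -
    have "\<exists>!x. y - (1/s) *\<^sub>R T x = x"
    proof (rule banach_fix_type[OF Bs(2,1)], intro allI)
      show "dist (y - (1/s) *\<^sub>R T x) (y - (1/s) *\<^sub>R T z) \<le> B / s * dist x z" for x z
        using lip2[of z x] by (simp add: dist_norm norm_minus_commute)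
    qed
    then show ?thesis by (metis M_def diff_add_cancel)
  qed
  have Mout: "M x = x" if "norm x > r" for x
    using r[OF that] by (simp add: M_def)
  \<comment> \<open>Points outside the ball are fixed: by injectivity no point of the ball is sent
    there, and a preimage of a point of the ball cannot lie there.\<close>
  have img: "M ` cball 0 r = cball 0 r"
  proof (intro equalityI subsetI)
    fix y assume "y \<in> M ` cball 0 r"
    then obtain x where x: "norm x \<le> r" "y = M x" by auto
    show "y \<in> cball 0 r"
      using x Mout[of y] injD[OF inj, of y x] by force
  next
    fix y :: "real^'n::_" assume "y \<in> cball 0 r"
    moreover obtain x where "M x = y" using surj by blast
    ultimately show "y \<in> M ` cball 0 r" using Mout[of x] by force
  qed
  have pos: "det (M' x) > 0" for x
    unfolding M'_def
  proof (rule det_mat1_add_pos)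
    fix v :: "real^'n::_" assume v: "v \<noteq> 0"
    have "norm ((1 / s) *\<^sub>R T' x *v v) = (1/s) * norm (T' x *v v)"
      using s0 by (simp flip: scaleR_matrix_vector_assoc)
    also have "\<dots> \<le> (1/s) * (B * norm v)"
      using s0 order.trans[OF norm_matrix_vector_mult_le mult_right_mono[OF B norm_ge_zero]]
      by (intro mult_left_mono) auto
    also have "\<dots> < norm v" using Bs(1) v s0 by (simp add: field_simps)
    finally show "norm ((1 / s) *\<^sub>R T' x *v v) < norm v" .
  qed
  have "integral (M ` cball 0 r) (\<lambda>x. 1) = integral (cball 0 r) (\<lambda>x. \<bar>det (M' x)\<bar> * 1)"
  proof (rule integral_change_of_variables_real(2)[symmetric])
    show "inj_on M (cball 0 r)" using inj inj_on_subset by blast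
    show "(\<lambda>x. 1 :: real) absolutely_integrable_on M ` cball 0 r"
      unfolding img by (intro absolutely_integrable_continuous_compact) auto
  qed (use M in auto)
  then have "integral (cball 0 r) (\<lambda>x. det (M' x)) = measure lebesgue (cball (0::real^'n::_) r)"
    using pos lmeasure_integral[OF lmeasurable_cball, of "0 :: real^'n::_" r]
    by (simp add: img abs_of_pos)
  moreover have "det (s *\<^sub>R mat 1 + T' x) = s ^ CARD('n) * det (M' x)" for x
  proof -
    have "s *\<^sub>R mat 1 + T' x = s *\<^sub>R M' x"
      using s0 by (simp add: M'_def scaleR_add_right)
    then show ?thesis by (simp add: det_scaleR)
  qed
  ultimately show ?thesis by simp
qed

lemma integral_det_compact_support:
  fixes T :: "real^'n::{finite,wellorder} \<Rightarrow> real^'n::_"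
  assumes T: "C1_map T T' UNIV" and r: "\<And>x. norm x > r \<Longrightarrow> T x = 0"
  shows "integral (cball 0 r) (\<lambda>x. det (T' x)) = 0"
proof -
  let ?N = "CARD('n::_)" and ?V = "measure lebesgue (cball (0::real^'n::_) r)"
  have C: "continuous_on (cball 0 r) T'"
    using C1_mapD(2)[OF T] continuous_on_subset by blast
  obtain B where B: "\<forall>x\<in>cball 0 r. norm (T' x) \<le> B" and "B > 0"
    using compact_imp_bounded[OF compact_continuous_image[OF C compact_cball]]
    unfolding bounded_pos by blast
  \<comment> \<open>The complement of the ball is open and \<open>T\<close> vanishes on it, so the
    bound \<open>B\<close> found on the ball holds everywhere.\<close>
  have "T' x = 0" if "norm x > r" for x
  proof -
    have "C1_map T T' (- cball 0 r)" using C1_map_subset[OF T] by blast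
    then show ?thesis
      using C1_map_deriv_unique[OF _ C1_map_const[of 0], of T T' "- cball 0 r" x] r that by auto
  qed
  then have B': "norm (T' x) \<le> B" for x
    using B \<open>B > 0\<close> by (cases "norm x > r") auto
  \<comment> \<open>One node more than the degree of the determinant as a polynomial in
    \<open>s\<close>, all beyond \<open>B\<close>, where the integral is known.\<close>
  define S where "S = (\<lambda>k. B + 1 + real k) ` {..?N}"
  have S: "finite S" "?N < card S"
    unfolding S_def by (auto simp: card_image inj_on_def)
  have SB: "s > B" if "s \<in> S" for s using that by (auto simp: S_def)
  obtain c where c: "\<And>p. degree p \<le> ?N \<Longrightarrow> poly p 0 = (\<Sum>s\<in>S. c s * poly p s)"
    using poly_extrapolation[OF S] by blast
  have "det (T' x) = (\<Sum>s\<in>S. c s * det (s *\<^sub>R mat 1 + T' x))" for x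
  proof -
    obtain p where "degree p \<le> ?N" "\<And>s. poly p s = det (s *\<^sub>R mat 1 + T' x)"
      using det_pencil_poly[of "T' x"] by blast
    then show ?thesis using c[of p] by simp
  qed
  then have "integral (cball 0 r) (\<lambda>x. det (T' x)) =
      (\<Sum>s\<in>S. integral (cball 0 r) (\<lambda>x. c s * det (s *\<^sub>R mat 1 + T' x)))"
    by (simp only:) (intro integral_sum S(1) integrable_continuous_compact compact_cball continuous_intros continuous_on_det C)
  also have "\<dots> = (\<Sum>s\<in>S. c s * (s ^ ?N * ?V))"
    by (intro sum.cong refl) (simp add: integral_det_perturbed_identity[OF T r B'] SB)
  also have "\<dots> = (\<Sum>s\<in>S. c s * poly (monom 1 ?N) s) * ?V"
    by (simp add: sum_distrib_right poly_monom mult.assoc)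
  \<comment> \<open>Extrapolating the power function back to 0 gives 0, since the dimension is
    positive.\<close>
  also have "\<dots> = 0"
    by (subst c[symmetric]) (auto simp: poly_monom degree_monom_eq)
  finally show ?thesis .
qed

section \<open>Bump functions of class C1\<close>

text \<open>A simple C1 function that vanishes exactly on a half-line; class C1 is all the
  smoothness that the cutoffs must have.\<close>

definition pos_sq :: "real \<Rightarrow> real" where
  "pos_sq s = (max 0 s)\<^sup>2"

lemma pos_sq_has_real_derivative [derivative_intros]:
  "(pos_sq has_real_derivative 2 * max 0 s) (at s within S)"
proof -
  have "(pos_sq has_real_derivative 2 * max 0 s) (at s)"
  proof (cases "s = 0")
    case True
    have "((\<lambda>y. (pos_sq y - pos_sq 0) / (y - 0)) \<longlongrightarrow> 0) (at 0)"
    proof (rule Lim_null_comparison)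
      have "norm ((pos_sq y - pos_sq 0) / (y - 0)) \<le> \<bar>y\<bar>" for y :: real
        by (cases "y \<ge> 0") (auto simp: pos_sq_def power2_eq_square)
      then show "\<forall>\<^sub>F y in at 0. norm ((pos_sq y - pos_sq 0) / (y - 0)) \<le> \<bar>y\<bar>" by simp
      show "((\<lambda>y::real. \<bar>y\<bar>) \<longlongrightarrow> 0) (at 0)" by (auto intro!: tendsto_eq_intros)
    qed
    then show ?thesis using True by (simp add: has_field_derivative_iff)
  next
    case False
    then consider "s > 0" | "s < 0" by linarith
    then show ?thesis
    proof cases
      case 1
      have "((\<lambda>s. s\<^sup>2) has_real_derivative 2 * max 0 s) (at s)"
        using 1 by (auto intro!: derivative_eq_intros)
      then show ?thesis
        by (rule has_field_derivative_transform_within_open[where S = "{0<..}"])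
          (use 1 in \<open>auto simp: pos_sq_def\<close>)
    next
      case 2
      have "((\<lambda>s. 0) has_real_derivative 2 * max 0 s) (at s)"
        using 2 by (auto intro!: derivative_eq_intros)
      then show ?thesis
        by (rule has_field_derivative_transform_within_open[where S = "{..<0}"])
          (use 2 in \<open>auto simp: pos_sq_def\<close>)
    qed
  qed
  then show ?thesis by (rule has_field_derivative_at_within)
qed

lemma pos_sq_nonneg: "pos_sq s \<ge> 0"
  by (simp add: pos_sq_def)

lemma pos_sq_pos: "s > 0 \<Longrightarrow> pos_sq s > 0"
  by (simp add: pos_sq_def)

lemma pos_sq_eq_0: "s \<le> 0 \<Longrightarrow> pos_sq s = 0"
  by (simp add: pos_sq_def)

text \<open>A quadratic spline rising from 0 to 1 on the unit interval. Its derivative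
  \<open>tent\<close> is the hat function with base from 0 to 1, peak 2 at 1/2 and area 1.\<close>

definition step :: "real \<Rightarrow> real" where
  "step s = 2 * pos_sq s - 4 * pos_sq (s - 1/2) + 2 * pos_sq (s - 1)"

definition tent :: "real \<Rightarrow> real" where
  "tent s = 4 * max 0 s - 8 * max 0 (s - 1/2) + 4 * max 0 (s - 1)"

lemma step_has_real_derivative: "(step has_real_derivative tent s) (at s within S)"
proof -
  have shift: "((\<lambda>s. pos_sq (s - a)) has_real_derivative 2 * max 0 (s - a)) (at s within S)" for a
    by (rule DERIV_cong, rule DERIV_chain2[OF pos_sq_has_real_derivative])
      (auto intro!: derivative_eq_intros)
  show ?thesis
    unfolding step_def[abs_def] tent_def
    using shift[of 0] by (auto intro!: derivative_eq_intros shift)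
qed

lemma step_eq_0: "s \<le> 0 \<Longrightarrow> step s = 0" and step_eq_1: "s \<ge> 1 \<Longrightarrow> step s = 1"
  by (auto simp: step_def pos_sq_def max_def power2_eq_square algebra_simps)

lemma tent_eq_0: "s \<le> 0 \<or> 1 \<le> s \<Longrightarrow> tent s = 0"
  and tent_nonneg: "tent s \<ge> 0"
  and tent_pos: "0 < s \<Longrightarrow> s < 1 \<Longrightarrow> tent s > 0"
  by (auto simp: tent_def max_def)

lemma continuous_on_tent [continuous_intros]:
  "continuous_on S f \<Longrightarrow> continuous_on S (\<lambda>x. tent (f x))"
  unfolding tent_def by (intro continuous_intros)

lemma step_bounds: "0 \<le> step s" "step s \<le> 1"
proof -
  have mono: "step a \<le> step b" if "a \<le> b" for a b
    using DERIV_nonneg_imp_nondecreasing[OF that] step_has_real_derivative tent_nonneg by metis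
  show "0 \<le> step s" using mono[of "min 0 s" s] step_eq_0[of "min 0 s"] by simp
  show "step s \<le> 1" using mono[of s "max 1 s"] step_eq_1[of "max 1 s"] by simp
qed

lemma C1_bump:
  fixes x :: "'a::euclidean_space"
  shows "((\<lambda>y. pos_sq (r\<^sup>2 - (norm (y - x))\<^sup>2)) has_derivative
           (\<lambda>v. ((- 4 * max 0 (r\<^sup>2 - (norm (y - x))\<^sup>2)) *\<^sub>R (y - x)) \<bullet> v)) (at y)"
proof -
  have "((\<lambda>y. r\<^sup>2 - (norm (y - x))\<^sup>2) has_derivative (\<lambda>v. - 2 * ((y - x) \<bullet> v))) (at y)"
    unfolding power2_norm_eq_inner
    by (auto intro!: derivative_eq_intros simp: inner_commute)
  from has_derivative_compose[OF this, of pos_sq, OF pos_sq_has_real_derivative[unfolded has_field_derivative_def]]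
  show ?thesis by (simp add: o_def mult_ac)
qed

text \<open>Finitely many balls inside \<open>W\<close> cover \<open>L\<close>; the sum
  \<open>b\<close> of their bumps is positive on \<open>L\<close>, hence bounded below there by some
  \<delta>. Composing a multiple of \<open>b\<close> with \<open>step\<close> flattens it to the
  constant 1 near \<open>L\<close>.\<close>

lemma C1_cutoff:
  fixes L :: "'a::euclidean_space set"
  assumes "compact L" "open W" "L \<subseteq> W"
  obtains k k' U K where "open U" "L \<subseteq> U" "U \<subseteq> K" "compact K" "K \<subseteq> W"
    "\<And>x. (k has_derivative (\<lambda>v. k' x \<bullet> v)) (at x)" "continuous_on UNIV k'"
    "\<And>x. x \<in> U \<Longrightarrow> k x = 1" "\<And>x. x \<in> U \<Longrightarrow> k' x = 0"
    "\<And>x. x \<notin> K \<Longrightarrow> k x = 0" "\<And>x. x \<notin> K \<Longrightarrow> k' x = 0"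
    "\<And>x. 0 \<le> k x" "\<And>x. k x \<le> (1::real)"
proof -
  have "\<forall>x\<in>L. \<exists>r>0. cball x r \<subseteq> W"
    using assms by (meson open_contains_cball subsetD)
  then obtain r where r: "\<And>x. x \<in> L \<Longrightarrow> 0 < r x" "\<And>x. x \<in> L \<Longrightarrow> cball x (r x) \<subseteq> W" by metis
  obtain T where T: "T \<subseteq> L" "finite T" "L \<subseteq> (\<Union>x\<in>T. ball x (r x))"
  proof (rule compactE_image[OF assms(1), of L "\<lambda>x. ball x (r x)"])
    show "L \<subseteq> (\<Union>c\<in>L. ball c (r c))" using r(1) by force
  qed auto
  define b where "b y = (\<Sum>x\<in>T. pos_sq ((r x)\<^sup>2 - (norm (y - x))\<^sup>2))" for y
  define b' where "b' y = (\<Sum>x\<in>T. (- 4 * max 0 ((r x)\<^sup>2 - (norm (y - x))\<^sup>2)) *\<^sub>R (y - x))" for y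
  have b: "(b has_derivative (\<lambda>v. b' y \<bullet> v)) (at y)" for y
    unfolding b_def[abs_def] b'_def inner_sum_left by (intro has_derivative_sum C1_bump)
  have contb: "continuous_on S b" for S
    using b has_derivative_continuous by (blast intro: continuous_at_imp_continuous_on)
  define K where "K = (\<Union>x\<in>T. cball x (r x))"
  have bK: "b y = 0" if "y \<notin> K" for y
    unfolding b_def
  proof (intro sum.neutral ballI pos_sq_eq_0)
    fix x assume "x \<in> T"
    then have "r x < norm (y - x)" "0 < r x"
      using that T(1) r(1) by (auto simp: K_def dist_norm norm_minus_commute)
    then show "(r x)\<^sup>2 - (norm (y - x))\<^sup>2 \<le> 0" by (simp add: power_mono)
  qed
  have bpos: "b y > 0" if y: "y \<in> L" for y
  proof -
    obtain x where x: "x \<in> T" "norm (y - x) < r x"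
      using y T(3) by (auto simp: dist_norm norm_minus_commute)
    then have "0 < pos_sq ((r x)\<^sup>2 - (norm (y - x))\<^sup>2)"
      by (intro pos_sq_pos) (simp add: power_strict_mono)
    also have "\<dots> \<le> b y"
      unfolding b_def by (rule member_le_sum) (use x T pos_sq_nonneg in auto)
    finally show ?thesis .
  qed
  obtain \<delta> where \<delta>: "\<delta> > 0" "\<And>y. y \<in> L \<Longrightarrow> \<delta> \<le> b y"
  proof (cases "L = {}")
    case False
    then obtain x where "x \<in> L" "\<And>y. y \<in> L \<Longrightarrow> b x \<le> b y"
      using continuous_attains_inf[OF assms(1) _ contb] by blast
    then show ?thesis using that bpos by blast
  qed (use that[of 1] in auto)
  \<comment> \<open>The argument of \<open>step\<close> is \<open>b\<close> scaled by
    \<open>2 / \<delta>\<close>, so it exceeds 1 on this whole open neighbourhood of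
    \<open>L\<close>, and the gradient of the cutoff vanishes there too.\<close>
  define U where "U = {y. \<delta> / 2 < b y}"
  show ?thesis
  proof
    show "open U"
      unfolding U_def by (intro open_Collect_less continuous_intros contb)
    show "L \<subseteq> U" using \<delta> by (force simp: U_def)
    show "U \<subseteq> K" using bK \<delta>(1) by (force simp: U_def)
    show "compact K" unfolding K_def using T(2) by (intro compact_UN) auto
    show "K \<subseteq> W" unfolding K_def using T(1) r by blast
    show "((\<lambda>y. step (2 / \<delta> * b y)) has_derivative (\<lambda>v. ((tent (2 / \<delta> * b y) * (2 / \<delta>)) *\<^sub>R b' y) \<bullet> v)) (at y)" for y
    proof -
      have "((\<lambda>y. 2 / \<delta> * b y) has_derivative (\<lambda>v. 2 / \<delta> * (b' y \<bullet> v))) (at y)"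
        by (intro derivative_intros b)
      from has_derivative_compose[OF this, of step, OF step_has_real_derivative[unfolded has_field_derivative_def]]
      show ?thesis by (simp add: mult_ac)
    qed
    show "continuous_on UNIV (\<lambda>y. (tent (2 / \<delta> * b y) * (2 / \<delta>)) *\<^sub>R b' y)"
      unfolding b'_def by (intro continuous_intros contb)
    show "step (2 / \<delta> * b y) = 1" if "y \<in> U" for y
      using that \<delta>(1) by (intro step_eq_1) (simp add: U_def field_simps)
    show "(tent (2 / \<delta> * b y) * (2 / \<delta>)) *\<^sub>R b' y = 0" if "y \<in> U" for y
      using that \<delta>(1) tent_eq_0[of "2 / \<delta> * b y"] by (simp add: U_def field_simps)
    show "step (2 / \<delta> * b y) = 0" if "y \<notin> K" for y
      using bK[OF that] by (simp add: step_eq_0)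
    show "(tent (2 / \<delta> * b y) * (2 / \<delta>)) *\<^sub>R b' y = 0" if "y \<notin> K" for y
      using bK[OF that] by (simp add: tent_eq_0)
  qed (rule step_bounds)+
qed

text \<open>Multiplied by a cutoff that is 1 near \<open>L\<close> and extended by 0, both maps
  become compactly supported, so their Jacobian determinants have integral 0. These determinants
  agree off \<open>L\<close>, hence the parts over \<open>L\<close> agree, and there the cutoff is
  invisible.\<close>

lemma integral_det_eq_if_eq_off_compact:
  fixes T0 :: "real^'n::{finite,wellorder} \<Rightarrow> real^'n::_"
  assumes W: "open W" and L: "compact L" "L \<subseteq> W"
    and T0: "C1_map T0 T0' W" and T1: "C1_map T1 T1' W"
    and eq: "\<And>x. x \<in> W - L \<Longrightarrow> T0 x = T1 x"
  shows "integral L (\<lambda>x. det (T0' x)) = integral L (\<lambda>x. det (T1' x))"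
proof -
  obtain k k' U K where U: "open U" "L \<subseteq> U" "U \<subseteq> K" "compact K" "K \<subseteq> W"
    and k: "\<And>x. (k has_derivative (\<lambda>v. k' x \<bullet> v)) (at x)" "continuous_on UNIV k'"
    and kU: "\<And>x. x \<in> U \<Longrightarrow> k x = 1" "\<And>x. x \<in> U \<Longrightarrow> k' x = 0"
    and kK: "\<And>x. x \<notin> K \<Longrightarrow> k x = 0" "\<And>x. x \<notin> K \<Longrightarrow> k' x = 0"
    by (rule C1_cutoff[OF L(1) W L(2)], rule that) assumption+
  define E where "E T x = (if x \<in> W then k x *\<^sub>R T x else 0)" for T :: "(real,'n::_) vec \<Rightarrow> (real,'n::_) vec" and x
  define E' where "E' T T' x = (if x \<in> W then k x *\<^sub>R T' x + outer_product (T x) (k' x) else 0)"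
    for T :: "(real,'n::_) vec \<Rightarrow> (real,'n::_) vec" and T' :: "(real,'n::_) vec \<Rightarrow> ((real,'n::_) vec,'n::_) vec" and x
  have E: "C1_map (E T) (E' T T') UNIV" if T: "C1_map T T' W" for T T'
  proof -
    have "C1_map (\<lambda>x. k x *\<^sub>R T x) (\<lambda>x. k x *\<^sub>R T' x + outer_product (T x) (k' x)) W"
      using continuous_on_subset[OF k(2)] by (intro C1_map_scaleR T k(1)) auto
    from C1_map_cong_open[OF this W, of "E T"]
    have "C1_map (E T) (\<lambda>x. k x *\<^sub>R T' x + outer_product (T x) (k' x)) W"
      by (simp add: E_def)
    then have 1: "C1_map (E T) (E' T T') W"
      by (rule C1_map_deriv_cong) (simp add: E'_def)
    have z: "E T x = 0" "E' T T' x = 0" if "x \<in> - K" for x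
      using that kK[of x] by (auto simp: E_def E'_def outer_product_def vec_eq_iff)
    have K: "open (- K)" using U(4) compact_imp_closed by blast
    from C1_map_cong_open[OF C1_map_const[of 0] K, of "E T"]
    have "C1_map (E T) (\<lambda>x. 0) (- K)" using z(1) by simp
    then have 2: "C1_map (E T) (E' T T') (- K)"
      by (rule C1_map_deriv_cong) (simp add: z(2))
    have "W \<union> - K = UNIV" using U(5) by blast
    then show ?thesis using C1_map_Un[OF 1 2 W K] by simp
  qed
  obtain r where r: "K \<subseteq> cball 0 r"
    using compact_imp_bounded[OF U(4)] unfolding bounded_iff by (auto simp: subset_iff)
  have zero: "integral (cball 0 r) (\<lambda>x. det (E' T T' x)) = 0" if "C1_map T T' W" for T T'
  proof (rule integral_det_compact_support[OF E[OF that]])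
    fix x :: "real^'n::_" assume "norm x > r"
    then have "x \<notin> K" using r by auto
    then show "E T x = 0" using kK by (simp add: E_def)
  qed
  have cont: "continuous_on S (\<lambda>x. det (E' T T' x))" if "C1_map T T' W" for T T' S
    using continuous_on_det[OF C1_mapD(2)[OF E[OF that]]] continuous_on_subset by blast
  let ?d = "\<lambda>x. det (E' T0 T0' x) - det (E' T1 T1' x)"
  \<comment> \<open>Off the closed set \<open>L\<close> the two extensions coincide on an open set,
    so their derivatives coincide as well.\<close>
  have d0: "?d x = 0" if "x \<notin> L" for x
  proof -
    have o: "open (- L)" using L(1) compact_imp_closed by blast
    have "E T1 x = E T0 x" if "x \<in> - L" for x
      using that eq by (simp add: E_def)
    from C1_map_deriv_unique[OF C1_map_subset[OF E[OF T0]] C1_map_subset[OF E[OF T1]] o this, of x]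
    show ?thesis using that by simp
  qed
  have int: "(\<lambda>x. det (E' T T' x)) integrable_on S" if "C1_map T T' W" "compact S" for T T' S
    using cont[OF that(1)] that(2) by (rule integrable_continuous_compact[rotated])
  have "(?d has_integral integral L ?d) (cball 0 r)"
    by (rule has_integral_on_superset[OF integrable_integral _ _])
      (use r U d0 int[OF T0 L(1)] int[OF T1 L(1)] in \<open>auto intro!: integrable_diff\<close>)
  then have "integral L ?d = integral (cball 0 r) ?d"
    by (simp add: integral_unique)
  also have "\<dots> = 0"
    using zero[OF T0] zero[OF T1] int[OF T0 compact_cball] int[OF T1 compact_cball]
    by (simp add: integral_diff)
  finally have "integral L (\<lambda>x. det (E' T0 T0' x)) = integral L (\<lambda>x. det (E' T1 T1' x))"
    using int[OF T0 L(1)] int[OF T1 L(1)] by (simp add: integral_diff)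
  moreover have "E' T T' x = T' x" if "x \<in> L" for T T' x
    using that U(2) L(2) kU[of x] by (auto simp: E'_def outer_product_def vec_eq_iff)
  ultimately show ?thesis
    by (simp cong: integral_cong)
qed

section \<open>Integrals of bump functions against Jacobian determinants\<close>

lemma integral_pos_if_pos_at_interior:
  fixes f :: "'a::euclidean_space \<Rightarrow> real"
  assumes L: "compact L" and f: "continuous_on L f" "\<And>x. x \<in> L \<Longrightarrow> 0 \<le> f x"
    and x: "x \<in> interior L" "f x > 0"
  shows "integral L f > 0"
proof -
  obtain a b where ab: "x \<in> box a b" "cbox a b \<subseteq> interior L"
    using open_contains_cbox[OF open_interior x(1)] by metis
  then have sub: "cbox a b \<subseteq> L" using interior_subset by blast
  have fi: "f integrable_on L" "f integrable_on cbox a b"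
    using f(1) continuous_on_subset[OF f(1) sub] L by (auto intro: integrable_continuous_compact)
  have "0 \<le> integral (cbox a b) f"
    using sub f(2) by (intro integral_nonneg fi) auto
  moreover have "integral (cbox a b) f \<noteq> 0"
  proof
    assume "integral (cbox a b) f = 0"
    then have "(f has_integral 0) (cbox a b)" using fi(2) by (metis integrable_integral)
    then have "f x = 0"
      using has_integral_0_cbox_imp_0[of a b f x] continuous_on_subset[OF f(1) sub] f(2) sub ab(1)
        box_subset_cbox by blast
    then show False using x(2) by simp
  qed
  moreover have "integral (cbox a b) f \<le> integral L f"
    by (rule integral_subset_le[OF sub fi(2,1)]) (use f in auto)
  ultimately show ?thesis by linarith
qed

text \<open>Made so that its Jacobian determinant is a bump function:
  \<open>bump c \<delta> (F x) * det (F' x)\<close> is then itself the Jacobian determinant of a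
  composite map, and the comparison of such integrals applies. The shift 1/2 puts the peak of each
  \<open>tent\<close> at \<open>c\<close>.\<close>

definition bump_map :: "real^'n \<Rightarrow> real \<Rightarrow> real^'n \<Rightarrow> real^'n" where
  "bump_map c \<delta> y = (\<chi> j. step (CARD('n) / \<delta> * (y $ j - c $ j) + 1/2))"

definition bump_jacobian :: "real^'n \<Rightarrow> real \<Rightarrow> real^'n \<Rightarrow> real^'n^'n" where
  "bump_jacobian c \<delta> y = (\<chi> i j. if i = j then CARD('n) / \<delta> * tent (CARD('n) / \<delta> * (y $ j - c $ j) + 1/2) else 0)"

definition bump :: "real^'n \<Rightarrow> real \<Rightarrow> real^'n \<Rightarrow> real" where
  "bump c \<delta> y = (\<Prod>j\<in>UNIV. CARD('n) / \<delta> * tent (CARD('n) / \<delta> * (y $ j - c $ j) + 1/2))"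

lemma det_bump_jacobian: "det (bump_jacobian c \<delta> y) = bump c \<delta> y"
  unfolding bump_jacobian_def bump_def by (subst det_diagonal) auto

lemma C1_map_bump_map:
  fixes c :: "real^'n"
  shows "C1_map (bump_map c \<delta>) (bump_jacobian c \<delta>) UNIV"
  unfolding C1_map_def
proof (intro conjI ballI)
  fix y :: "real^'n"
  show "(bump_map c \<delta> has_derivative (\<lambda>v. bump_jacobian c \<delta> y *v v)) (at y)"
  proof (subst has_derivative_componentwise_within, intro ballI)
    fix b :: "real^'n" assume "b \<in> Basis"
    then obtain j where b: "b = axis j 1" by (auto simp: Basis_vec_def)
    let ?t = "\<lambda>y::real^'n. CARD('n) / \<delta> * (y $ j - c $ j) + 1/2"
    have "((\<lambda>y::real^'n. C * (y $ j - c $ j) + 1/2) has_derivative (\<lambda>v. C * v $ j)) (at y)" for C :: real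
      by (auto intro!: derivative_eq_intros bounded_linear_imp_has_derivative)
    then have "(?t has_derivative (\<lambda>v. CARD('n) / \<delta> * v $ j)) (at y)" .
    from has_derivative_compose[OF this, of step, OF step_has_real_derivative[unfolded has_field_derivative_def]]
    have "((\<lambda>y. step (?t y)) has_derivative (\<lambda>v. tent (?t y) * (CARD('n) / \<delta> * v $ j))) (at y)"
      by simp
    moreover have "(bump_jacobian c \<delta> y *v v) \<bullet> b = tent (?t y) * (CARD('n) / \<delta> * v $ j)" for v
      by (simp add: b inner_axis matrix_vector_mult_def bump_jacobian_def if_distrib[where f="\<lambda>z. z * _"] cong: if_cong)
    ultimately show "((\<lambda>y. bump_map c \<delta> y \<bullet> b) has_derivative (\<lambda>v. (bump_jacobian c \<delta> y *v v) \<bullet> b)) (at y)"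
      by (simp add: b inner_axis bump_map_def)
  qed
next
  show "continuous_on UNIV (bump_jacobian c \<delta>)"
    unfolding bump_jacobian_def[abs_def]
  proof (rule continuous_on_vec_lambda, rule continuous_on_vec_lambda)
    show "continuous_on UNIV (\<lambda>y. if i = j then CARD('n) / \<delta> * tent (CARD('n) / \<delta> * (y $ j - c $ j) + 1/2) else 0)" for i j
    proof (cases "i = j")
      case True
      show ?thesis unfolding if_P[OF True] by (intro continuous_intros)
    qed simp
  qed
qed

lemma continuous_on_bump [continuous_intros]:
  assumes "continuous_on S f"
  shows "continuous_on S (\<lambda>x. bump c \<delta> (f x))"
  unfolding bump_def by (intro continuous_intros assms)

lemma bump_nonneg: "\<delta> > 0 \<Longrightarrow> bump c \<delta> y \<ge> 0"
  unfolding bump_def by (intro prod_nonneg ballI mult_nonneg_nonneg tent_nonneg) auto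

lemma bump_center_pos: "\<delta> > 0 \<Longrightarrow> bump c \<delta> c > 0"
  unfolding bump_def by (intro prod_pos ballI mult_pos_pos tent_pos) auto

text \<open>The support is a small cube around \<open>c\<close>. Since the Euclidean norm is at most
  the sum of the coordinates, the scaling by \<open>CARD('n)\<close> places the cube inside the ball
  of radius \<delta>.\<close>

lemma bump_eq_0:
  fixes c :: "real^'n"
  assumes "\<delta> > 0" "dist y c \<ge> \<delta>"
  shows "bump c \<delta> y = 0"
proof -
  have "\<exists>j. \<delta> / CARD('n) \<le> \<bar>(y - c) $ j\<bar>"
  proof (rule ccontr)
    assume "\<not> ?thesis"
    then have "(\<Sum>j\<in>(UNIV :: 'n set). \<bar>(y - c) $ j\<bar>) < (\<Sum>j\<in>(UNIV :: 'n set). \<delta> / CARD('n))"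
      by (intro sum_strict_mono) (auto simp: not_le)
    then have "norm (y - c) < \<delta>"
      using norm_le_l1_cart[of "y - c"] by simp
    then show False using assms(2) by (simp add: dist_norm)
  qed
  then obtain j where "\<delta> / CARD('n) \<le> \<bar>(y - c) $ j\<bar>" by blast
  then have "1 \<le> CARD('n) / \<delta> * \<bar>y $ j - c $ j\<bar>"
    using assms(1) by (simp add: field_simps)
  then have "1 \<le> \<bar>CARD('n) / \<delta> * (y $ j - c $ j)\<bar>"
    using assms(1) by (simp add: abs_mult)
  then have "CARD('n) / \<delta> * (y $ j - c $ j) + 1/2 \<le> 0 \<or> 1 \<le> CARD('n) / \<delta> * (y $ j - c $ j) + 1/2"
    by linarith
  then have "tent (CARD('n) / \<delta> * (y $ j - c $ j) + 1/2) = 0"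
    by (rule tent_eq_0)
  then show ?thesis
    unfolding bump_def by (intro prod_zero) auto
qed

text \<open>Both sides are integrals of Jacobian determinants, of \<open>bump_map c \<delta> \<circ> F\<close> and of
  \<open>bump_map c \<delta> \<circ> h \<circ> F\<close>.\<close>

lemma integral_bump_transport:
  fixes F :: "real^'n::{finite,wellorder} \<Rightarrow> real^'n::_"
  assumes "open W" "compact L" "L \<subseteq> W" and F: "C1_map F F' W" and h: "C1_map h h' UNIV"
    and eq: "\<And>x. x \<in> W - L \<Longrightarrow> h (F x) = F x"
  shows "integral L (\<lambda>x. bump c \<delta> (F x) * det (F' x)) =
         integral L (\<lambda>x. bump c \<delta> (h (F x)) * (det (h' (F x)) * det (F' x)))"
proof -
  have hF: "C1_map (\<lambda>x. h (F x)) (\<lambda>x. h' (F x) ** F' x) W"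
    by (rule C1_map_compose[OF F h]) simp
  have "integral L (\<lambda>x. det (bump_jacobian c \<delta> (F x) ** F' x)) =
        integral L (\<lambda>x. det (bump_jacobian c \<delta> (h (F x)) ** (h' (F x) ** F' x)))"
    by (rule integral_det_eq_if_eq_off_compact[OF assms(1-3)
          C1_map_compose[OF F C1_map_bump_map] C1_map_compose[OF hF C1_map_bump_map]])
      (use eq in auto)
  then show ?thesis by (simp add: det_mul det_bump_jacobian)
qed

text \<open>The translation by \<open>b - a\<close> is switched on by a bump \<open>k\<close> with
  \<open>k a = 1\<close> and gradient at most \<open>4 / \<rho>\<close>. With
  \<open>dist a b\<close> at most \<open>\<rho> / 8\<close> the perturbation of the identity has
  Lipschitz constant 1/2. This yields both the positive determinant and the factor 2 in the last
  estimate.\<close>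

lemma C1_push:
  fixes a b :: "real^'n"
  assumes \<rho>: "\<rho> > 0" and ab: "dist a b \<le> \<rho> / 8"
  obtains h h' where "C1_map h h' UNIV" "h a = b" "\<And>y. dist y a \<ge> \<rho> \<Longrightarrow> h y = y"
    "\<And>y. det (h' y) > 0" "\<And>y. dist y a \<le> 2 * dist (h y) b"
proof -
  \<comment> \<open>\<open>pos_sq (\<rho>\<^sup>2)\<close> equals \<open>\<rho> ^ 4\<close>, hence
    the normalization.\<close>
  define k where "k y = pos_sq (\<rho>\<^sup>2 - (norm (y - a))\<^sup>2) / \<rho> ^ 4" for y
  define k' where "k' y = (- 4 * max 0 (\<rho>\<^sup>2 - (norm (y - a))\<^sup>2) / \<rho> ^ 4) *\<^sub>R (y - a)" for y
  have k: "(k has_derivative (\<lambda>v. k' y \<bullet> v)) (at y)" for y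
    unfolding k_def[abs_def] k'_def
    using has_derivative_mult_right[OF C1_bump[of \<rho> a y], of "1 / \<rho> ^ 4"] by simp
  have k'_le: "norm (k' y) \<le> 4 / \<rho>" for y
  proof (cases "norm (y - a) < \<rho>")
    case True
    have "max 0 (\<rho>\<^sup>2 - (norm (y - a))\<^sup>2) * norm (y - a) \<le> \<rho>\<^sup>2 * \<rho>"
      using True \<rho> by (intro mult_mono) auto
    then have "4 * max 0 (\<rho>\<^sup>2 - (norm (y - a))\<^sup>2) / \<rho> ^ 4 * norm (y - a) \<le> 4 * (\<rho>\<^sup>2 * \<rho>) / \<rho> ^ 4"
      using \<rho> by (simp add: divide_right_mono)
    also have "\<dots> = 4 / \<rho>" using \<rho> by (simp add: field_simps power2_eq_square power4_eq_xxxx)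
    finally show ?thesis using \<rho> by (simp add: k'_def abs_mult)
  next
    case False
    then have "\<rho>\<^sup>2 \<le> (norm (y - a))\<^sup>2" using \<rho> by (simp add: power_mono)
    then show ?thesis using \<rho> by (simp add: k'_def)
  qed
  have k_lip: "norm (k y - k z) \<le> 4 / \<rho> * norm (y - z)" for y z
  proof (rule differentiable_bound[OF convex_UNIV])
    show "(k has_derivative (\<lambda>v. k' z \<bullet> v)) (at z within UNIV)" for z
      using k by simp
    show "onorm (\<lambda>v. k' z \<bullet> v) \<le> 4 / \<rho>" for z
    proof (rule onorm_le)
      show "norm (k' z \<bullet> v) \<le> 4 / \<rho> * norm v" for v
        using Cauchy_Schwarz_ineq2[of "k' z" v] mult_right_mono[OF k'_le norm_ge_zero, of z v] by simp
    qed
  qed auto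
  have ab': "norm (b - a) \<le> \<rho> / 8" using ab by (simp add: dist_norm norm_minus_commute)
  define h where "h y = y + k y *\<^sub>R (b - a)" for y
  define h' where "h' y = mat 1 + outer_product (b - a) (k' y)" for y
  show ?thesis
  proof
    have "continuous_on UNIV k'"
      unfolding k'_def by (intro continuous_intros) (use \<rho> in auto)
    from C1_map_add[OF C1_map_id C1_map_scaleR[OF C1_map_const[of "b - a"] k this]]
    show "C1_map h h' UNIV" unfolding h_def[abs_def] h'_def[abs_def] by simp
    have ka: "k a = 1" using \<rho> by (simp add: k_def pos_sq_def)
    then show ha: "h a = b" by (simp add: h_def)
    show "h y = y" if "dist y a \<ge> \<rho>" for y
    proof -
      have "\<rho>\<^sup>2 \<le> (norm (y - a))\<^sup>2" using that \<rho> by (simp add: power_mono dist_norm)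
      then show ?thesis by (simp add: h_def k_def pos_sq_eq_0)
    qed
    show "det (h' y) > 0" for y
      unfolding h'_def
    proof (rule det_mat1_add_pos)
      fix v :: "real^'n" assume v: "v \<noteq> 0"
      have "norm (outer_product (b - a) (k' y) *v v) = \<bar>k' y \<bullet> v\<bar> * norm (b - a)"
        by (simp add: outer_product_mult)
      also have "\<dots> \<le> (4 / \<rho> * norm v) * (\<rho> / 8)"
        using Cauchy_Schwarz_ineq2[of "k' y" v] mult_right_mono[OF k'_le norm_ge_zero, of y v] ab' \<rho>
        by (intro mult_mono) auto
      also have "\<dots> < norm v" using \<rho> v by simp
      finally show "norm (outer_product (b - a) (k' y) *v v) < norm v" .
    qed
    show "dist y a \<le> 2 * dist (h y) b" for y
    proof -
      have "y - a = (h y - b) - (k y - k a) *\<^sub>R (b - a)"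
        by (simp add: h_def ka algebra_simps)
      then have "norm (y - a) \<le> norm (h y - b) + \<bar>k y - k a\<bar> * norm (b - a)"
        using norm_triangle_ineq4[of "h y - b" "(k y - k a) *\<^sub>R (b - a)"] by simp
      also have "\<bar>k y - k a\<bar> * norm (b - a) \<le> (4 / \<rho> * norm (y - a)) * (\<rho> / 8)"
        using k_lip[of y a] ab' \<rho> by (intro mult_mono) auto
      finally show ?thesis using \<rho> by (simp add: dist_norm)
    qed
  qed
qed

lemma continuous_on_bump_det:
  fixes F :: "real^'n::{finite,wellorder} \<Rightarrow> real^'n::_"
  assumes F: "C1_map F F' W" and L: "L \<subseteq> W"
  shows "continuous_on L (\<lambda>x. bump c \<delta> (F x) * det (F' x))"
proof -
  have "continuous_on L F" "continuous_on L F'"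
    using C1_mapD(2,3)[OF F, THEN continuous_on_subset, OF L] by blast+
  then show ?thesis by (intro continuous_intros continuous_on_det)
qed

lemma continuous_on_bump_det_transport:
  fixes F :: "real^'n::{finite,wellorder} \<Rightarrow> real^'n::_"
  assumes F: "C1_map F F' W" and h: "C1_map h h' UNIV" and L: "L \<subseteq> W"
  shows "continuous_on L (\<lambda>x. bump c \<delta> (h (F x)) * (det (h' (F x)) * det (F' x)))"
  using continuous_on_bump_det[OF C1_map_compose[OF F h] L, of c \<delta>] by (simp add: det_mul)

section \<open>The sign of the Jacobian determinant of an injective map\<close>

lemma open_det_set:
  fixes F :: "real^'n \<Rightarrow> real^'n"
  assumes "C1_map F F' W" "open W"
  shows "open {x \<in> W. det (F' x) > 0}" "open {x \<in> W. det (F' x) < 0}" "open {x \<in> W. det (F' x) \<noteq> 0}"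
proof -
  have c: "continuous_on W (\<lambda>x. det (F' x))"
    by (rule continuous_on_det[OF C1_mapD(2)[OF assms(1)]])
  have eq: "{x \<in> W. det (F' x) \<in> A} = W \<inter> (\<lambda>x. det (F' x)) -` A" for A by auto
  have o: "open {x \<in> W. det (F' x) \<in> A}" if "open A" for A
    using continuous_open_preimage[OF c assms(2) that] unfolding eq .
  show "open {x \<in> W. det (F' x) > 0}" using o[of "{0<..}"] by simp
  show "open {x \<in> W. det (F' x) < 0}" using o[of "{..<0}"] by simp
  show "open {x \<in> W. det (F' x) \<noteq> 0}" using o[of "-{0}"] by (simp add: open_Compl)
qed

text \<open>A bump near the image of a point \<open>x2\<close> with negative determinant has a
  negative integral against \<open>det F'\<close>: by injectivity its support is reached only from
  the negative set. Pushing the bump to the image of a nearby point \<open>x1\<close> with positive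
  determinant makes the integral nonnegative, although transport leaves its value unchanged.\<close>

lemma inj_imp_det_sign_constant:
  fixes F :: "real^'n::{finite,wellorder} \<Rightarrow> real^'n::_"
  assumes F: "C1_map F F' V" and V: "open V" "x0 \<in> V" and inj: "inj_on F V"
    and pos: "x0 \<in> closure {x \<in> V. det (F' x) > 0}" and neg: "x0 \<in> closure {x \<in> V. det (F' x) < 0}"
  shows False
proof -
  have contF: "continuous_on S F" if "S \<subseteq> V" for S
    using continuous_on_subset[OF C1_mapD(3)[OF F] that] .
  have openF: "open (F ` S)" if "open S" "S \<subseteq> V" for S
    using invariance_of_domain[OF contF] that inj inj_on_subset by blast
  obtain r where r: "r > 0" "cball x0 r \<subseteq> V" using V open_contains_cball by blast
  then have rb: "ball x0 r \<subseteq> V" using ball_subset_cball by blast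
  obtain \<rho>' where "\<rho>' > 0" "cball (F x0) \<rho>' \<subseteq> F ` ball x0 r"
    using openF[OF open_ball rb] r(1) by (meson centre_in_ball imageI open_contains_cball)
  \<comment> \<open>Injectivity sends points outside \<open>ball x0 r\<close> farther than
    \<open>2 * \<rho>\<close> from \<open>F x0\<close>, hence at least \<rho> away from
    \<open>F x1\<close>, where the push is the identity.\<close>
  then obtain \<rho> where \<rho>: "\<rho> > 0" "cball (F x0) (2 * \<rho>) \<subseteq> F ` ball x0 r"
    by (metis half_gt_zero mult_2 field_sum_of_halves)
  have "open (ball x0 r \<inter> F -` ball (F x0) (\<rho> / 16))"
    by (rule continuous_open_preimage[OF contF[OF rb]]) auto
  moreover have "x0 \<in> ball x0 r \<inter> F -` ball (F x0) (\<rho> / 16)" using r \<rho> by simp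
  ultimately have near: "\<exists>x\<in>S. x \<in> ball x0 r \<and> dist (F x0) (F x) < \<rho> / 16" if "x0 \<in> closure S" for S
    using that open_Int_closure_eq_empty[of "ball x0 r \<inter> F -` ball (F x0) (\<rho> / 16)" S]
    by (auto simp: disjoint_iff)
  obtain x1 x2 where x1: "x1 \<in> V" "det (F' x1) > 0" "x1 \<in> ball x0 r" "dist (F x0) (F x1) < \<rho> / 16"
    and x2: "x2 \<in> V" "det (F' x2) < 0" "x2 \<in> ball x0 r" "dist (F x0) (F x2) < \<rho> / 16"
    using near[OF pos] near[OF neg] by blast
  let ?P = "{x \<in> V. det (F' x) > 0} \<inter> ball x0 r" and ?N = "{x \<in> V. det (F' x) < 0} \<inter> ball x0 r"
  have "open (F ` ?P)" "open (F ` ?N)"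
    using open_det_set[OF F V(1)] by (auto intro!: openF)
  moreover have "F x1 \<in> F ` ?P" "F x2 \<in> F ` ?N"
    using x1(1-3) x2(1-3) by blast+
  ultimately obtain d1 d2 where d1: "d1 > 0" "ball (F x1) d1 \<subseteq> F ` ?P"
    and d2: "d2 > 0" "ball (F x2) d2 \<subseteq> F ` ?N"
    by (elim openE)
  \<comment> \<open>\<open>d \<le> d2\<close> keeps the support of the bump inside the image of the
    negative set. \<open>2 * d \<le> d1\<close> does the same for the pulled-back bump and the
    positive set, as the push shrinks distances to its centre by at most the factor 2.\<close>
  define d where "d = min (d1 / 2) d2"
  have d: "d > 0" "2 * d \<le> d1" "d \<le> d2" using d1 d2 by (auto simp: d_def)
  have "dist (F x1) (F x2) \<le> \<rho> / 8"
    using x1(4) x2(4) dist_triangle[of "F x1" "F x2" "F x0"] by (simp add: dist_commute)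
  then obtain h h' where h: "C1_map h h' UNIV" "h (F x1) = F x2" "\<And>y. dist y (F x1) \<ge> \<rho> \<Longrightarrow> h y = y"
    "\<And>y. det (h' y) > 0" "\<And>y. dist y (F x1) \<le> 2 * dist (h y) (F x2)"
    using C1_push[OF \<rho>(1)] by metis
  let ?L = "cball x0 r"
  have eq: "integral ?L (\<lambda>x. bump (F x2) d (F x) * det (F' x)) =
      integral ?L (\<lambda>x. bump (F x2) d (h (F x)) * (det (h' (F x)) * det (F' x)))"
  proof (rule integral_bump_transport[OF V(1) compact_cball r(2) F h(1)])
    fix x assume x: "x \<in> V - cball x0 r"
    have "F x \<notin> F ` ball x0 r"
      using x inj_on_image_mem_iff[OF inj _ rb, of x] by auto
    then have "dist (F x0) (F x) > 2 * \<rho>" using \<rho>(2) by (meson mem_cball not_le subsetD)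
    then have "dist (F x) (F x1) \<ge> \<rho>"
      using x1(4) dist_triangle[of "F x0" "F x" "F x1"] \<rho>(1) by (simp add: dist_commute)
    then show "h (F x) = F x" by (rule h(3))
  qed
  have neg: "bump (F x2) d (F x) * det (F' x) \<le> 0" if "x \<in> ?L" for x
  proof (cases "dist (F x) (F x2) < d")
    case True
    then have "F x \<in> ball (F x2) d2" using d(3) by (simp add: dist_commute)
    then have "F x \<in> F ` ?N" using d2(2) by blast
    moreover have "x \<in> V" using that r(2) by blast
    ultimately have "x \<in> ?N" using inj_on_image_mem_iff[OF inj, of x ?N] by blast
    then have "det (F' x) < 0" by blast
    then show ?thesis using bump_nonneg[OF d(1)] by (intro mult_nonneg_nonpos) auto
  qed (use bump_eq_0[OF d(1), of "F x" "F x2"] in simp)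
  have "integral ?L (\<lambda>x. - (bump (F x2) d (F x) * det (F' x))) > 0"
  proof (rule integral_pos_if_pos_at_interior[of _ _ x2])
    show "continuous_on ?L (\<lambda>x. - (bump (F x2) d (F x) * det (F' x)))"
      by (intro continuous_intros continuous_on_bump_det[OF F r(2)])
    show "- (bump (F x2) d (F x2) * det (F' x2)) > 0"
      using mult_pos_neg[OF bump_center_pos[OF d(1)] x2(2)] by simp
    show "x2 \<in> interior (cball x0 r)" using x2(3) by simp
  qed (use neg in auto)
  moreover have "integral ?L (\<lambda>x. bump (F x2) d (h (F x)) * (det (h' (F x)) * det (F' x))) \<ge> 0"
  proof (rule integral_nonneg)
    show "(\<lambda>x. bump (F x2) d (h (F x)) * (det (h' (F x)) * det (F' x))) integrable_on ?L"
      by (intro integrable_continuous_compact compact_cball continuous_on_bump_det_transport[OF F h(1) r(2)])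
    fix x assume x: "x \<in> ?L"
    show "0 \<le> bump (F x2) d (h (F x)) * (det (h' (F x)) * det (F' x))"
    proof (cases "dist (h (F x)) (F x2) < d")
      case True
      then have "dist (F x) (F x1) < d1" using h(5)[of "F x"] d by linarith
      then have "F x \<in> ball (F x1) d1" by (simp add: dist_commute)
      then have "F x \<in> F ` ?P" using d1(2) by blast
      moreover have "x \<in> V" using x r(2) by blast
      ultimately have "x \<in> ?P" using inj_on_image_mem_iff[OF inj, of x ?P] by blast
      then have "det (F' x) > 0" by blast
      then show ?thesis using bump_nonneg[OF d(1)] h(4)
        by (intro mult_nonneg_nonneg) (auto intro: less_imp_le)
    qed (use bump_eq_0[OF d(1), of "h (F x)" "F x2"] in simp)
  qed
  ultimately show False using eq by (simp add: integral_neg)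
qed

section \<open>Maps properly homotopic to the identity\<close>

text \<open>Uniform properness of the straight-line homotopy from the identity to \<open>F\<close>.
  Values outside \<open>D\<close> are allowed, so only compact sets inside \<open>D\<close> are
  tested.\<close>

definition proper_homotopy_to_id :: "'a::euclidean_space set \<Rightarrow> ('a \<Rightarrow> 'a) \<Rightarrow> bool" where
  "proper_homotopy_to_id D F \<longleftrightarrow>
     (\<forall>K. compact K \<and> K \<subseteq> D \<longrightarrow>
        (\<exists>C. compact C \<and> C \<subseteq> D \<and> (\<forall>x\<in>D. \<forall>t. 0 \<le> t \<and> t \<le> 1 \<and> x + t *\<^sub>R (F x - x) \<in> K \<longrightarrow> x \<in> C)))"

lemma proper_homotopy_to_idE:
  assumes "proper_homotopy_to_id D F" "compact K" "K \<subseteq> D"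
  obtains C where "compact C" "C \<subseteq> D" "K \<subseteq> C" "\<And>x. x \<in> D \<Longrightarrow> F x \<in> K \<Longrightarrow> x \<in> C"
    "\<And>x t. x \<in> D \<Longrightarrow> 0 \<le> t \<Longrightarrow> t \<le> 1 \<Longrightarrow> x + t *\<^sub>R (F x - x) \<in> K \<Longrightarrow> x \<in> C"
proof -
  obtain C where C: "compact C" "C \<subseteq> D"
    "\<And>x t. x \<in> D \<Longrightarrow> 0 \<le> t \<Longrightarrow> t \<le> 1 \<Longrightarrow> x + t *\<^sub>R (F x - x) \<in> K \<Longrightarrow> x \<in> C"
    using assms unfolding proper_homotopy_to_id_def by metis
  show ?thesis
  proof (rule that[OF C(1,2)])
    show "K \<subseteq> C" using C(3)[of _ 0] assms(3) by auto
    show "x \<in> C" if "x \<in> D" "F x \<in> K" for x using C(3)[of x 1] that by simp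
  qed (rule C(3))
qed

lemma compact_preimage_proper:
  fixes F :: "'a::euclidean_space \<Rightarrow> 'a"
  assumes hom: "proper_homotopy_to_id D F" and F: "continuous_on D F" and K: "compact K" "K \<subseteq> D"
  shows "compact {x \<in> D. F x \<in> K}"
proof -
  obtain C where C: "compact C" "C \<subseteq> D" "\<And>x. x \<in> D \<Longrightarrow> F x \<in> K \<Longrightarrow> x \<in> C"
    using proper_homotopy_to_idE[OF hom K] by metis
  have "{x \<in> D. F x \<in> K} = C \<inter> F -` K" using C by auto
  moreover have "closed (C \<inter> F -` K)"
    using C K F continuous_on_subset by (blast intro: continuous_closed_preimage compact_imp_closed)
  ultimately show ?thesis using C(1) by (metis compact_Int_closed inf_left_idem)
qed

text \<open>The statement that the degree is 1. A cutoff \<open>k\<close> used as a space-dependent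
  homotopy time gives a map \<open>g\<close> that is \<open>F\<close> near \<open>C\<close> and the
  identity off the compact set \<open>L\<close>; the comparison lemma is applied to \<open>g\<close>
  and the identity.\<close>

lemma integral_bump_proper:
  fixes F :: "real^'n::{finite,wellorder} \<Rightarrow> real^'n::_"
  assumes D: "open D" and F: "C1_map F F' D" and hom: "proper_homotopy_to_id D F"
    and c: "\<delta> > 0" "cball c \<delta> \<subseteq> D"
  obtains L where "compact L" "L \<subseteq> D" "cball c \<delta> \<subseteq> L" "\<And>x. x \<in> D \<Longrightarrow> F x \<in> cball c \<delta> \<Longrightarrow> x \<in> L"
    "integral L (\<lambda>x. bump c \<delta> (F x) * det (F' x)) = integral L (bump c \<delta>)"
    "integral L (bump c \<delta>) > 0"
proof -
  obtain C where C: "compact C" "C \<subseteq> D" "cball c \<delta> \<subseteq> C" "\<And>x. x \<in> D \<Longrightarrow> F x \<in> cball c \<delta> \<Longrightarrow> x \<in> C"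
    "\<And>x t. x \<in> D \<Longrightarrow> 0 \<le> t \<Longrightarrow> t \<le> 1 \<Longrightarrow> x + t *\<^sub>R (F x - x) \<in> cball c \<delta> \<Longrightarrow> x \<in> C"
    using proper_homotopy_to_idE[OF hom compact_cball c(2)] by blast
  obtain k k' U L where U: "open U" "C \<subseteq> U" "U \<subseteq> L" "compact L" "L \<subseteq> D"
    and k: "\<And>x. (k has_derivative (\<lambda>v. k' x \<bullet> v)) (at x)" "continuous_on UNIV k'"
    and kU: "\<And>x. x \<in> U \<Longrightarrow> k x = 1"
    and kL: "\<And>x. x \<notin> L \<Longrightarrow> k x = 0" and k01: "\<And>x. 0 \<le> k x" "\<And>x. k x \<le> 1"
    by (rule C1_cutoff[OF C(1) D C(2)], rule that) assumption+
  define g where "g x = x + k x *\<^sub>R (F x + (-1) *\<^sub>R x)" for x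
  have const: "((\<lambda>x. -1) has_derivative (\<lambda>v. 0 \<bullet> v)) (at x)" for x :: "real^'n::_"
    by simp
  have k'D: "continuous_on D k'" using continuous_on_subset[OF k(2)] by blast
  obtain g' where g': "C1_map g g' D"
    unfolding g_def[abs_def]
    using C1_map_add[OF C1_map_id C1_map_scaleR[OF C1_map_add[OF F C1_map_scaleR[OF C1_map_id const continuous_on_const]] k(1) k'D]]
    by blast
  have gF: "g x = F x" if "x \<in> U" for x using kU[OF that] by (simp add: g_def)
  have g'F: "g' x = F' x" if "x \<in> U" for x
    using C1_map_deriv_unique[OF C1_map_subset[OF g'] C1_map_subset[OF F] U(1)] gF U that by force
  have "integral L (\<lambda>x. bump c \<delta> (g x) * det (g' x)) = integral L (\<lambda>x. bump c \<delta> x)"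
  proof -
    have "integral L (\<lambda>x. det (bump_jacobian c \<delta> (g x) ** g' x)) = integral L (\<lambda>x. det (bump_jacobian c \<delta> x))"
      by (rule integral_det_eq_if_eq_off_compact[OF D U(4,5) C1_map_compose[OF g' C1_map_bump_map]
            C1_map_subset[OF C1_map_bump_map]]) (auto simp: g_def kL)
    then show ?thesis by (simp add: det_mul det_bump_jacobian)
  qed
  moreover have "bump c \<delta> (g x) * det (g' x) = bump c \<delta> (F x) * det (F' x)" if "x \<in> L" for x
  proof (cases "x \<in> U")
    case False
    then have "x \<notin> C" "x \<in> D" using that U by auto
    \<comment> \<open>Outside \<open>C\<close> no time of the homotopy reaches the ball, neither
      \<open>k x\<close> nor 1. So both bumps vanish, and \<open>g\<close> may be replaced by
      \<open>F\<close> on all of \<open>L\<close>.\<close>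
    then have "g x \<notin> cball c \<delta>" "F x \<notin> cball c \<delta>"
      using C(4)[of x] C(5)[of x "k x"] k01 by (auto simp: g_def)
    then show ?thesis
      using bump_eq_0[OF c(1), of "g x" c] bump_eq_0[OF c(1), of "F x" c] by (simp add: dist_commute)
  qed (simp add: gF g'F)
  ultimately have eq: "integral L (\<lambda>x. bump c \<delta> (F x) * det (F' x)) = integral L (bump c \<delta>)"
    by (simp cong: integral_cong)
  show ?thesis
  proof (rule that[OF U(4,5) _ _ eq])
    show "integral L (bump c \<delta>) > 0"
    proof (rule integral_pos_if_pos_at_interior[OF U(4)])
      show "continuous_on L (bump c \<delta>)" by (rule continuous_on_bump[OF continuous_on_id])
      show "c \<in> interior L"
        using interior_maximal[OF U(3,1)] C(3) U(2) c(1) by force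
    qed (use bump_nonneg bump_center_pos c in auto)
  qed (use C U in blast)+
qed

text \<open>If \<open>y\<close> were missed, properness would give a whole ball around
  \<open>y\<close> that is missed; a bump inside it composed with \<open>F\<close> would be 0,
  against the positive integral.\<close>

lemma proper_homotopy_surj:
  fixes F :: "real^'n::{finite,wellorder} \<Rightarrow> real^'n::_"
  assumes D: "open D" and F: "C1_map F F' D" and hom: "proper_homotopy_to_id D F" and y: "y \<in> D"
  obtains x where "x \<in> D" "F x = y"
proof -
  obtain \<delta>0 where \<delta>0: "\<delta>0 > 0" "cball y \<delta>0 \<subseteq> D" using D y open_contains_cball by blast
  let ?A = "{x \<in> D. F x \<in> cball y \<delta>0}"
  have A: "compact ?A"
    by (rule compact_preimage_proper[OF hom C1_mapD(3)[OF F] compact_cball \<delta>0(2)])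
  have "\<exists>x\<in>D. F x = y"
  proof (rule ccontr)
    assume no: "\<not> ?thesis"
    have "\<exists>\<delta>>0. \<delta> \<le> \<delta>0 \<and> (\<forall>x\<in>?A. \<delta> \<le> dist (F x) y)"
    proof (cases "?A = {}")
      case False
      have "continuous_on ?A (\<lambda>x. dist (F x) y)"
        by (intro continuous_intros continuous_on_subset[OF C1_mapD(3)[OF F]]) auto
      then obtain a where a: "a \<in> ?A" "\<forall>x\<in>?A. dist (F a) y \<le> dist (F x) y"
        using continuous_attains_inf[OF A False] by blast
      show ?thesis
        using a no by (intro exI[of _ "min \<delta>0 (dist (F a) y)"]) (auto simp: \<delta>0)
    qed (use \<delta>0 in auto)
    then obtain \<delta> where \<delta>: "\<delta> > 0" "\<delta> \<le> \<delta>0" "\<forall>x\<in>?A. \<delta> \<le> dist (F x) y" by blast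
    have "cball y \<delta> \<subseteq> D" using \<delta> \<delta>0 by force
    from integral_bump_proper[OF D F hom \<delta>(1) this]
    obtain L where L: "L \<subseteq> D"
      "integral L (\<lambda>x. bump y \<delta> (F x) * det (F' x)) = integral L (bump y \<delta>)" "integral L (bump y \<delta>) > 0" by metis
    have "bump y \<delta> (F x) = 0" if "x \<in> L" for x
    proof -
      have "\<delta> \<le> dist (F x) y" using that L(1) \<delta> by (cases "x \<in> ?A") (auto simp: dist_commute)
      then show ?thesis using bump_eq_0[OF \<delta>(1)] by blast
    qed
    then have "integral L (\<lambda>x. bump y \<delta> (F x) * det (F' x)) = integral L (\<lambda>x. 0)"
      by (intro integral_cong) simp
    then show False using L by simp
  qed
  then show ?thesis using that by blast
qed

lemma C1_locally_injective:
  fixes F :: "'a::euclidean_space \<Rightarrow> 'a"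
  assumes W: "open W" "a \<in> W" and der: "\<And>x. x \<in> W \<Longrightarrow> (F has_derivative F' x) (at x)"
    and cont: "\<And>v. continuous_on W (\<lambda>x. F' x v)" and inj: "inj (F' a)"
  obtains r where "r > 0" "ball a r \<subseteq> W" "inj_on F (ball a r)"
proof -
  have lin: "linear (F' x)" if "x \<in> W" for x using has_derivative_linear[OF der[OF that]] .
  obtain g where g: "linear g" "g \<circ> F' a = id"
    using linear_injective_left_inverse[OF lin[OF W(2)] inj] by blast
  show ?thesis
  proof (rule has_derivative_locally_injective[OF W(2,1) _ g(2) der])
    show "bounded_linear g" using g(1) by (simp add: linear_conv_bounded_linear)
    fix e :: real assume e: "e > 0"
    \<comment> \<open>Continuity of the derivative is known only vector by vector; the finite sum
      over the basis dominates the operator norm of the difference.\<close>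
    define s where "s x = (\<Sum>b\<in>Basis. norm (F' x b - F' a b))" for x
    have "continuous_on W s" unfolding s_def[abs_def] by (intro continuous_intros cont)
    then have "isCont s a" using W by (simp add: continuous_on_eq_continuous_at)
    moreover have "s a = 0" by (simp add: s_def)
    ultimately obtain d1 where d1: "d1 > 0" "\<And>x. dist x a < d1 \<Longrightarrow> s x < e"
      unfolding continuous_at_eps_delta using e by (fastforce simp: dist_real_def)
    obtain d2 where d2: "d2 > 0" "ball a d2 \<subseteq> W" using W by (elim openE)
    have "onorm (\<lambda>v. F' x v - F' a v) < e" if x: "dist a x < min d1 d2" for x
    proof -
      have "x \<in> W" using d2(2) x by auto
      then have "bounded_linear (\<lambda>v. F' x v - F' a v)"
        using lin W(2) by (intro bounded_linear_sub) (simp_all add: linear_conv_bounded_linear)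
      then have "onorm (\<lambda>v. F' x v - F' a v) \<le> s x"
        unfolding s_def by (rule onorm_componentwise)
      also have "\<dots> < e" using d1(2) x by (simp add: dist_commute)
      finally show ?thesis .
    qed
    then show "\<exists>d>0. \<forall>x. dist a x < d \<longrightarrow> onorm (\<lambda>v. F' x v - F' a v) < e"
      using d1(1) d2(1) by (intro exI[of _ "min d1 d2"]) auto
  qed (use that in auto)
qed

lemma C1_map_locally_injective:
  fixes F :: "real^'n \<Rightarrow> real^'n"
  assumes W: "open W" "a \<in> W" and F: "C1_map F F' W" and det: "det (F' a) \<noteq> 0"
  obtains r where "r > 0" "ball a r \<subseteq> W" "inj_on F (ball a r)"
proof (rule C1_locally_injective[OF W C1_mapD(1)[OF F]])
  show "continuous_on W (\<lambda>x. F' x *v v)" for v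
    unfolding matrix_vector_mult_def by (intro continuous_intros C1_mapD(2)[OF F])
  show "inj (\<lambda>v. F' a *v v)"
    using det inj_matrix_vector_mult invertible_det_nz by blast
qed

text \<open>Each of two regular preimages would contribute the full integral of the bump, by the
  change of variables formula on a small ball around it. The other contributions are nonnegative,
  but the total equals the integral once.\<close>

lemma at_most_one_positive_preimage:
  fixes F :: "real^'n::{finite,wellorder} \<Rightarrow> real^'n::_"
  assumes D: "open D" and F: "C1_map F F' D" and hom: "proper_homotopy_to_id D F"
    and nonneg: "\<And>x. x \<in> D \<Longrightarrow> F x \<in> D \<Longrightarrow> det (F' x) \<ge> 0"
    and x: "x1 \<in> D" "x2 \<in> D" "F x1 \<in> D" "F x1 = F x2" "det (F' x1) > 0" "det (F' x2) > 0"
  shows "x1 = x2"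
proof (rule ccontr)
  assume ne: "x1 \<noteq> x2"
  obtain r1 where r1: "r1 > 0" "ball x1 r1 \<subseteq> D" "inj_on F (ball x1 r1)"
    using C1_map_locally_injective[OF D x(1) F] x(5) by force
  obtain r2 where r2: "r2 > 0" "ball x2 r2 \<subseteq> D" "inj_on F (ball x2 r2)"
    using C1_map_locally_injective[OF D x(2) F] x(6) by force
  define r where "r = min (min r1 r2) (dist x1 x2 / 2)"
  have r: "r > 0" "r \<le> r1" "r \<le> r2" "r \<le> dist x1 x2 / 2" using r1 r2 ne by (auto simp: r_def)
  let ?y = "F x1"
  have sub: "ball x1 r \<subseteq> D" "ball x2 r \<subseteq> D"
    using r r1 r2 subset_ball order_trans by metis+
  have inj: "inj_on F (ball x1 r)" "inj_on F (ball x2 r)"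
    using r r1 r2 subset_ball inj_on_subset by metis+
  have contF: "continuous_on S F" if "S \<subseteq> D" for S
    using continuous_on_subset[OF C1_mapD(3)[OF F] that] .
  have "open (F ` ball x1 r \<inter> F ` ball x2 r \<inter> D)"
    using invariance_of_domain[OF contF[OF sub(1)] _ inj(1)] invariance_of_domain[OF contF[OF sub(2)] _ inj(2)] D
    by (intro open_Int) auto
  moreover have "?y \<in> F ` ball x1 r" using r(1) by (intro imageI) simp
  moreover have "?y \<in> F ` ball x2 r" unfolding x(4) using r(1) by (intro imageI) simp
  ultimately obtain \<delta> where \<delta>: "\<delta> > 0" "cball ?y \<delta> \<subseteq> F ` ball x1 r \<inter> F ` ball x2 r \<inter> D"
    using x(3) open_contains_cball by (metis IntI)
  then have \<delta>D: "cball ?y \<delta> \<subseteq> D" by blast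
  obtain L where L: "compact L" "L \<subseteq> D" "cball ?y \<delta> \<subseteq> L" "\<And>x. x \<in> D \<Longrightarrow> F x \<in> cball ?y \<delta> \<Longrightarrow> x \<in> L"
    "integral L (\<lambda>x. bump ?y \<delta> (F x) * det (F' x)) = integral L (bump ?y \<delta>)"
    "integral L (bump ?y \<delta>) > 0"
    using integral_bump_proper[OF D F hom \<delta>(1) \<delta>D] by blast
  let ?I = "integral (cball ?y \<delta>) (bump ?y \<delta>)"
  let ?f = "\<lambda>x. bump ?y \<delta> (F x) * det (F' x)"
  have bcont: "continuous_on S (bump ?y \<delta>)" for S by (rule continuous_on_bump[OF continuous_on_id])
  have b0: "bump ?y \<delta> z = 0" if "z \<notin> cball ?y \<delta>" for z
    using that bump_eq_0[OF \<delta>(1), of z ?y] by (simp add: dist_commute)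
  have bi: "(bump ?y \<delta>) absolutely_integrable_on cball ?y \<delta>"
    by (intro absolutely_integrable_continuous_compact compact_cball bcont)
  have IL: "integral L (bump ?y \<delta>) = ?I"
    using has_integral_on_superset[OF integrable_integral[OF set_lebesgue_integral_eq_integral(1)[OF bi]] b0 L(3)]
    by (simp add: integral_unique)
  have *: "?f absolutely_integrable_on {x \<in> ball z r. F x \<in> cball ?y \<delta>} \<and>
      integral {x \<in> ball z r. F x \<in> cball ?y \<delta>} ?f = ?I"
    if z: "ball z r \<subseteq> D" "inj_on F (ball z r)" "cball ?y \<delta> \<subseteq> F ` ball z r" for z
  proof -
    let ?S = "{x \<in> ball z r. F x \<in> cball ?y \<delta>}"
    have img: "F ` ?S = cball ?y \<delta>" using z(3) by auto
    obtain T where T: "closed T" "ball z r \<inter> F -` cball ?y \<delta> = ball z r \<inter> T"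
      using continuous_closedin_preimage[OF contF[OF z(1)] closed_cball, of ?y \<delta>]
      unfolding closedin_closed by blast
    have "?S = ball z r \<inter> F -` cball ?y \<delta>" by auto
    also have "\<dots> \<in> sets borel" unfolding T(2) using T(1) by auto
    finally have S: "?S \<in> sets lebesgue" by simp
    have der: "(F has_derivative (\<lambda>v. F' x *v v)) (at x)" if "x \<in> ?S" for x
      using C1_mapD(1)[OF F] that z(1) by blast
    have injS: "inj_on F ?S" using z(2) by (rule inj_on_subset) auto
    have abs: "?f x = \<bar>det (F' x)\<bar> * bump ?y \<delta> (F x)" if "x \<in> ?S" for x
    proof -
      have "x \<in> D" "F x \<in> D" using that z(1) \<delta>D by blast+
      then show ?thesis using nonneg[of x] by simp
    qed
    have "(\<lambda>x. \<bar>det (F' x)\<bar> * bump ?y \<delta> (F x)) absolutely_integrable_on ?S"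
      "integral ?S (\<lambda>x. \<bar>det (F' x)\<bar> * bump ?y \<delta> (F x)) = ?I"
      using integral_change_of_variables_real[OF S der injS, of "bump ?y \<delta>"] bi unfolding img by auto
    moreover have "?f absolutely_integrable_on ?S \<longleftrightarrow>
        (\<lambda>x. \<bar>det (F' x)\<bar> * bump ?y \<delta> (F x)) absolutely_integrable_on ?S"
      by (rule set_integrable_cong[OF refl refl abs])
    moreover have "integral ?S ?f = integral ?S (\<lambda>x. \<bar>det (F' x)\<bar> * bump ?y \<delta> (F x))"
      by (rule integral_cong[OF abs])
    ultimately show ?thesis by (simp only:)
  qed
  let ?S1 = "{x \<in> ball x1 r. F x \<in> cball ?y \<delta>}" and ?S2 = "{x \<in> ball x2 r. F x \<in> cball ?y \<delta>}"
  have 1: "?f absolutely_integrable_on ?S1 \<and> integral ?S1 ?f = ?I" using *[OF sub(1) inj(1)] \<delta>(2) by blast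
  have 2: "?f absolutely_integrable_on ?S2 \<and> integral ?S2 ?f = ?I" using *[OF sub(2) inj(2)] \<delta>(2) by blast
  have disj: "?S1 \<inter> ?S2 = {}"
    using r(4) dist_triangle_less_add[of x1 _ r x2 r] by (fastforce simp: dist_commute)
  have i12: "(?f has_integral ?I + ?I) (?S1 \<union> ?S2)"
    by (rule has_integral_Un)
      (use 1 2 disj set_lebesgue_integral_eq_integral(1) in \<open>auto simp: has_integral_iff\<close>)
  have fL: "?f integrable_on L"
    by (intro integrable_continuous_compact L(1) continuous_on_bump_det[OF F L(2)])
  have "?I + ?I \<le> integral L ?f"
  proof (rule has_integral_subset_le[OF _ i12 integrable_integral[OF fL]])
    show "?S1 \<union> ?S2 \<subseteq> L" using L(4) sub by blast
    show "\<forall>x\<in>L. 0 \<le> ?f x"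
    proof
      fix x assume x: "x \<in> L"
      show "0 \<le> ?f x"
      proof (cases "F x \<in> cball ?y \<delta>")
        case True
        then have "x \<in> D" "F x \<in> D" using x L(2) \<delta>D by blast+
        then show ?thesis using nonneg[of x] bump_nonneg[OF \<delta>(1)] by (intro mult_nonneg_nonneg) auto
      qed (simp add: b0)
    qed
  qed
  then show False using L(5,6) IL by simp
qed

text \<open>Otherwise all of \<open>V\<close> is critical and its image is negligible by Sard's
  theorem, whereas invariance of domain makes it open and nonempty.\<close>

lemma inj_imp_ex_regular_point:
  fixes F :: "real^'n::{finite,wellorder} \<Rightarrow> real^'n::_"
  assumes "open V" "V \<noteq> {}" "inj_on F V" and F: "C1_map F F' V"
  shows "\<exists>x\<in>V. det (F' x) \<noteq> 0"
proof (rule ccontr)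
  assume "\<not> ?thesis"
  then have "\<And>x. x \<in> V \<Longrightarrow> rank (matrix (\<lambda>v. F' x *v v)) < CARD('n)"
    by (simp add: det_eq_0_rank[symmetric])
  then have "negligible (F ` V)"
    by (intro baby_Sard[OF order_refl has_derivative_at_withinI[OF C1_mapD(1)[OF F]]])
  moreover have "open (F ` V)"
    by (rule invariance_of_domain[OF C1_mapD(3)[OF F] assms(1,3)])
  ultimately show False using open_not_negligible assms(2) by blast
qed

text \<open>The closures of the positive and of the negative set cover \<open>R\<close>, as regular
  points accumulate wherever \<open>F\<close> is locally injective, and they do not meet in
  \<open>R\<close>, as the sign is locally constant there. Connectedness leaves only one of
  them.\<close>

lemma det_nonneg_if_noncritical_connected:
  fixes F :: "real^'n::{finite,wellorder} \<Rightarrow> real^'n::_"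
  assumes D: "open D" "D \<noteq> {}" and F: "C1_map F F' D" and hom: "proper_homotopy_to_id D F"
    and R: "R \<subseteq> {x \<in> D. F x \<in> D}" "{x \<in> D. F x \<in> D} \<subseteq> closure R" "connected R"
    and inj: "\<And>x. x \<in> R \<Longrightarrow> \<exists>V. open V \<and> x \<in> V \<and> inj_on F V"
  shows "x \<in> D \<Longrightarrow> F x \<in> D \<Longrightarrow> det (F' x) \<ge> 0"
    and "{x \<in> D. F x \<in> D} \<subseteq> closure {x \<in> D. det (F' x) > 0}"
proof -
  let ?P = "{x \<in> D. det (F' x) > 0}" and ?N = "{x \<in> D. det (F' x) < 0}" and ?M = "{x \<in> D. F x \<in> D}"
  note oPN = open_det_set[OF F D(1)]
  have V: "\<exists>V. open V \<and> x \<in> V \<and> inj_on F V \<and> V \<subseteq> D" if "x \<in> R" for x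
  proof -
    obtain V where "open V" "x \<in> V" "inj_on F V" using inj[OF \<open>x \<in> R\<close>] by blast
    then show ?thesis
      using that R(1) D(1) by (intro exI[of _ "V \<inter> D"]) (auto intro: inj_on_subset)
  qed
  have cover: "R \<subseteq> closure ?P \<union> closure ?N"
  proof
    fix x assume "x \<in> R"
    then obtain V where V: "open V" "x \<in> V" "inj_on F V" "V \<subseteq> D" using V by blast
    have "x \<in> closure (?P \<union> ?N)"
      unfolding closure_iff_nhds_not_empty
    proof (intro allI impI)
      fix A U assume A: "U \<subseteq> A" "open U" "x \<in> U"
      have "\<exists>z\<in>V \<inter> U. det (F' z) \<noteq> 0"
      proof (rule inj_imp_ex_regular_point)
        show "C1_map F F' (V \<inter> U)" using C1_map_subset[OF F] V(4) by blast
      qed (use A V in \<open>auto intro: inj_on_subset\<close>)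
      then obtain z where "z \<in> V" "z \<in> U" "det (F' z) \<noteq> 0" by blast
      then have "z \<in> (?P \<union> ?N) \<inter> A" using A V(4) by (auto simp: neq_iff)
      then show "(?P \<union> ?N) \<inter> A \<noteq> {}" by blast
    qed
    then show "x \<in> closure ?P \<union> closure ?N" by (simp add: closure_Un)
  qed
  have disj: "closure ?P \<inter> closure ?N \<inter> R = {}"
  proof (rule equals0I)
    fix x assume x: "x \<in> closure ?P \<inter> closure ?N \<inter> R"
    then obtain V where V: "open V" "x \<in> V" "inj_on F V" "V \<subseteq> D" using V by blast
    have eq: "V \<inter> ?P = {x \<in> V. det (F' x) > 0}" "V \<inter> ?N = {x \<in> V. det (F' x) < 0}" using V by auto
    have "x \<in> closure (V \<inter> ?P)" "x \<in> closure (V \<inter> ?N)"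
      using open_Int_closure_subset[OF V(1)] V(2) x by blast+
    then show False
      using inj_imp_det_sign_constant[OF C1_map_subset[OF F V(4)] V(1-3)] unfolding eq by blast
  qed
  have dense: "S \<inter> R \<noteq> {}" if "open S" "z \<in> S" "z \<in> ?M" for S z
    using open_Int_closure_eq_empty[OF that(1), of R] that R(2) by blast
  have "closure ?P \<inter> R = {} \<or> closure ?N \<inter> R = {}"
    using connected_closedD[OF R(3) disj cover] by simp
  \<comment> \<open>If \<open>R\<close> were on the negative side, density would give
    \<open>det F' \<le> 0\<close> at every point with value in \<open>D\<close>, and the integral
    expressing degree 1 could not be positive.\<close>
  moreover have "closure ?P \<inter> R \<noteq> {}"
  proof
    assume no: "closure ?P \<inter> R = {}"
    have le: "det (F' x) \<le> 0" if "x \<in> ?M" for x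
    proof (rule ccontr)
      assume "\<not> ?thesis"
      then have "?P \<inter> R \<noteq> {}" using dense[OF oPN(1), of x] that by auto
      then show False using no closure_subset[of ?P] by blast
    qed
    obtain c \<delta> where c: "\<delta> > 0" "cball c \<delta> \<subseteq> D"
      using D open_contains_cball by (metis ex_in_conv)
    obtain L where L: "compact L" "L \<subseteq> D"
      "integral L (\<lambda>x. bump c \<delta> (F x) * det (F' x)) = integral L (bump c \<delta>)" "integral L (bump c \<delta>) > 0"
      using integral_bump_proper[OF D(1) F hom c] by metis
    have "integral L (\<lambda>x. - (bump c \<delta> (F x) * det (F' x))) \<ge> 0"
    proof (rule integral_nonneg)
      show "(\<lambda>x. - (bump c \<delta> (F x) * det (F' x))) integrable_on L"
        by (intro integrable_continuous_compact L(1) continuous_intros continuous_on_bump_det[OF F L(2)])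
      show "0 \<le> - (bump c \<delta> (F x) * det (F' x))" if "x \<in> L" for x
      proof (cases "F x \<in> D")
        case True
        then have "bump c \<delta> (F x) * det (F' x) \<le> 0"
          using le[of x] that L(2) bump_nonneg[OF c(1)] by (intro mult_nonneg_nonpos) auto
        then show ?thesis by simp
      next
        case False
        then have "F x \<notin> cball c \<delta>" using c(2) by blast
        then have "bump c \<delta> (F x) = 0" using bump_eq_0[OF c(1), of "F x" c] by (simp add: dist_commute)
        then show ?thesis by simp
      qed
    qed
    then show False using L(3,4) by (simp add: integral_neg)
  qed
  ultimately have no: "closure ?N \<inter> R = {}" by blast
  show "det (F' x) \<ge> 0" if "x \<in> D" "F x \<in> D" for x
  proof (rule ccontr)
    assume "\<not> ?thesis"
    then have "?N \<inter> R \<noteq> {}" using dense[OF oPN(2), of x] that by auto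
    then show False using no closure_subset[of ?N] by blast
  qed
  have "R \<subseteq> closure ?P" using cover no by blast
  then show "?M \<subseteq> closure ?P" using R(2) closure_minimal[OF _ closed_closure] by blast
qed

text \<open>Let the fibre split between disjoint open sets \<open>U1\<close> and \<open>U2\<close>.
  Regular points \<open>x1\<close> in \<open>U1\<close> and \<open>x2\<close> in \<open>U2\<close>
  have values close to \<open>y\<close>. Transporting a bump from near \<open>F x1\<close> to near
  \<open>F x2\<close>, inside \<open>U1\<close> alone, forces a second regular preimage of a point
  near \<open>F x2\<close>.\<close>

lemma connected_fibres_cart:
  fixes F :: "real^'n::{finite,wellorder} \<Rightarrow> real^'n::_"
  assumes D: "open D" and F: "C1_map F F' D" and hom: "proper_homotopy_to_id D F"
    and R: "R \<subseteq> {x \<in> D. F x \<in> D}" "{x \<in> D. F x \<in> D} \<subseteq> closure R" "connected R"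
    and inj: "\<And>x. x \<in> R \<Longrightarrow> \<exists>V. open V \<and> x \<in> V \<and> inj_on F V"
    and y: "y \<in> D"
  shows "connected {x \<in> D. F x = y}"
proof (rule ccontr)
  assume nc: "\<not> ?thesis"
  have "D \<noteq> {}" using y by blast
  note nonneg = det_nonneg_if_noncritical_connected(1)[OF D this F hom R inj]
    and densP = det_nonneg_if_noncritical_connected(2)[OF D this F hom R inj]
  let ?P = "{x \<in> D. det (F' x) > 0}"
  have oP: "open ?P" by (rule open_det_set[OF F D])
  have contF: "continuous_on S F" if "S \<subseteq> D" for S
    using continuous_on_subset[OF C1_mapD(3)[OF F] that] .
  have preim: "open {x \<in> D. F x \<in> U}" if "open U" for U
  proof -
    have "{x \<in> D. F x \<in> U} = D \<inter> F -` U" by auto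
    then show ?thesis using continuous_open_preimage[OF contF[OF order_refl] D that] by simp
  qed
  note proper = compact_preimage_proper[OF hom contF[OF order_refl]]
  have "compact {x \<in> D. F x \<in> {y}}" by (rule proper) (use y in auto)
  then have "closed {x \<in> D. F x = y}" by (simp add: compact_imp_closed)
  then obtain A1 A2 where A: "closed A1" "closed A2" "A1 \<noteq> {}" "A2 \<noteq> {}"
    "A1 \<union> A2 = {x \<in> D. F x = y}" "A1 \<inter> A2 = {}"
    using nc unfolding connected_closed_set[OF \<open>closed {x \<in> D. F x = y}\<close>] by auto
  obtain U1' U2' where U': "open U1'" "open U2'" "A1 \<subseteq> U1'" "A2 \<subseteq> U2'" "U1' \<inter> U2' = {}"
    using separation_normal[OF A(1,2,6)] by blast
  define U1 where "U1 = U1' \<inter> D"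
  define U2 where "U2 = U2' \<inter> D"
  have U: "open U1" "open U2" "A1 \<subseteq> U1" "A2 \<subseteq> U2" "U1 \<inter> U2 = {}" "U1 \<subseteq> D" "U2 \<subseteq> D"
    using U' D A(5) by (auto simp: U1_def U2_def)
  obtain \<rho>0 where \<rho>0: "\<rho>0 > 0" "cball y \<rho>0 \<subseteq> D" using D y open_contains_cball by blast
  \<comment> \<open>The compact part of the preimage that neither open set contains; it misses the
    fibre, so its values keep a distance from \<open>y\<close>, and closer to \<open>y\<close> the
    preimage splits completely.\<close>
  let ?B = "{x \<in> D. F x \<in> cball y \<rho>0} - (U1 \<union> U2)"
  have B: "compact ?B"
    using proper[OF compact_cball \<rho>0(2)] U(1,2) by (intro compact_diff) auto
  have "\<exists>\<epsilon>>0. \<forall>x\<in>?B. \<epsilon> < dist (F x) y"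
  proof (cases "?B = {}")
    case False
    have "continuous_on ?B (\<lambda>x. dist (F x) y)"
      by (intro continuous_intros contF) auto
    then obtain a where a: "a \<in> ?B" "\<forall>x\<in>?B. dist (F a) y \<le> dist (F x) y"
      using continuous_attains_inf[OF B False] by blast
    have "F a \<noteq> y" using a(1) A(5) U(3,4) by blast
    then have "dist (F a) y / 2 > 0" "dist (F a) y / 2 < dist (F a) y" by auto
    then show ?thesis using a(2) by (meson less_le_trans)
  qed (auto intro: exI[of _ 1])
  then obtain \<epsilon> where \<epsilon>: "\<epsilon> > 0" "\<forall>x\<in>?B. \<epsilon> < dist (F x) y" by blast
  define \<rho> where "\<rho> = min \<epsilon> \<rho>0 / 2"
  have \<rho>: "\<rho> > 0" "2 * \<rho> \<le> \<epsilon>" "2 * \<rho> \<le> \<rho>0" using \<epsilon>(1) \<rho>0(1) by (auto simp: \<rho>_def)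
  have \<rho>D: "cball y (2 * \<rho>) \<subseteq> D" using subset_cball[OF \<rho>(3)] \<rho>0(2) by blast
  have split: "x \<in> U1 \<union> U2" if "x \<in> D" "F x \<in> cball y (2 * \<rho>)" for x
  proof (rule ccontr)
    assume "x \<notin> U1 \<union> U2"
    then have "x \<in> ?B" using that \<rho>(3) by auto
    then show False using \<epsilon>(2) that(2) \<rho>(2) by (force simp: dist_commute)
  qed
  have near: "\<exists>x\<in>U. x \<in> ?P \<and> dist (F x) y < \<rho> / 16" if "open U" "U \<subseteq> D" "a \<in> U" "F a = y" for U a
  proof -
    let ?O = "U \<inter> {x \<in> D. F x \<in> ball y (\<rho> / 16)}"
    have "open ?O" using that preim by blast
    moreover have "a \<in> ?O" using that \<rho> by auto
    moreover have "a \<in> closure ?P" using densP that y by blast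
    ultimately have "?O \<inter> ?P \<noteq> {}" using open_Int_closure_eq_empty by blast
    then show ?thesis by (auto simp: dist_commute)
  qed
  obtain x1 where x1: "x1 \<in> U1" "x1 \<in> ?P" "dist (F x1) y < \<rho> / 16"
    using near[OF U(1,6)] A(3,5) U(3) by blast
  obtain x2 where x2: "x2 \<in> U2" "x2 \<in> ?P" "dist (F x2) y < \<rho> / 16"
    using near[OF U(2,7)] A(4,5) U(4) by blast
  have "open (U2 \<inter> ?P)" using U(2) oP by blast
  then obtain r where r: "r > 0" "ball x2 r \<subseteq> U2 \<inter> ?P" "inj_on F (ball x2 r)"
    using C1_map_locally_injective[of "U2 \<inter> ?P" x2 F F'] x2 C1_map_subset[OF F, of "U2 \<inter> ?P"] U(7) by auto
  then have rD: "ball x2 r \<subseteq> D" by blast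
  have "open (F ` ball x2 r)"
    by (rule invariance_of_domain[OF contF[OF rD] open_ball r(3)])
  moreover have "F x2 \<in> F ` ball x2 r" using r(1) by simp
  ultimately obtain d where d: "d > 0" "ball (F x2) d \<subseteq> F ` ball x2 r"
    by (elim openE)
  have "dist (F x1) (F x2) \<le> \<rho> / 8"
    using x1(3) x2(3) dist_triangle2[of "F x1" "F x2" y] by simp
  then obtain h h' where h: "C1_map h h' UNIV" "h (F x1) = F x2" "\<And>y. dist y (F x1) \<ge> \<rho> \<Longrightarrow> h y = y"
    "\<And>y. det (h' y) > 0"
    using C1_push[OF \<rho>(1)] by metis
  \<comment> \<open>The part of the preimage that lies in \<open>U1\<close>. Writing it as a
    complement of the open set \<open>U2\<close> shows that it is compact.\<close>
  let ?L = "{x \<in> D. F x \<in> cball y (2 * \<rho>)} - U2"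
  have L: "compact ?L" "?L \<subseteq> U1"
    using proper[OF compact_cball \<rho>D] U(2) split by (auto intro: compact_diff)
  have LD: "?L \<subseteq> D" by blast
  have eq: "integral ?L (\<lambda>x. bump (F x2) d (F x) * det (F' x)) =
      integral ?L (\<lambda>x. bump (F x2) d (h (F x)) * (det (h' (F x)) * det (F' x)))"
  proof (rule integral_bump_transport[OF U(1) L C1_map_subset[OF F U(6)] h(1)])
    fix x assume x: "x \<in> U1 - ?L"
    then have "F x \<notin> cball y (2 * \<rho>)" using U(5,6) by blast
    then have "dist (F x) (F x1) \<ge> \<rho>"
      using x1(3) dist_triangle[of y "F x" "F x1"] \<rho>(1) by (simp add: dist_commute)
    then show "h (F x) = F x" by (rule h(3))
  qed
  have LF: "det (F' x) \<ge> 0" if "x \<in> ?L" for x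
    using that \<rho>D by (intro nonneg) auto
  have "integral ?L (\<lambda>x. bump (F x2) d (h (F x)) * (det (h' (F x)) * det (F' x))) > 0"
  proof (rule integral_pos_if_pos_at_interior[OF L(1)])
    show "continuous_on ?L (\<lambda>x. bump (F x2) d (h (F x)) * (det (h' (F x)) * det (F' x)))"
      by (rule continuous_on_bump_det_transport[OF F h(1) LD])
    show "0 \<le> bump (F x2) d (h (F x)) * (det (h' (F x)) * det (F' x))" if "x \<in> ?L" for x
      using bump_nonneg[OF d(1)] h(4) LF[OF that] by (intro mult_nonneg_nonneg) (auto intro: less_imp_le)
    show "0 < bump (F x2) d (h (F x1)) * (det (h' (F x1)) * det (F' x1))"
      unfolding h(2) using bump_center_pos[OF d(1)] h(4) x1(2) by (intro mult_pos_pos) auto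
    have "open (U1 \<inter> {x \<in> D. F x \<in> ball y (2 * \<rho>)})" using U(1) preim by blast
    moreover have "U1 \<inter> {x \<in> D. F x \<in> ball y (2 * \<rho>)} \<subseteq> ?L" using U(5) by auto
    moreover have "x1 \<in> U1 \<inter> {x \<in> D. F x \<in> ball y (2 * \<rho>)}"
      using x1 \<rho>(1) by (auto simp: dist_commute)
    ultimately show "x1 \<in> interior ?L" using interior_maximal by blast
  qed
  \<comment> \<open>The transported integral is positive because of \<open>x1\<close>, so the
    original one is nonzero: some \<open>x3\<close> outside \<open>U2\<close> has its value in the
    support of the bump, which is covered by the image of a ball around \<open>x2\<close>.\<close>
  then have "integral ?L (\<lambda>x. bump (F x2) d (F x) * det (F' x)) \<noteq> 0" using eq by simp
  then obtain x3 where x3: "x3 \<in> ?L" "bump (F x2) d (F x3) * det (F' x3) \<noteq> 0"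
    using integral_cong[of ?L "\<lambda>x. bump (F x2) d (F x) * det (F' x)" "\<lambda>x. 0"] by auto
  have "dist (F x3) (F x2) < d"
    using x3(2) bump_eq_0[OF d(1), of "F x3" "F x2"] by force
  then have "F x3 \<in> F ` ball x2 r" using d(2) by (auto simp: dist_commute)
  then obtain x4 where x4: "x4 \<in> ball x2 r" "F x3 = F x4" by blast
  have "x3 = x4"
  proof (rule at_most_one_positive_preimage[OF D F hom nonneg])
    show "det (F' x3) > 0" using LF[OF x3(1)] x3(2) by (auto simp: less_le)
  qed (use x3 x4 r(2) \<rho>D in auto)
  then show False using x3(1) x4(1) r(2) by blast
qed

text \<open>The change of variables theorem and Sard's theorem of the library need a wellordered index type.
  Any order on the standard basis serves the purpose.\<close>

typedef (overloaded) 'a basis_index = "Basis :: 'a::euclidean_space set"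
  using nonempty_Basis by blast

instance basis_index :: (euclidean_space) finite
proof
  have "UNIV = Abs_basis_index ` (Basis :: 'a set)"
    by (metis Abs_basis_index_cases UNIV_eq_I imageI)
  then show "finite (UNIV :: 'a basis_index set)" by (metis finite_Basis finite_imageI)
qed

instantiation basis_index :: (euclidean_space) wellorder
begin

definition less_eq_basis_index :: "'a basis_index \<Rightarrow> 'a basis_index \<Rightarrow> bool" where
  "less_eq_basis_index a b \<longleftrightarrow> to_nat a \<le> to_nat b"

definition less_basis_index :: "'a basis_index \<Rightarrow> 'a basis_index \<Rightarrow> bool" where
  "less_basis_index a b \<longleftrightarrow> to_nat a < to_nat b"

instance
proof
  fix P :: "'a basis_index \<Rightarrow> bool" and a
  assume step: "\<And>x. (\<And>y. y < x \<Longrightarrow> P y) \<Longrightarrow> P x"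
  show "P a"
    by (induction "to_nat a" arbitrary: a rule: less_induct) (metis step less_basis_index_def)
qed (auto simp: less_eq_basis_index_def less_basis_index_def)

end

section \<open>Transfer to arbitrary Euclidean spaces\<close>

definition to_coords :: "'a::euclidean_space \<Rightarrow> real ^ 'a basis_index" where
  "to_coords x = (\<chi> b. x \<bullet> Rep_basis_index b)"

definition from_coords :: "real ^ 'a basis_index \<Rightarrow> 'a::euclidean_space" where
  "from_coords v = (\<Sum>b\<in>UNIV. v $ b *\<^sub>R Rep_basis_index b)"

lemma bij_Rep_basis_index: "bij_betw Rep_basis_index UNIV (Basis :: 'a::euclidean_space set)"
  unfolding bij_betw_def using Rep_basis_index_inject type_definition.Rep_range[OF type_definition_basis_index]
  by (auto simp: inj_on_def)

lemma from_to_coords [simp]: "from_coords (to_coords x) = x"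
proof -
  have "from_coords (to_coords x) = (\<Sum>b\<in>Basis. (x \<bullet> b) *\<^sub>R b)"
    unfolding from_coords_def to_coords_def vec_lambda_beta
    by (rule sum.reindex_bij_betw[OF bij_Rep_basis_index])
  then show ?thesis by (simp add: euclidean_representation)
qed

lemma to_from_coords [simp]: "to_coords (from_coords v) = v"
proof -
  have "(\<Sum>c\<in>UNIV. v $ c *\<^sub>R Rep_basis_index c) \<bullet> Rep_basis_index b = v $ b" for b
  proof -
    have "(\<Sum>c\<in>UNIV. v $ c *\<^sub>R Rep_basis_index c) \<bullet> Rep_basis_index b =
        (\<Sum>c\<in>UNIV. if c = b then v $ c else 0)"
      unfolding inner_sum_left
      by (intro sum.cong) (auto simp: inner_Basis Rep_basis_index Rep_basis_index_inject)
    then show ?thesis by simp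
  qed
  then show ?thesis by (simp add: vec_eq_iff to_coords_def from_coords_def)
qed

lemma linear_to_coords: "linear to_coords"
  by (auto intro!: linearI simp: to_coords_def vec_eq_iff inner_add_left)

lemma linear_from_coords: "linear from_coords"
  by (auto intro!: linearI simp: from_coords_def scaleR_add_left sum.distrib scaleR_sum_right)

lemma continuous_on_to_coords: "continuous_on S to_coords"
  and continuous_on_from_coords: "continuous_on T from_coords"
  using linear_to_coords linear_from_coords by (auto intro: linear_continuous_on linear_conv_bounded_linear[THEN iffD1])

lemma to_coords_inject: "to_coords x = to_coords y \<longleftrightarrow> x = y"
  by (metis from_to_coords)

lemma to_coords_image: "to_coords ` S = from_coords -` S"
  by (force simp: image_iff)

text \<open>Conjugation with the coordinate isomorphism; its linearity carries the straight-line
  homotopy over.\<close>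

theorem connected_fibres:
  fixes F :: "'a::euclidean_space \<Rightarrow> 'a"
  assumes D: "open D" and der: "\<And>x. x \<in> D \<Longrightarrow> (F has_derivative F' x) (at x)"
    and cont: "\<And>v. continuous_on D (\<lambda>x. F' x v)"
    and hom: "proper_homotopy_to_id D F"
    and R: "R \<subseteq> {x \<in> D. F x \<in> D}" "{x \<in> D. F x \<in> D} \<subseteq> closure R" "connected R"
    and inj: "\<And>x. x \<in> R \<Longrightarrow> \<exists>V. open V \<and> x \<in> V \<and> inj_on F V"
    and y: "y \<in> D"
  shows "connected {x \<in> D. F x = y}" "{x \<in> D. F x = y} \<noteq> {}"
proof -
  let ?D = "to_coords ` D" and ?F = "\<lambda>v. to_coords (F (from_coords v))"
  let ?F' = "\<lambda>v. matrix (\<lambda>w. to_coords (F' (from_coords v) (from_coords w)))"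
  have openI: "open (to_coords ` S)" if "open S" for S :: "'a set"
    unfolding to_coords_image using open_vimage[OF that continuous_on_from_coords] .
  have bl: "bounded_linear to_coords" "bounded_linear from_coords"
    using linear_to_coords linear_from_coords by (simp_all add: linear_conv_bounded_linear)
  have F: "C1_map ?F ?F' ?D"
    unfolding C1_map_def
  proof (intro conjI ballI)
    fix v assume "v \<in> ?D"
    then have vD: "from_coords v \<in> D" by auto
    have "(?F has_derivative (\<lambda>w. to_coords (F' (from_coords v) (from_coords w)))) (at v)"
      by (rule has_derivative_compose[OF has_derivative_compose[OF bounded_linear_imp_has_derivative[OF bl(2)] der[OF vD]]
            bounded_linear_imp_has_derivative[OF bl(1)]])
    moreover from this have "linear (\<lambda>w. to_coords (F' (from_coords v) (from_coords w)))"
      by (rule has_derivative_linear)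
    ultimately show "(?F has_derivative (\<lambda>w. ?F' v *v w)) (at v)"
      by (simp add: matrix_works)
  next
    show "continuous_on ?D ?F'"
    proof (rule continuous_on_matrix_componentwise)
      fix i j
      have "continuous_on ?D (\<lambda>v. F' (from_coords v) (from_coords (axis j 1)))"
        by (rule continuous_on_compose2[OF cont continuous_on_from_coords]) auto
      then show "continuous_on ?D (\<lambda>v. ?F' v $ i $ j)"
        unfolding matrix_def to_coords_def by (auto intro: continuous_intros)
    qed
  qed
  have hom': "proper_homotopy_to_id ?D ?F"
    unfolding proper_homotopy_to_id_def
  proof (intro allI impI)
    fix K :: "(real ^ 'a basis_index) set" assume K: "compact K \<and> K \<subseteq> ?D"
    have "compact (from_coords ` K)" "from_coords ` K \<subseteq> D"
      using K continuous_on_from_coords by (auto intro: compact_continuous_image)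
    then obtain C where C: "compact C" "C \<subseteq> D"
      "\<And>x t. x \<in> D \<Longrightarrow> 0 \<le> t \<Longrightarrow> t \<le> 1 \<Longrightarrow> x + t *\<^sub>R (F x - x) \<in> from_coords ` K \<Longrightarrow> x \<in> C"
      using proper_homotopy_to_idE[OF hom] by metis
    show "\<exists>C. compact C \<and> C \<subseteq> ?D \<and> (\<forall>x\<in>?D. \<forall>t. 0 \<le> t \<and> t \<le> 1 \<and> x + t *\<^sub>R (?F x - x) \<in> K \<longrightarrow> x \<in> C)"
    proof (intro exI[of _ "to_coords ` C"] conjI ballI allI impI)
      show "compact (to_coords ` C)" 
        by (rule compact_continuous_image[OF continuous_on_to_coords C(1)])
      show "to_coords ` C \<subseteq> ?D" using C(2) by blast
      fix v t assume v: "v \<in> ?D" and t: "0 \<le> t \<and> t \<le> 1 \<and> v + t *\<^sub>R (?F v - v) \<in> K"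
      then obtain x where x: "x \<in> D" "v = to_coords x" by blast
      have "from_coords (v + t *\<^sub>R (?F v - v)) = x + t *\<^sub>R (F x - x)"
        unfolding x(2) by (simp add: linear_add[OF linear_from_coords] linear_diff[OF linear_from_coords]
            linear_scale[OF linear_from_coords])
      then have "x + t *\<^sub>R (F x - x) \<in> from_coords ` K" using t by (metis imageI)
      then show "v \<in> to_coords ` C" using C(3) x t by blast
    qed
  qed
  have M: "{v \<in> ?D. ?F v \<in> ?D} = to_coords ` {x \<in> D. F x \<in> D}"
    by (auto simp: to_coords_inject)
  have fibre: "{x \<in> D. F x = y} = from_coords ` {v \<in> ?D. ?F v = to_coords y}"
    by (force simp: to_coords_inject image_iff)
  have "connected {v \<in> ?D. ?F v = to_coords y}"
  proof (rule connected_fibres_cart[OF openI[OF D] F hom', of "to_coords ` R"])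
    show "to_coords ` R \<subseteq> {v \<in> ?D. ?F v \<in> ?D}" unfolding M using R(1) by blast
    show "{v \<in> ?D. ?F v \<in> ?D} \<subseteq> closure (to_coords ` R)"
      unfolding M using R(2) closure_linear_image_subset[OF linear_to_coords, of R] by blast
    show "connected (to_coords ` R)"
      by (rule connected_continuous_image[OF continuous_on_to_coords R(3)])
    show "to_coords y \<in> ?D" using y by blast
    fix v assume "v \<in> to_coords ` R"
    then obtain x where x: "x \<in> R" "v = to_coords x" by blast
    then obtain V where V: "open V" "x \<in> V" "inj_on F V" using inj by blast
    have "inj_on ?F (to_coords ` V)"
      using V(3) by (auto simp: inj_on_def to_coords_inject)
    then show "\<exists>V. open V \<and> v \<in> V \<and> inj_on ?F V" using openI[OF V(1)] V(2) x by blast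
  qed
  then show "connected {x \<in> D. F x = y}"
    unfolding fibre by (intro connected_continuous_image continuous_on_from_coords)
  obtain v where "v \<in> ?D" "?F v = to_coords y"
    using proper_homotopy_surj[OF openI[OF D] F hom'] y by (metis imageI)
  then show "{x \<in> D. F x = y} \<noteq> {}" by (auto simp: to_coords_inject)
qed

section \<open>C1 maps between Euclidean spaces\<close>

text \<open>Matrix-free, so that it also covers products and vectors of vectors. In finite
  dimension, continuity of the derivative in each direction amounts to continuity of the
  derivative.\<close>

definition C1_on :: "('a::euclidean_space \<Rightarrow> 'b::euclidean_space) \<Rightarrow> 'a set \<Rightarrow> bool" where
  "C1_on f S \<longleftrightarrow> (\<exists>f'. (\<forall>x\<in>S. (f has_derivative f' x) (at x)) \<and> (\<forall>v. continuous_on S (\<lambda>x. f' x v)))"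

lemma C1_onI:
  assumes "\<And>x. x \<in> S \<Longrightarrow> (f has_derivative f' x) (at x)" "\<And>v. continuous_on S (\<lambda>x. f' x v)"
  shows "C1_on f S"
  using assms unfolding C1_on_def by blast

lemma C1_onE:
  assumes "C1_on f S"
  obtains f' where "\<And>x. x \<in> S \<Longrightarrow> (f has_derivative f' x) (at x)" "\<And>v. continuous_on S (\<lambda>x. f' x v)"
  using assms unfolding C1_on_def by blast

lemma C1_on_imp_continuous_on: "C1_on f S \<Longrightarrow> continuous_on S f"
  unfolding C1_on_def by (meson continuous_at_imp_continuous_on has_derivative_continuous)

lemma C1_on_subset: "C1_on f S \<Longrightarrow> T \<subseteq> S \<Longrightarrow> C1_on f T"
  unfolding C1_on_def by (meson continuous_on_subset subsetD)

lemma C1_on_cong_open: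
  assumes "C1_on f S" "open S" "\<And>x. x \<in> S \<Longrightarrow> g x = f x"
  shows "C1_on g S"
proof -
  obtain f' where f': "\<And>x. x \<in> S \<Longrightarrow> (f has_derivative f' x) (at x)" "\<And>v. continuous_on S (\<lambda>x. f' x v)"
    using assms(1) unfolding C1_on_def by blast
  show ?thesis
    by (rule C1_onI[OF has_derivative_transform_within_open[OF f'(1) assms(2) _ assms(3)[symmetric]] f'(2)])
qed

lemma C1_on_bounded_linear: "bounded_linear f \<Longrightarrow> C1_on f S"
  by (rule C1_onI[of S f "\<lambda>x. f"]) (auto intro: bounded_linear_imp_has_derivative)

lemma C1_on_const: "C1_on (\<lambda>x. c) S"
  by (rule C1_onI[of S _ "\<lambda>x v. 0"]) auto

lemma C1_on_add:
  assumes "C1_on f S" "C1_on g S"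
  shows "C1_on (\<lambda>x. f x + g x) S"
proof -
  obtain f' g' where "\<And>x. x \<in> S \<Longrightarrow> (f has_derivative f' x) (at x)" "\<And>v. continuous_on S (\<lambda>x. f' x v)"
    "\<And>x. x \<in> S \<Longrightarrow> (g has_derivative g' x) (at x)" "\<And>v. continuous_on S (\<lambda>x. g' x v)"
    using assms by (metis C1_onE)
  then show ?thesis
    by (intro C1_onI[of S _ "\<lambda>x v. f' x v + g' x v"] has_derivative_add continuous_on_add)
qed

lemma C1_on_sum:
  "finite I \<Longrightarrow> (\<And>i. i \<in> I \<Longrightarrow> C1_on (f i) S) \<Longrightarrow> C1_on (\<lambda>x. \<Sum>i\<in>I. f i x) S"
  by (induction I rule: finite_induct) (auto intro: C1_on_const C1_on_add)

lemma C1_on_compose: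
  assumes f: "C1_on f S" and g: "C1_on g T" and ST: "f ` S \<subseteq> T"
  shows "C1_on (\<lambda>x. g (f x)) S"
proof -
  obtain f' where f': "\<And>x. x \<in> S \<Longrightarrow> (f has_derivative f' x) (at x)" "\<And>v. continuous_on S (\<lambda>x. f' x v)"
    using f by (metis C1_onE)
  obtain g' where g': "\<And>x. x \<in> T \<Longrightarrow> (g has_derivative g' x) (at x)" "\<And>v. continuous_on T (\<lambda>x. g' x v)"
    using g by (metis C1_onE)
  show ?thesis
  proof (rule C1_onI[of S _ "\<lambda>x v. g' (f x) (f' x v)"])
    show "((\<lambda>x. g (f x)) has_derivative (\<lambda>v. g' (f x) (f' x v))) (at x)" if "x \<in> S" for x
      using has_derivative_compose[OF f'(1) g'(1)] that ST by blast
    fix v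
    have "g' (f x) w = (\<Sum>b\<in>Basis. (w \<bullet> b) *\<^sub>R g' (f x) b)" if "x \<in> S" for x w
    proof -
      have "linear (g' (f x))" using g'(1) that ST has_derivative_linear by blast
      then show ?thesis
        by (subst euclidean_representation[of w, symmetric]) (simp only: linear_sum linear_scale)
    qed
    then have "continuous_on S (\<lambda>x. g' (f x) (f' x v)) \<longleftrightarrow>
        continuous_on S (\<lambda>x. \<Sum>b\<in>Basis. (f' x v \<bullet> b) *\<^sub>R g' (f x) b)"
      by (intro continuous_on_cong) auto
    also have "\<dots>"
      by (intro continuous_intros f'(2) continuous_on_compose2[OF g'(2) C1_on_imp_continuous_on[OF f] ST])
    finally show "continuous_on S (\<lambda>x. g' (f x) (f' x v))" .
  qed
qed

lemma C1_on_bounded_bilinear: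
  assumes B: "bounded_bilinear B" and f: "C1_on f S" and g: "C1_on g S"
  shows "C1_on (\<lambda>x. B (f x) (g x)) S"
proof -
  obtain f' g' where d: "\<And>x. x \<in> S \<Longrightarrow> (f has_derivative f' x) (at x)" "\<And>v. continuous_on S (\<lambda>x. f' x v)"
    "\<And>x. x \<in> S \<Longrightarrow> (g has_derivative g' x) (at x)" "\<And>v. continuous_on S (\<lambda>x. g' x v)"
    using f g by (metis C1_onE)
  show ?thesis
    by (rule C1_onI[of S _ "\<lambda>x v. B (f x) (g' x v) + B (f' x v) (g x)"])
      (intro bounded_bilinear.FDERIV[OF B] d continuous_on_add bounded_bilinear.continuous_on[OF B]
        C1_on_imp_continuous_on[OF f] C1_on_imp_continuous_on[OF g] | assumption)+
qed

lemmas C1_on_inner = C1_on_bounded_bilinear[OF bounded_bilinear_inner]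
lemmas C1_on_scaleR = C1_on_bounded_bilinear[OF bounded_bilinear_scaleR]

lemma C1_on_inverse:
  fixes f :: "'a::euclidean_space \<Rightarrow> real"
  assumes f: "C1_on f S" and nz: "\<And>x. x \<in> S \<Longrightarrow> f x \<noteq> 0"
  shows "C1_on (\<lambda>x. inverse (f x)) S"
proof -
  obtain f' where d: "\<And>x. x \<in> S \<Longrightarrow> (f has_derivative f' x) (at x)" "\<And>v. continuous_on S (\<lambda>x. f' x v)"
    using f by (metis C1_onE)
  show ?thesis
    by (rule C1_onI[of S _ "\<lambda>x v. - (inverse (f x) * f' x v * inverse (f x))"])
      (use nz in \<open>auto intro!: Deriv.has_derivative_inverse d continuous_intros C1_on_imp_continuous_on[OF f]\<close>)
qed

lemma C1_on_vec:
  fixes f :: "'i::finite \<Rightarrow> 'a::euclidean_space \<Rightarrow> 'b::euclidean_space"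
  assumes "\<And>i. C1_on (f i) S"
  shows "C1_on (\<lambda>x. \<chi> i. f i x) S"
proof -
  have "C1_on (\<lambda>x. \<Sum>i\<in>UNIV. axis i (f i x)) S"
  proof (intro C1_on_sum C1_on_compose[OF assms C1_on_bounded_linear, where T = UNIV])
    show "bounded_linear (\<lambda>y::'b. axis i y)" for i :: 'i
      by (auto simp: linear_conv_bounded_linear[symmetric] axis_def vec_eq_iff intro!: linearI)
  qed auto
  moreover have "(\<Sum>i\<in>UNIV. axis i (f i x)) = (\<chi> i. f i x)" for x
    by (simp add: vec_eq_iff axis_def if_distrib cong: if_cong)
  ultimately show ?thesis by simp
qed

lemma C1_on_iff_C1_map: "C1_on f S \<longleftrightarrow> (\<exists>f'. C1_map f f' S)" for f :: "real^'n \<Rightarrow> real^'m"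
proof
  assume "C1_on f S"
  then obtain f' where f': "\<And>x. x \<in> S \<Longrightarrow> (f has_derivative f' x) (at x)" "\<And>v. continuous_on S (\<lambda>x. f' x v)"
    by (metis C1_onE)
  have "C1_map f (\<lambda>x. matrix (f' x)) S"
    unfolding C1_map_def
  proof (intro conjI ballI)
    fix x assume "x \<in> S"
    then have "(f has_derivative f' x) (at x)" by (rule f'(1))
    moreover from this have "linear (f' x)" by (rule has_derivative_linear)
    ultimately show "(f has_derivative (\<lambda>v. matrix (f' x) *v v)) (at x)"
      by (simp add: matrix_works)
  next
    show "continuous_on S (\<lambda>x. matrix (f' x))"
      by (rule continuous_on_matrix_componentwise) (auto simp: matrix_def intro!: continuous_intros f'(2))
  qed
  then show "\<exists>f'. C1_map f f' S" by blast
next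
  assume "\<exists>f'. C1_map f f' S"
  then obtain f' where f: "C1_map f f' S" by blast
  show "C1_on f S"
    by (rule C1_onI[OF C1_mapD(1)[OF f]]) (auto simp: matrix_vector_mult_def intro!: continuous_intros C1_mapD(2)[OF f])
qed

section \<open>Differentiability of inverse maps\<close>

lemma matrix_mult_matrix_inv:
  fixes A :: "real^'n^'n"
  assumes "det A \<noteq> 0"
  shows "A ** matrix_inv A = mat 1"
  using assms someI_ex[of "\<lambda>B. A ** B = mat 1 \<and> B ** A = mat 1"]
  unfolding invertible_det_nz[symmetric] invertible_def matrix_inv_def by blast

text \<open>Cramer's rule writes every entry as a quotient of determinants.\<close>

lemma continuous_on_matrix_inv:
  fixes A :: "'a::topological_space \<Rightarrow> real^'n^'n"
  assumes A: "continuous_on S A" and nz: "\<And>x. x \<in> S \<Longrightarrow> det (A x) \<noteq> 0"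
  shows "continuous_on S (\<lambda>x. matrix_inv (A x))"
proof (rule continuous_on_matrix_componentwise)
  fix k j
  let ?B = "\<lambda>x. \<chi> i l. if l = k then axis j 1 $ i else A x $ i $ l"
  have "matrix_inv (A x) $ k $ j = det (?B x) / det (A x)" if "x \<in> S" for x
  proof -
    have "A x ** matrix_inv (A x) = mat 1"
      using nz[OF that] by (simp add: matrix_mult_matrix_inv)
    then have "A x *v (matrix_inv (A x) *v axis j 1) = axis j 1"
      by (simp add: matrix_vector_mul_assoc)
    then have "matrix_inv (A x) *v axis j 1 = (\<chi> k. det (\<chi> i l. if l = k then axis j 1 $ i else A x $ i $ l) / det (A x))"
      using cramer[OF nz[OF that]] by blast
    then show ?thesis
      by (metis (no_types, lifting) matrix_vector_mult_basis column_def vec_lambda_beta)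
  qed
  moreover have "continuous_on S ?B"
  proof (rule continuous_on_matrix_componentwise)
    show "continuous_on S (\<lambda>x. ?B x $ i $ l)" for i l
      by (cases "l = k") (auto intro!: continuous_intros A)
  qed
  then have "continuous_on S (\<lambda>x. det (?B x) / det (A x))"
    using nz by (intro continuous_on_divide continuous_on_det A) auto
  ultimately show "continuous_on S (\<lambda>x. matrix_inv (A x) $ k $ j)"
    by (simp cong: continuous_on_cong)
qed

lemma C1_map_inverse:
  fixes f :: "real^'n \<Rightarrow> real^'n"
  assumes S: "open S" and f: "C1_map f f' S" and nz: "\<And>x. x \<in> S \<Longrightarrow> det (f' x) \<noteq> 0"
    and g: "\<And>x. x \<in> S \<Longrightarrow> g (f x) = x"
  shows "C1_on g (f ` S)"
proof -
  have der: "(g has_derivative (\<lambda>v. matrix_inv (f' (g y)) *v v)) (at y)" if y: "y \<in> f ` S" for y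
  proof -
    obtain x where x: "x \<in> S" "y = f x" using y by blast
    have "f' x ** matrix_inv (f' x) = mat 1"
      using nz[OF x(1)] by (simp add: matrix_mult_matrix_inv)
    then have "(\<lambda>v. f' x *v v) \<circ> (\<lambda>v. matrix_inv (f' x) *v v) = id"
      by (simp add: fun_eq_iff matrix_vector_mul_assoc)
    from has_derivative_inverse_strong[OF S x(1) C1_mapD(3)[OF f] g C1_mapD(1)[OF f x(1)] this]
    show ?thesis by (simp add: x g)
  qed
  \<comment> \<open>Differentiability of \<open>g\<close> comes first; its continuity then feeds
    back into the formula for the derivative, which becomes continuous too.\<close>
  then have "continuous_on (f ` S) g"
    by (meson continuous_at_imp_continuous_on has_derivative_continuous)
  moreover have "g ` f ` S \<subseteq> S" using g by auto
  ultimately have "continuous_on (f ` S) (\<lambda>y. f' (g y))"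
    using continuous_on_compose2[OF C1_mapD(2)[OF f]] by blast
  then have "continuous_on (f ` S) (\<lambda>y. matrix_inv (f' (g y)))"
    by (rule continuous_on_matrix_inv) (use nz g in auto)
  then have "C1_map g (\<lambda>y. matrix_inv (f' (g y))) (f ` S)"
    using der by (auto simp: C1_map_def)
  then show ?thesis using C1_on_iff_C1_map by blast
qed

text \<open>Zeros can only be crossed downwards. Were \<open>q b\<close> nonnegative, there would be
  a first zero after a negative point, and just before it \<open>q\<close> would already be
  positive.\<close>

lemma neg_after_nonpos_if_decreasing_at_zeros:
  fixes q :: "real \<Rightarrow> real"
  assumes der: "\<And>t. 0 \<le> t \<Longrightarrow> t \<le> b \<Longrightarrow> (q has_real_derivative q' t) (at t)"
    and neg: "\<And>t. 0 \<le> t \<Longrightarrow> t \<le> b \<Longrightarrow> q t = 0 \<Longrightarrow> q' t < 0"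
    and q0: "q 0 \<le> 0" and b: "0 < b"
  shows "q b < 0"
proof (rule ccontr)
  assume "\<not> ?thesis"
  then have qb: "q b \<ge> 0" by simp
  have cont: "continuous_on {0..b} q"
    using der by (intro continuous_at_imp_continuous_on ballI DERIV_isCont) auto
  obtain t0 where t0: "0 \<le> t0" "t0 < b" "q t0 < 0"
  proof (cases "q 0 = 0")
    case True
    have "\<exists>d>0. \<forall>h>0. h < d \<longrightarrow> q (0 + h) < q 0"
      by (rule DERIV_neg_dec_right[OF der neg]) (use b True in auto)
    then obtain d where d: "d > 0" "\<And>h. 0 < h \<Longrightarrow> h < d \<Longrightarrow> q (0 + h) < q 0" by blast
    show ?thesis
      by (rule that[of "min (d / 2) (b / 2)"]) (use d(1) d(2)[of "min (d / 2) (b / 2)"] b True in auto)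
  qed (use that[of 0] q0 b in auto)
  have "\<exists>x\<ge>t0. x \<le> b \<and> q x = 0"
    by (rule IVT') (use t0 qb cont in \<open>auto intro: continuous_on_subset\<close>)
  then have ne: "{x \<in> {t0..b}. q x = 0} \<noteq> {}" by auto
  have "closed {x \<in> {t0..b}. q x = 0}"
    using t0 by (intro continuous_closed_preimage_constant continuous_on_subset[OF cont]) auto
  then have "compact ({t0..b} \<inter> {x \<in> {t0..b}. q x = 0})"
    by (intro compact_Int_closed compact_Icc)
  moreover have "{t0..b} \<inter> {x \<in> {t0..b}. q x = 0} = {x \<in> {t0..b}. q x = 0}" by blast
  ultimately have "compact {x \<in> {t0..b}. q x = 0}" by simp
  then obtain s where s: "s \<in> {x \<in> {t0..b}. q x = 0}" "\<And>x. x \<in> {x \<in> {t0..b}. q x = 0} \<Longrightarrow> s \<le> x"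
    using compact_attains_inf[OF _ ne] by blast
  then have s0: "t0 < s" "s \<le> b" "q s = 0" using t0(3) by (auto simp: less_le)
  have "\<exists>d>0. \<forall>h>0. h < d \<longrightarrow> q s < q (s - h)"
    by (rule DERIV_neg_dec_left[OF der neg]) (use s0 t0 in auto)
  then obtain d where d: "d > 0" "\<And>h. 0 < h \<Longrightarrow> h < d \<Longrightarrow> q s < q (s - h)" by blast
  define h where "h = min (d / 2) ((s - t0) / 2)"
  have h: "0 < h" "h < d" "t0 < s - h" using d(1) s0 by (auto simp: h_def min_def field_simps)
  then have "q (s - h) > 0" using d(2) s0(3) by force
  then have "\<exists>x\<ge>t0. x \<le> s - h \<and> q x = 0"
    by (intro IVT') (use t0 s0 h in \<open>auto intro: continuous_on_subset[OF cont]\<close>)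
  then show False using s(2) s0 h by force
qed

section \<open>A single consumer\<close>

lemma commodity_space_box: "commodity_space = (\<Inter>j. {x. 0 < x $ j})"
  by (auto simp: commodity_space_def)

lemma open_commodity_space: "open (commodity_space :: (real^'l) set)"
  unfolding commodity_space_box
  by (intro open_INT ballI open_Collect_less continuous_intros) simp

lemma convex_commodity_space: "convex (commodity_space :: (real^'l) set)"
proof (rule convexI)
  fix x y :: "real^'l" and a b :: real
  assume *: "x \<in> commodity_space" "y \<in> commodity_space" "0 \<le> a" "0 \<le> b" "a + b = 1"
  have "0 < a * x $ j + b * y $ j" for j
  proof (cases "a = 0")
    case False
    then have "0 < a * x $ j" "0 \<le> b * y $ j" using * by (auto simp: commodity_space_def less_imp_le)
    then show ?thesis by simp
  qed (use * in \<open>auto simp: commodity_space_def\<close>)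
  then show "a *\<^sub>R x + b *\<^sub>R y \<in> commodity_space" by (simp add: commodity_space_def)
qed

lemma inner_pos_if_commodity:
  assumes "p \<in> commodity_space" "x \<in> commodity_space"
  shows "p \<bullet> x > 0"
  using assms by (auto simp: commodity_space_def inner_vec_def intro!: sum_pos)

locale consumer =
  fixes u :: "real^'l \<Rightarrow> real"
  assumes smooth: "smooth_on u commodity_space"
    and monotone: "monotone_utility u"
    and strict_quasiconcave: "strictly_quasiconcave_utility u"
    and necessity: "necessity u"
begin

lemma has_derivative_utility:
  assumes x: "x \<in> commodity_space"
  shows "(u has_derivative (\<lambda>v. gradient u x \<bullet> v)) (at x)"
proof -
  have "Ck_on 1 u commodity_space" using smooth unfolding smooth_on_def by blast
  then have "u differentiable (at x)" using x by simp
  then have d: "(u has_derivative frechet_derivative u (at x)) (at x)"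
    by (simp add: frechet_derivative_works)
  then have lin: "linear (frechet_derivative u (at x))" by (rule has_derivative_linear)
  have "frechet_derivative u (at x) v = gradient u x \<bullet> v" for v
  proof -
    have "frechet_derivative u (at x) v = frechet_derivative u (at x) (\<Sum>j\<in>UNIV. v $ j *s axis j 1)"
      by (simp add: basis_expansion)
    also have "\<dots> = (\<Sum>j\<in>UNIV. v $ j * frechet_derivative u (at x) (axis j 1))"
      by (simp add: linear_sum[OF lin] linear_scale[OF lin] scalar_mult_eq_scaleR)
    finally show ?thesis by (simp add: gradient_def inner_vec_def mult.commute)
  qed
  then have "frechet_derivative u (at x) = (\<lambda>v. gradient u x \<bullet> v)" by blast
  then show ?thesis using d by simp
qed

lemma C1_map_gradient: "C1_map (gradient u) (hessian u) commodity_space"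
proof -
  let ?D = "\<lambda>j x. frechet_derivative u (at x) (axis j 1)"
  have "Ck_on (Suc (Suc 0)) u commodity_space" using smooth unfolding smooth_on_def by blast
  then have D: "\<And>x j. x \<in> commodity_space \<Longrightarrow> ?D j differentiable (at x)"
    "\<And>j w. continuous_on commodity_space (\<lambda>x. frechet_derivative (?D j) (at x) w)"
    by auto
  have der: "(gradient u has_derivative (\<lambda>v. \<chi> j. frechet_derivative (?D j) (at x) v)) (at x)"
    if "x \<in> commodity_space" for x
  proof (subst has_derivative_componentwise_within, intro ballI)
    fix b :: "real^'l" assume "b \<in> Basis"
    then obtain j where "b = axis j 1" by (auto simp: Basis_vec_def)
    then show "((\<lambda>x. gradient u x \<bullet> b) has_derivative (\<lambda>v. (\<chi> j. frechet_derivative (?D j) (at x) v) \<bullet> b)) (at x)"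
      using D(1)[OF that, of j, unfolded frechet_derivative_works] by (simp add: inner_axis gradient_def)
  qed
  have hess: "hessian u x = matrix (\<lambda>v. \<chi> j. frechet_derivative (?D j) (at x) v)" if "x \<in> commodity_space" for x
    unfolding hessian_def jacobian_def frechet_derivative_at[OF der[OF that], symmetric] ..
  show ?thesis
    unfolding C1_map_def
  proof (intro conjI ballI)
    fix x :: "real^'l" assume x: "x \<in> commodity_space"
    show "(gradient u has_derivative (\<lambda>v. hessian u x *v v)) (at x)"
      using der[OF x] has_derivative_linear[OF der[OF x]] by (simp add: hess[OF x] matrix_works)
  next
    have "continuous_on commodity_space (\<lambda>x. matrix (\<lambda>v. \<chi> j. frechet_derivative (?D j) (at x) v))"
      by (rule continuous_on_matrix_componentwise) (simp add: matrix_def D(2))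
    then show "continuous_on commodity_space (hessian u)"
      by (simp add: hess cong: continuous_on_cong)
  qed
qed

lemma continuous_on_utility: "continuous_on commodity_space u"
  using has_derivative_utility
  by (meson continuous_at_imp_continuous_on has_derivative_continuous)

lemma gradient_pos: "x \<in> commodity_space \<Longrightarrow> gradient u x \<in> commodity_space"
  using monotone by (auto simp: monotone_utility_def)

lemma DERIV_utility_segment:
  assumes "x + t *\<^sub>R d \<in> commodity_space"
  shows "((\<lambda>t. u (x + t *\<^sub>R d)) has_real_derivative gradient u (x + t *\<^sub>R d) \<bullet> d) (at t)"
proof -
  have "((\<lambda>t. x + t *\<^sub>R d) has_derivative (\<lambda>h. h *\<^sub>R d)) (at t)"
    by (auto intro!: derivative_eq_intros)
  from has_derivative_compose[OF this has_derivative_utility[OF assms]]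
  show ?thesis by (simp add: has_field_derivative_def mult_commute_abs)
qed

lemma segment_in_commodity_space:
  assumes "x \<in> commodity_space" "y \<in> commodity_space" "0 \<le> t" "t \<le> 1"
  shows "x + t *\<^sub>R (y - x) \<in> commodity_space"
  using convexD_alt[OF convex_commodity_space assms] by (simp add: algebra_simps)

lemma utility_mvt:
  assumes "x \<in> commodity_space" "y \<in> commodity_space"
  obtains t where "0 < t" "t < 1" "u y - u x = gradient u (x + t *\<^sub>R (y - x)) \<bullet> (y - x)"
proof -
  have "\<exists>t>0. t < 1 \<and> u (x + 1 *\<^sub>R (y - x)) - u (x + 0 *\<^sub>R (y - x)) =
      (1 - 0) * (gradient u (x + t *\<^sub>R (y - x)) \<bullet> (y - x))"
    by (rule MVT2) (auto intro!: DERIV_utility_segment segment_in_commodity_space assms)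
  then show ?thesis using that by auto
qed

text \<open>Along the segment from \<open>x\<close> to \<open>y\<close> every critical point of the utility is a strict local maximum,
  so that the utility keeps decreasing once its slope is nonpositive.\<close>

lemma utility_less_if_gradient_nonpos:
  assumes x: "x \<in> commodity_space" and y: "y \<in> commodity_space" and ne: "y \<noteq> x"
    and le: "gradient u x \<bullet> (y - x) \<le> 0"
  shows "u y < u x"
proof -
  obtain t where t: "0 < t" "t < 1" "u y - u x = gradient u (x + t *\<^sub>R (y - x)) \<bullet> (y - x)"
    using utility_mvt[OF x y] by blast
  let ?z = "\<lambda>s. x + s *\<^sub>R (y - x)"
  have z: "?z s \<in> commodity_space" if "0 \<le> s" "s \<le> t" for s
    using segment_in_commodity_space[OF x y] that t by simp
  have "gradient u (?z t) \<bullet> (y - x) < 0"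
  proof (rule neg_after_nonpos_if_decreasing_at_zeros[of t _ "\<lambda>s. (hessian u (?z s) *v (y - x)) \<bullet> (y - x)"])
    show "((\<lambda>s. gradient u (?z s) \<bullet> (y - x)) has_real_derivative (hessian u (?z s) *v (y - x)) \<bullet> (y - x)) (at s)"
      if "0 \<le> s" "s \<le> t" for s
    proof -
      have "(?z has_derivative (\<lambda>h. h *\<^sub>R (y - x))) (at s)"
        by (auto intro!: derivative_eq_intros)
      from has_derivative_inner_left[OF has_derivative_compose[OF this C1_mapD(1)[OF C1_map_gradient z[OF that]]]]
      show ?thesis by (simp add: has_field_derivative_def matrix_vector_mult_scaleR mult_commute_abs)
    qed
    show "(hessian u (?z s) *v (y - x)) \<bullet> (y - x) < 0"
      if "0 \<le> s" "s \<le> t" "gradient u (?z s) \<bullet> (y - x) = 0" for s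
      using strict_quasiconcave z[OF that(1,2)] that(3) ne
      unfolding strictly_quasiconcave_utility_def by (metis eq_iff_diff_eq_0 inner_commute)
  qed (use le t in auto)
  then show ?thesis using t(3) by simp
qed

lemma utility_mono:
  assumes "x \<in> commodity_space" "y \<in> commodity_space" "\<And>j. x $ j \<le> y $ j"
  shows "u x \<le> u y"
proof -
  obtain t where t: "0 < t" "t < 1" "u y - u x = gradient u (x + t *\<^sub>R (y - x)) \<bullet> (y - x)"
    using utility_mvt[OF assms(1,2)] by blast
  have "gradient u (x + t *\<^sub>R (y - x)) \<in> commodity_space"
    using t by (intro gradient_pos segment_in_commodity_space assms) auto
  then have "gradient u (x + t *\<^sub>R (y - x)) \<bullet> (y - x) \<ge> 0"
    using assms(3) by (auto simp: commodity_space_def inner_vec_def less_imp_le intro!: sum_nonneg mult_nonneg_nonneg)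
  then show ?thesis using t(3) by simp
qed

text \<open>The danger is the boundary of the orthant. Necessity makes the indifference surface
  through \<open>y\<close> closed in the whole space, so its part \<open>?Z\<close> in the box is
  compact and stays away from the boundary. Every point of \<open>?S\<close> dominates a point of
  \<open>?Z\<close> and inherits its distance.\<close>

lemma compact_upper_contour:
  assumes y: "y \<in> commodity_space"
  shows "compact {x \<in> commodity_space. u y \<le> u x \<and> (\<forall>j. x $ j \<le> b)}" (is "compact ?S")
proof (cases "?S = {}")
  case False
  let ?Z = "{x \<in> commodity_space. u x = u y} \<inter> cbox 0 (\<chi> j. b)"
  have below: "\<exists>z\<in>?Z. \<forall>j. z $ j \<le> x $ j" if x: "x \<in> ?S" for x
  proof -
    \<comment> \<open>The coordinatewise minimum has utility at most \<open>u y\<close>, so the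
      segment rising from it to \<open>x\<close> meets the level of \<open>y\<close>.\<close>
    define m where "m = (\<chi> j. min (x $ j) (y $ j))"
    have m: "m \<in> commodity_space" "\<And>j. m $ j \<le> x $ j" "\<And>j. m $ j \<le> y $ j"
      using x y by (auto simp: m_def commodity_space_def)
    have seg: "m + t *\<^sub>R (x - m) \<in> commodity_space" if "0 \<le> t" "t \<le> 1" for t
      using segment_in_commodity_space[OF m(1) _ that] x by blast
    have "\<exists>t\<ge>0. t \<le> 1 \<and> u (m + t *\<^sub>R (x - m)) = u y"
    proof (rule IVT')
      show "continuous_on {0..1} (\<lambda>t. u (m + t *\<^sub>R (x - m)))"
        by (rule continuous_on_compose2[OF continuous_on_utility]) (use seg in \<open>auto intro!: continuous_intros\<close>)
    qed (use x utility_mono[OF m(1) y m(3)] in auto)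
    then obtain t where t: "0 \<le> t" "t \<le> 1" "u (m + t *\<^sub>R (x - m)) = u y" by blast
    let ?z = "m + t *\<^sub>R (x - m)"
    have le: "?z $ j \<le> x $ j" for j
    proof -
      have "t * (x $ j - m $ j) \<le> 1 * (x $ j - m $ j)"
        using t m(2)[of j] by (intro mult_right_mono) auto
      then show ?thesis by simp
    qed
    have "?z $ j \<le> b" "0 \<le> ?z $ j" for j
      using order_trans[OF le] seg[OF t(1,2)] x unfolding commodity_space_def by (blast intro: less_imp_le)+
    then have "?z \<in> cbox 0 (\<chi> j. b)" by (simp add: mem_box_cart)
    then show ?thesis using seg[OF t(1,2)] t(3) le by blast
  qed
  have Z: "compact ?Z"
    using necessity unfolding necessity_def by (intro closed_Int_compact compact_cbox) auto
  have "?Z \<noteq> {}" using below False by blast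
  \<comment> \<open>The minima of the coordinates over \<open>?Z\<close> are positive and form the
    lower corner of a box inside the orthant.\<close>
  then have "\<exists>z. z \<in> ?Z \<and> (\<forall>w\<in>?Z. z $ j \<le> w $ j)" for j
    unfolding Bex_def[symmetric] by (intro continuous_attains_inf[OF Z] continuous_intros)
  then have "\<forall>j. \<exists>z. z \<in> ?Z \<and> (\<forall>w\<in>?Z. z $ j \<le> w $ j)" by (rule allI)
  from choice[OF this] obtain e where e': "\<forall>j. e j \<in> ?Z \<and> (\<forall>w\<in>?Z. e j $ j \<le> w $ j)" ..
  have e: "e j \<in> ?Z" "w \<in> ?Z \<Longrightarrow> e j $ j \<le> w $ j" for j w
    using e' by (fast+)
  let ?B = "cbox (\<chi> j. e j $ j) (\<chi> j. b)"
  have BX: "?B \<subseteq> commodity_space"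
  proof
    fix x assume x: "x \<in> ?B"
    have "0 < e j $ j" for j using e(1)[of j] by (auto simp: commodity_space_def)
    then show "x \<in> commodity_space"
      using x by (auto simp: mem_box_cart commodity_space_def intro: less_le_trans)
  qed
  have "?S = ?B \<inter> u -` {u y..}"
  proof (intro equalityI subsetI)
    fix x assume x: "x \<in> ?S"
    then obtain z where z: "z \<in> ?Z" "\<forall>j. z $ j \<le> x $ j" using below by blast
    then have "e j $ j \<le> x $ j" for j using e(2)[OF z(1), of j] order_trans by blast
    then show "x \<in> ?B \<inter> u -` {u y..}" using x by (auto simp: mem_box_cart)
  next
    fix x assume x: "x \<in> ?B \<inter> u -` {u y..}"
    then have "x \<in> commodity_space" using BX by blast
    then show "x \<in> ?S" using x by (auto simp: mem_box_cart)
  qed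
  moreover have "closed (?B \<inter> u -` {u y..})"
    by (intro continuous_closed_preimage continuous_on_subset[OF continuous_on_utility BX]) auto
  moreover have "bounded (?B \<inter> u -` {u y..})"
    by (rule bounded_subset[OF bounded_cbox]) blast
  ultimately show ?thesis by (simp add: compact_eq_bounded_closed)
qed (simp only: compact_empty)

text \<open>The first-order condition suffices: affordable directions have nonpositive slope at
  \<open>x\<close>, and then strict quasi-concavity makes every other affordable bundle strictly
  worse.\<close>

lemma demand_eqI:
  assumes x: "x \<in> commodity_space" and c: "c > 0" "gradient u x = c *\<^sub>R p" and px: "p \<bullet> x = p \<bullet> w"
  shows "demand u p w = x"
  unfolding demand_def
proof (rule the_equality)
  have less: "u y < u x" if "y \<in> budget_set p w" "y \<noteq> x" for y
  proof (rule utility_less_if_gradient_nonpos[OF x])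
    show "gradient u x \<bullet> (y - x) \<le> 0"
      using that(1) c px by (simp add: budget_set_def inner_diff_right mult_le_0_iff)
  qed (use that in \<open>auto simp: budget_set_def\<close>)
  have xb: "x \<in> budget_set p w" using x px by (simp add: budget_set_def)
  show "is_arg_max u (\<lambda>y. y \<in> budget_set p w) x"
    using xb less by (force simp: is_arg_max_def)
  show "y = x" if "is_arg_max u (\<lambda>y. y \<in> budget_set p w) y" for y
    using that xb less[of y] by (auto simp: is_arg_max_def)
qed

lemma ex_demand:
  assumes p: "p \<in> commodity_space" and w: "w \<in> commodity_space"
  shows "\<exists>x\<in>commodity_space. (\<exists>c>0. gradient u x = c *\<^sub>R p) \<and> p \<bullet> x = p \<bullet> w"
proof -
  \<comment> \<open>A bound for every coordinate of every affordable bundle: spending on good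
    \<open>j\<close> alone cannot exceed the income.\<close>
  define b where "b = (\<Sum>j\<in>UNIV. (p \<bullet> w) / p $ j)"
  have bnd: "x $ j \<le> b" if x: "x \<in> budget_set p w" for x j
  proof -
    have pos: "p $ i > 0" "x $ i > 0" for i using p x by (auto simp: commodity_space_def budget_set_def)
    have "p $ j * x $ j \<le> (\<Sum>i\<in>UNIV. p $ i * x $ i)"
      by (rule member_le_sum) (use pos in \<open>auto simp: less_imp_le\<close>)
    also have "\<dots> \<le> p \<bullet> w" using x by (simp add: budget_set_def inner_vec_def)
    finally have "x $ j \<le> (p \<bullet> w) / p $ j" using pos(1)[of j] by (simp add: field_simps)
    also have "\<dots> \<le> b"
      unfolding b_def by (rule member_le_sum)
        (use pos inner_pos_if_commodity[OF p w] in \<open>auto intro: less_imp_le\<close>)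
    finally show ?thesis .
  qed
  \<comment> \<open>The budget set itself need not be compact, as the orthant is open; discarding
    bundles worse than the endowment repairs this.\<close>
  let ?A = "{x \<in> commodity_space. u w \<le> u x \<and> (\<forall>j. x $ j \<le> b)} \<inter> {x. p \<bullet> x \<le> p \<bullet> w}"
  have "compact ?A"
    by (intro compact_Int_closed compact_upper_contour w closed_Collect_le continuous_intros)
  moreover have "w \<in> ?A" using w bnd[of w] by (auto simp: budget_set_def)
  moreover have "continuous_on ?A u" by (rule continuous_on_subset[OF continuous_on_utility]) auto
  ultimately obtain x where x: "x \<in> ?A" "\<And>y. y \<in> ?A \<Longrightarrow> u y \<le> u x"
    using continuous_attains_sup[of ?A u] by blast
  have max: "u y \<le> u x" if "y \<in> budget_set p w" for y
  proof (cases "u w \<le> u y")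
    case True
    then show ?thesis using x(2)[of y] that bnd[OF that] by (auto simp: budget_set_def)
  qed (use x(1) in auto)
  let ?q = "gradient u x"
  have xX: "x \<in> commodity_space" using x(1) by blast
  have foc: "?q \<bullet> v \<le> 0" if v: "\<exists>e>0. \<forall>t. 0 < t \<and> t < e \<longrightarrow> p \<bullet> (x + t *\<^sub>R v) \<le> p \<bullet> w" for v
  proof (rule ccontr)
    assume "\<not> ?thesis"
    then have "0 < gradient u (x + 0 *\<^sub>R v) \<bullet> v" by simp
    moreover have "((\<lambda>t. u (x + t *\<^sub>R v)) has_real_derivative gradient u (x + 0 *\<^sub>R v) \<bullet> v) (at 0)"
      by (rule DERIV_utility_segment) (use xX in simp)
    ultimately obtain d where d: "d > 0" "\<And>h. 0 < h \<Longrightarrow> h < d \<Longrightarrow> u (x + 0 *\<^sub>R v) < u (x + (0 + h) *\<^sub>R v)"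
      using DERIV_pos_inc_right by metis
    obtain e where e: "e > 0" "\<And>t. 0 < t \<Longrightarrow> t < e \<Longrightarrow> p \<bullet> (x + t *\<^sub>R v) \<le> p \<bullet> w" using v by blast
    have "open ((\<lambda>t. x + t *\<^sub>R v) -` commodity_space)"
      by (intro open_vimage open_commodity_space continuous_intros)
    moreover have "0 \<in> (\<lambda>t. x + t *\<^sub>R v) -` commodity_space" using xX by simp
    ultimately obtain r where r: "r > 0" "ball 0 r \<subseteq> (\<lambda>t. x + t *\<^sub>R v) -` commodity_space"
      by (elim openE)
    define t where "t = min (min d e) r / 2"
    have t: "0 < t" "t < d" "t < e" "t < r" using d(1) e(1) r(1) by (auto simp: t_def min_def)
    then have "t \<in> ball 0 r" by simp
    then have "x + t *\<^sub>R v \<in> commodity_space" using r(2) by blast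
    then have "x + t *\<^sub>R v \<in> budget_set p w" using e(2) t by (simp add: budget_set_def)
    then show False using max[of "x + t *\<^sub>R v"] d(2)[of t] t by simp
  qed
  have px: "p \<bullet> x = p \<bullet> w"
  proof (rule ccontr)
    assume "p \<bullet> x \<noteq> p \<bullet> w"
    then have lt: "p \<bullet> x < p \<bullet> w" using x(1) by simp
    \<comment> \<open>With a slack budget a small move along \<open>p\<close> stays affordable, yet
      gradient and price are both positive vectors.\<close>
    have "?q \<bullet> p \<le> 0"
    proof (rule foc, intro exI conjI allI impI)
      have pp: "p \<bullet> p > 0" using inner_pos_if_commodity[OF p p] .
      then show "(p \<bullet> w - p \<bullet> x) / (p \<bullet> p) > 0" using lt by simp
      show "p \<bullet> (x + t *\<^sub>R p) \<le> p \<bullet> w" if "0 < t \<and> t < (p \<bullet> w - p \<bullet> x) / (p \<bullet> p)" for t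
        using that pp by (simp add: inner_add_right field_simps)
    qed
    then show False using inner_pos_if_commodity[OF gradient_pos[OF xX] p] by simp
  qed
  \<comment> \<open>The projection coefficient: the remainder \<open>?v\<close> of the gradient is
    orthogonal to \<open>p\<close>, hence a budget-neutral direction, and the first-order condition
    gives it norm 0.\<close>
  define c where "c = (?q \<bullet> p) / (p \<bullet> p)"
  have pp: "p \<bullet> p > 0" using inner_pos_if_commodity[OF p p] .
  have c: "c > 0" using pp inner_pos_if_commodity[OF gradient_pos[OF xX] p] by (simp add: c_def)
  let ?v = "?q - c *\<^sub>R p"
  have pv: "p \<bullet> ?v = 0" using pp by (simp add: c_def inner_diff_right inner_commute)
  have "?q \<bullet> ?v \<le> 0"
    by (rule foc, rule exI[of _ 1]) (use pv px in \<open>simp add: inner_add_right\<close>)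
  moreover have "?q \<bullet> ?v = ?v \<bullet> ?v" using pv by (simp add: inner_diff_left)
  ultimately have "?v = 0" by (metis inner_ge_zero inner_eq_zero_iff order_antisym)
  then have "?q = c *\<^sub>R p" by simp
  then show ?thesis using xX c px by blast
qed

text \<open>Inverse demand: the gradient scaled to numeraire price 1.\<close>

definition supporting_price :: "'l \<Rightarrow> real^'l \<Rightarrow> real^'l" where
  "supporting_price n x = inverse (gradient u x $ n) *\<^sub>R gradient u x"

lemma supporting_price_in_price_set:
  assumes "x \<in> commodity_space"
  shows "supporting_price n x \<in> price_set n"
  using gradient_pos[OF assms]
  by (auto simp: supporting_price_def price_set_def commodity_space_def less_imp_neq[symmetric])

lemma demand_supporting_price:
  assumes "x \<in> commodity_space" "supporting_price n x \<bullet> x = supporting_price n x \<bullet> w"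
  shows "demand u (supporting_price n x) w = x"
proof (rule demand_eqI[OF assms(1) _ _ assms(2)])
  show "gradient u x $ n > 0" using gradient_pos[OF assms(1)] by (auto simp: commodity_space_def)
  then show "gradient u x = gradient u x $ n *\<^sub>R supporting_price n x"
    by (simp add: supporting_price_def)
qed

lemma demand_props:
  assumes p: "p \<in> price_set n" and w: "w \<in> commodity_space"
  shows "demand u p w \<in> commodity_space" "p \<bullet> demand u p w = p \<bullet> w"
    "supporting_price n (demand u p w) = p"
proof -
  have "p \<in> commodity_space" using p by (auto simp: price_set_def commodity_space_def)
  then obtain x c where x: "x \<in> commodity_space" "c > 0" "gradient u x = c *\<^sub>R p" "p \<bullet> x = p \<bullet> w"
    using ex_demand[OF _ w] by blast
  then have "demand u p w = x" by (intro demand_eqI)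
  moreover have "supporting_price n x = p"
    using x(2,3) p by (simp add: supporting_price_def price_set_def)
  ultimately show "demand u p w \<in> commodity_space" "p \<bullet> demand u p w = p \<bullet> w"
    "supporting_price n (demand u p w) = p" using x by auto
qed

lemma C1_on_supporting_price: "C1_on (supporting_price n) commodity_space"
proof -
  have g: "C1_on (gradient u) commodity_space" using C1_map_gradient C1_on_iff_C1_map by blast
  have "C1_on (\<lambda>x. gradient u x $ n) commodity_space"
    by (rule C1_on_compose[OF g C1_on_bounded_linear[OF bounded_linear_vec_nth], where T = UNIV]) simp
  then show ?thesis
    unfolding supporting_price_def[abs_def]
    using gradient_pos by (intro C1_on_scaleR C1_on_inverse g) (auto simp: commodity_space_def less_imp_neq[symmetric])
qed

end

text \<open>Since the numeraire price is 1, the coordinate \<open>n\<close> is free to record the income.\<close>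

definition price_income :: "'l::finite \<Rightarrow> real^'l \<Rightarrow> real^'l \<Rightarrow> real^'l" where
  "price_income n p w = (\<chi> j. if j = n then p \<bullet> w else p $ j)"

context consumer
begin

text \<open>The inverse of demand as a function of price and income, with both encoded in a single
  vector of \<open>real^'l\<close>, so that domain and range have equal dimension.\<close>

definition price_income_map :: "'l \<Rightarrow> real^'l \<Rightarrow> real^'l" where
  "price_income_map n x = price_income n (supporting_price n x) x"

text \<open>A kernel vector \<open>v\<close> changes neither the supporting price nor, to first
  order, the income, so it is tangent to the indifference surface. Differentiating the identity that
  the gradient is a multiple of the price shows that the Hessian maps \<open>v\<close> to a multiple
  of the price. So the quadratic form vanishes at \<open>v\<close>, against negative
  definiteness.\<close>

lemma det_deriv_price_income_map:
  assumes x: "x \<in> commodity_space" and f: "C1_map (price_income_map n) f' commodity_space"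
  shows "det (f' x) \<noteq> 0"
proof
  assume "det (f' x) = 0"
  then obtain v where v: "v \<noteq> 0" "f' x *v v = 0" by (rule det_eq_0_imp_kernel)
  let ?q = "gradient u x" and ?H = "hessian u x *v v" and ?P = "supporting_price n"
  have qn: "?q $ n > 0" using gradient_pos[OF x] by (auto simp: commodity_space_def)
  obtain P' where P': "C1_map ?P P' commodity_space"
    using C1_on_supporting_price[of n] unfolding C1_on_iff_C1_map by blast
  have comp: "((\<lambda>x. price_income_map n x $ j) has_derivative (\<lambda>w. (f' x *v w) $ j)) (at x)" for j
    using bounded_linear.has_derivative[OF bounded_linear_vec_nth C1_mapD(1)[OF f x]] by blast
  have compP: "((\<lambda>x. ?P x $ j) has_derivative (\<lambda>w. (P' x *v w) $ j)) (at x)" for j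
    using bounded_linear.has_derivative[OF bounded_linear_vec_nth C1_mapD(1)[OF P' x]] by blast
  \<comment> \<open>The numeraire price is constantly 1; the other prices are coordinates of the map
    itself.\<close>
  have P0: "(P' x *v v) $ j = 0" for j
  proof (cases "j = n")
    case True
    have "((\<lambda>x. ?P x $ n) has_derivative (\<lambda>w. 0)) (at x)"
      by (rule has_derivative_transform_within_open[OF has_derivative_const[of 1] open_commodity_space x])
        (use supporting_price_in_price_set in \<open>auto simp: price_set_def\<close>)
    from has_derivative_unique[OF compP[of n] this]
    have "(P' x *v w) $ n = 0" for w by (rule fun_cong)
    then show ?thesis using True by simp
  next
    case False
    then have "((\<lambda>x. price_income_map n x $ j) has_derivative (\<lambda>w. (P' x *v w) $ j)) (at x)"
      using compP[of j] by (simp add: price_income_map_def price_income_def)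
    from has_derivative_unique[OF comp[of j] this]
    have "(f' x *v w) $ j = (P' x *v w) $ j" for w by (rule fun_cong)
    then show ?thesis using v(2) by (metis zero_index)
  qed
  then have Pv: "P' x *v v = 0" by (simp add: vec_eq_iff)
  have "((\<lambda>x. ?P x \<bullet> x) has_derivative (\<lambda>w. ?P x \<bullet> w + (P' x *v w) \<bullet> x)) (at x)"
    by (rule has_derivative_inner[OF C1_mapD(1)[OF P' x] has_derivative_ident])
  then have "((\<lambda>x. price_income_map n x $ n) has_derivative (\<lambda>w. ?P x \<bullet> w + (P' x *v w) \<bullet> x)) (at x)"
    by (simp add: price_income_map_def price_income_def)
  from has_derivative_unique[OF comp[of n] this]
  have "(f' x *v w) $ n = ?P x \<bullet> w + (P' x *v w) \<bullet> x" for w by (rule fun_cong)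
  from this[of v] have Pxv: "?P x \<bullet> v = 0" using v(2) Pv by simp
  then have qv: "?q \<bullet> v = 0" using qn by (simp add: supporting_price_def)
  have gP: "gradient u y = gradient u y $ n *\<^sub>R ?P y" if "y \<in> commodity_space" for y
    using gradient_pos[OF that] by (auto simp: supporting_price_def commodity_space_def less_imp_neq[symmetric])
  have gn: "((\<lambda>y. gradient u y $ n) has_derivative (\<lambda>w. (hessian u x *v w) $ n)) (at x)"
    using bounded_linear.has_derivative[OF bounded_linear_vec_nth C1_mapD(1)[OF C1_map_gradient x]] .
  have "((\<lambda>y. gradient u y $ n *\<^sub>R ?P y) has_derivative
      (\<lambda>w. ?q $ n *\<^sub>R (P' x *v w) + ((hessian u x *v w) $ n) *\<^sub>R ?P x)) (at x)"
    by (rule has_derivative_scaleR[OF gn C1_mapD(1)[OF P' x]])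
  note has_derivative_transform_within_open[OF this open_commodity_space x gP[symmetric]]
  from has_derivative_unique[OF C1_mapD(1)[OF C1_map_gradient x] this]
  have "hessian u x *v w = ?q $ n *\<^sub>R (P' x *v w) + ((hessian u x *v w) $ n) *\<^sub>R ?P x" for w
    by (rule fun_cong)
  from this[of v] have "?H = (?H $ n) *\<^sub>R ?P x" using Pv by simp
  then have "v \<bullet> ?H = v \<bullet> ((?H $ n) *\<^sub>R ?P x)" by (rule arg_cong)
  then have "v \<bullet> ?H = 0" using Pxv by (simp add: inner_commute)
  moreover have "v \<bullet> ?H < 0"
    using strict_quasiconcave x qv v(1) unfolding strictly_quasiconcave_utility_def by blast
  ultimately show False by simp
qed

text \<open>\<open>d\<close> is the inverse of \<open>price_income_map\<close>, which is injective
  because demand at the supporting price recovers the bundle. Its image contains the orthant, so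
  \<open>d\<close> is C1 there.\<close>

lemma ex_C1_demand_function:
  obtains d where "C1_on d commodity_space"
    "\<And>p w. p \<in> price_set n \<Longrightarrow> w \<in> commodity_space \<Longrightarrow>
      price_income n p w \<in> commodity_space \<and> demand u p w = d (price_income n p w)"
proof -
  let ?f = "price_income_map n"
  have "C1_on ?f commodity_space"
    unfolding price_income_map_def price_income_def
  proof (rule C1_on_vec)
    fix j
    show "C1_on (\<lambda>x. if j = n then supporting_price n x \<bullet> x else supporting_price n x $ j) commodity_space"
    proof (cases "j = n")
      case True
      show ?thesis unfolding if_P[OF True]
        by (intro C1_on_inner C1_on_supporting_price C1_on_bounded_linear bounded_linear_ident)
    next
      case False
      show ?thesis unfolding if_not_P[OF False]
        by (rule C1_on_compose[OF C1_on_supporting_price C1_on_bounded_linear[OF bounded_linear_vec_nth], where T = UNIV]) simp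
    qed
  qed
  then obtain f' where f: "C1_map ?f f' commodity_space" unfolding C1_on_iff_C1_map by blast
  have P: "supporting_price n x = (\<chi> j. if j = n then 1 else ?f x $ j)" if "x \<in> commodity_space" for x
    using supporting_price_in_price_set[OF that, of n]
    by (simp add: vec_eq_iff price_income_map_def price_income_def price_set_def)
  have Pn: "supporting_price n x \<bullet> x = ?f x $ n" for x
    by (simp add: price_income_map_def price_income_def)
  have inj: "inj_on ?f commodity_space"
  proof (rule inj_onI)
    fix x y assume xy: "x \<in> commodity_space" "y \<in> commodity_space" "?f x = ?f y"
    then have eq: "supporting_price n x = supporting_price n y"
      unfolding P[OF xy(1)] P[OF xy(2)] by (simp only:)
    have "supporting_price n x \<bullet> x = supporting_price n x \<bullet> y"
      using Pn[of x] Pn[of y] xy(3) eq by simp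
    then have "demand u (supporting_price n x) y = x" by (rule demand_supporting_price[OF xy(1)])
    moreover have "demand u (supporting_price n x) y = y"
      unfolding eq by (rule demand_supporting_price[OF xy(2) refl])
    ultimately show "x = y" by (rule trans[OF sym])
  qed
  define d where "d = the_inv_into commodity_space ?f"
  have d: "d (?f x) = x" if "x \<in> commodity_space" for x
    using the_inv_into_f_f[OF inj that] by (simp add: d_def)
  have C1: "C1_on d (?f ` commodity_space)"
    by (rule C1_map_inverse[OF open_commodity_space f det_deriv_price_income_map[OF _ f] d])
  have demand: "price_income n p w = ?f (demand u p w)" if "p \<in> price_set n" "w \<in> commodity_space" for p w
    using demand_props[OF that] by (simp add: price_income_map_def price_income_def cong: if_cong)
  have img: "commodity_space \<subseteq> ?f ` commodity_space"
  proof
    fix s :: "real^'l" assume s: "s \<in> commodity_space"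
    define p where "p = (\<chi> j. if j = n then 1 else s $ j)"
    \<comment> \<open>Every positive vector encodes some price and income: a bundle with equal
      coordinates, scaled to have value \<open>s $ n\<close>.\<close>
    define w :: "real^'l" where "w = (s $ n / (\<Sum>j\<in>UNIV. p $ j)) *\<^sub>R 1"
    have p: "p \<in> price_set n" using s by (auto simp: p_def price_set_def commodity_space_def)
    then have sp: "(\<Sum>j\<in>UNIV. p $ j) > 0" by (auto simp: price_set_def intro!: sum_pos)
    have w: "w \<in> commodity_space" using s sp by (auto simp: w_def commodity_space_def)
    have "p \<bullet> w = s $ n" using sp by (simp add: w_def inner_vec_def flip: sum_divide_distrib sum_distrib_right)
    then have "price_income n p w = s" by (simp add: price_income_def p_def vec_eq_iff)
    then show "s \<in> ?f ` commodity_space" using demand[OF p w] demand_props(1)[OF p w] by auto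
  qed
  show ?thesis
  proof (rule that[OF C1_on_subset[OF C1 img]])
    fix p w assume pw: "p \<in> price_set n" "w \<in> (commodity_space :: (real^'l) set)"
    then have "p \<in> commodity_space" by (auto simp: price_set_def commodity_space_def)
    then have "price_income n p w \<in> commodity_space"
      using inner_pos_if_commodity[OF _ pw(2)] by (auto simp: price_income_def commodity_space_def)
    moreover have "demand u p w = d (price_income n p w)"
      using d demand[OF pw] demand_props(1)[OF pw] by simp
    ultimately show "price_income n p w \<in> commodity_space \<and> demand u p w = d (price_income n p w)" by blast
  qed
qed

end

lemma compact_vec_components:
  fixes A :: "'i::finite \<Rightarrow> 'a::euclidean_space set"
  assumes "\<And>i. compact (A i)"
  shows "compact {x. \<forall>i. x $ i \<in> A i}"
proof -
  have "{x. \<forall>i. x $ i \<in> A i} = (\<Inter>i. (\<lambda>x. x $ i) -` A i)" by auto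
  moreover have "closed (\<Inter>i. (\<lambda>x. x $ i) -` A i)"
    using assms by (intro closed_INT ballI closed_vimage compact_imp_closed continuous_intros)
  ultimately have "closed {x. \<forall>i. x $ i \<in> A i}" by simp
  moreover have "bounded {x. \<forall>i. x $ i \<in> A i}"
  proof -
    have "\<forall>i. \<exists>B. \<forall>x\<in>A i. norm x \<le> B"
      using assms compact_imp_bounded bounded_iff by blast
    from choice[OF this] obtain B where B: "\<forall>i. \<forall>x\<in>A i. norm x \<le> B i" ..
    have "norm x \<le> (\<Sum>i\<in>UNIV. B i)" if "\<forall>i. x $ i \<in> A i" for x
    proof -
      have "norm x \<le> (\<Sum>i\<in>UNIV. norm (x $ i))" unfolding norm_vec_def by (intro L2_set_le_sum) auto
      also have "\<dots> \<le> (\<Sum>i\<in>UNIV. B i)" using B that by (intro sum_mono) blast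
      finally show ?thesis .
    qed
    then show ?thesis unfolding bounded_iff by blast
  qed
  ultimately show ?thesis by (simp add: compact_eq_bounded_closed)
qed

section \<open>Exchange economies\<close>

locale economy =
  fixes n :: "'l::finite" and u :: "'m::finite \<Rightarrow> real^'l \<Rightarrow> real"
  assumes consumer: "\<And>i. consumer (u i)"
begin

text \<open>One consumer is singled out. Recording his demand instead of his endowment gives the chart
  \<open>chart\<close> of the equilibrium manifold, with values in the endowment space; in this chart the natural
  projection is the restriction of \<open>projection\<close>.\<close>

definition i0 :: 'm where "i0 = undefined"

definition price :: "real^'l \<Rightarrow> real^'l" where
  "price x = consumer.supporting_price (u i0) n x"

definition others_excess :: "real^'l^'m \<Rightarrow> real^'l" where
  "others_excess \<xi> = (\<Sum>i\<in>UNIV - {i0}. demand (u i) (price (\<xi> $ i0)) (\<xi> $ i) - \<xi> $ i)"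

text \<open>Market clearing forces the endowment of \<open>i0\<close> to be his demand plus the
  excess demand of the others. The formula makes sense on all of \<Omega>, also where this endowment
  is not positive; the image of the chart is \<open>E_coords\<close>.\<close>

definition projection :: "real^'l^'m \<Rightarrow> real^'l^'m" where
  "projection \<xi> = \<xi> + axis i0 (others_excess \<xi>)"

definition chart :: "(real^'l) \<times> (real^'l^'m) \<Rightarrow> real^'l^'m" where
  "chart e = (\<chi> i. if i = i0 then demand (u i0) (fst e) (snd e $ i0) else snd e $ i)"

definition chart_inv :: "real^'l^'m \<Rightarrow> (real^'l) \<times> (real^'l^'m)" where
  "chart_inv \<xi> = (price (\<xi> $ i0), projection \<xi>)"

abbreviation \<Omega> :: "(real^'l^'m) set" where "\<Omega> \<equiv> endowment_space"

abbreviation E :: "((real^'l) \<times> (real^'l^'m)) set" where "E \<equiv> equilibrium_manifold n u"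

definition E_coords :: "(real^'l^'m) set" where
  "E_coords = {\<xi> \<in> \<Omega>. projection \<xi> \<in> \<Omega>}"

section \<open>The chart and its inverse\<close>

lemma open_endowment_space: "open \<Omega>"
proof -
  have eq: "\<Omega> = (\<Inter>i. (\<lambda>\<omega>. \<omega> $ i) -` commodity_space)" by (auto simp: endowment_space_def)
  show ?thesis
    unfolding eq by (intro open_INT ballI open_vimage open_commodity_space continuous_intros) simp
qed

lemma price_in_price_set: "x \<in> commodity_space \<Longrightarrow> price x \<in> price_set n"
  unfolding price_def by (rule consumer.supporting_price_in_price_set[OF consumer])

lemma demand_price: "x \<in> commodity_space \<Longrightarrow> price x \<bullet> x = price x \<bullet> w \<Longrightarrow> demand (u i0) (price x) w = x"
  unfolding price_def by (rule consumer.demand_supporting_price[OF consumer])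

lemma projection_nth: "projection \<xi> $ i = (if i = i0 then \<xi> $ i0 + others_excess \<xi> else \<xi> $ i)"
  by (auto simp: projection_def axis_def)

lemma endowment_nth: "\<xi> \<in> \<Omega> \<Longrightarrow> \<xi> $ i \<in> commodity_space"
  by (simp add: endowment_space_def)

lemma walras: "\<xi> \<in> \<Omega> \<Longrightarrow> price (\<xi> $ i0) \<bullet> others_excess \<xi> = 0"
  unfolding others_excess_def inner_sum_right inner_diff_right
  using consumer.demand_props(2)[OF consumer price_in_price_set[OF endowment_nth] endowment_nth]
  by (intro sum.neutral) auto

lemma chart_in_E_coords:
  assumes e: "e \<in> E"
  shows "chart e \<in> E_coords" "projection (chart e) = snd e" "price (chart e $ i0) = fst e" "chart_inv (chart e) = e"
proof -
  obtain p \<omega> where pw: "e = (p, \<omega>)" "p \<in> price_set n" "\<omega> \<in> \<Omega>" "excess_demand u p \<omega> = 0"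
    using e by (auto simp: equilibrium_manifold_def)
  note d = consumer.demand_props[OF consumer pw(2) endowment_nth[OF pw(3)]]
  show price: "price (chart e $ i0) = fst e"
    using d(3) by (simp add: chart_def pw(1) price_def)
  have \<Omega>: "chart e \<in> \<Omega>"
    using d(1) endowment_nth[OF pw(3)] by (auto simp: chart_def pw(1) endowment_space_def)
  have "others_excess (chart e) = (\<Sum>i\<in>UNIV - {i0}. demand (u i) p (\<omega> $ i) - \<omega> $ i)"
    unfolding others_excess_def price by (intro sum.cong) (auto simp: chart_def pw(1))
  also have "\<dots> = \<omega> $ i0 - demand (u i0) p (\<omega> $ i0)"
    using pw(4) unfolding excess_demand_def by (subst (asm) sum.remove[of _ i0]) (auto simp: algebra_simps)
  finally show proj: "projection (chart e) = snd e"
    by (simp add: vec_eq_iff projection_nth) (simp add: chart_def pw(1))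
  show "chart e \<in> E_coords" using \<Omega> proj pw(3) by (simp add: E_coords_def pw(1))
  show "chart_inv (chart e) = e" by (simp add: chart_inv_def proj price)
qed

lemma chart_inv_in_E:
  assumes \<xi>: "\<xi> \<in> E_coords"
  shows "chart_inv \<xi> \<in> E" "chart (chart_inv \<xi>) = \<xi>"
proof -
  have \<Omega>: "\<xi> \<in> \<Omega>" "projection \<xi> \<in> \<Omega>" using \<xi> by (auto simp: E_coords_def)
  \<comment> \<open>By Walras' law the reconstructed endowment has the same value as the bundle at
    its supporting price, so the bundle is demanded.\<close>
  have d0: "demand (u i0) (price (\<xi> $ i0)) (projection \<xi> $ i0) = \<xi> $ i0"
    by (rule demand_price[OF endowment_nth[OF \<Omega>(1)]]) (simp add: projection_nth inner_add_right walras[OF \<Omega>(1)])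
  show "chart (chart_inv \<xi>) = \<xi>"
    by (simp add: vec_eq_iff chart_def chart_inv_def d0) (simp add: projection_nth)
  have "excess_demand u (price (\<xi> $ i0)) (projection \<xi>) =
      (\<xi> $ i0 - projection \<xi> $ i0) + (\<Sum>i\<in>UNIV - {i0}. demand (u i) (price (\<xi> $ i0)) (projection \<xi> $ i) - projection \<xi> $ i)"
    unfolding excess_demand_def by (subst sum.remove[of _ i0]) (auto simp: d0)
  also have "(\<Sum>i\<in>UNIV - {i0}. demand (u i) (price (\<xi> $ i0)) (projection \<xi> $ i) - projection \<xi> $ i) = others_excess \<xi>"
    unfolding others_excess_def by (intro sum.cong) (auto simp: projection_nth)
  finally have "excess_demand u (price (\<xi> $ i0)) (projection \<xi>) = 0" by (simp add: projection_nth)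
  then show "chart_inv \<xi> \<in> E"
    using \<Omega> price_in_price_set[OF endowment_nth[OF \<Omega>(1)]] by (simp add: equilibrium_manifold_def chart_inv_def)
qed

section \<open>Differentiability of projection and chart\<close>

lemma C1_on_nth: "C1_on (\<lambda>x. x $ i) S" for i :: "'i::finite" and S :: "('b::euclidean_space^'i) set"
  by (rule C1_on_bounded_linear[OF bounded_linear_vec_nth])

lemma C1_on_price_income:
  assumes "C1_on p S" "C1_on w S"
  shows "C1_on (\<lambda>x. price_income n (p x) (w x)) S"
  unfolding price_income_def
proof (rule C1_on_vec)
  fix j
  show "C1_on (\<lambda>x. if j = n then p x \<bullet> w x else p x $ j) S"
  proof (cases "j = n")
    case True
    show ?thesis unfolding if_P[OF True] by (intro C1_on_inner assms)
  next
    case False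
    show ?thesis unfolding if_not_P[OF False]
      by (rule C1_on_compose[OF assms(1) C1_on_nth, where T = UNIV]) simp
  qed
qed

lemma C1_on_price: "C1_on (\<lambda>\<xi>. price (\<xi> $ i0)) \<Omega>"
proof -
  have "C1_on price commodity_space"
    unfolding price_def[abs_def] by (rule consumer.C1_on_supporting_price[OF consumer])
  then show ?thesis
    by (rule C1_on_compose[OF C1_on_nth]) (auto simp: endowment_nth)
qed

lemma C1_on_projection: "C1_on projection \<Omega>"
proof -
  have "C1_on (\<lambda>\<xi>. demand (u i) (price (\<xi> $ i0)) (\<xi> $ i)) \<Omega>" for i
  proof -
    obtain d where d: "C1_on d commodity_space"
      "\<And>p w. p \<in> price_set n \<Longrightarrow> w \<in> commodity_space \<Longrightarrow>
        price_income n p w \<in> commodity_space \<and> demand (u i) p w = d (price_income n p w)"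
      using consumer.ex_C1_demand_function[OF consumer] by blast
    have d': "price_income n (price (\<xi> $ i0)) (\<xi> $ i) \<in> commodity_space \<and>
        demand (u i) (price (\<xi> $ i0)) (\<xi> $ i) = d (price_income n (price (\<xi> $ i0)) (\<xi> $ i))"
      if "\<xi> \<in> \<Omega>" for \<xi>
      using d(2) price_in_price_set endowment_nth that by blast
    have "C1_on (\<lambda>\<xi>. d (price_income n (price (\<xi> $ i0)) (\<xi> $ i))) \<Omega>"
      by (rule C1_on_compose[OF C1_on_price_income[OF C1_on_price C1_on_nth] d(1)]) (use d' in blast)
    then show ?thesis
      by (rule C1_on_cong_open[OF _ open_endowment_space]) (use d' in blast)
  qed
  then have "C1_on (\<lambda>\<xi>. demand (u i) (price (\<xi> $ i0)) (\<xi> $ i) + (-1) *\<^sub>R \<xi> $ i) \<Omega>" for i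
    by (intro C1_on_add C1_on_scaleR C1_on_const C1_on_nth)
  then have 1: "C1_on others_excess \<Omega>"
    unfolding others_excess_def[abs_def] by (intro C1_on_sum) auto
  have 2: "bounded_linear (\<lambda>v::real^'l. axis i0 v :: real^'l^'m)"
    by (auto simp: linear_conv_bounded_linear[symmetric] axis_def vec_eq_iff intro!: linearI)
  have "C1_on (\<lambda>\<xi>. axis i0 (others_excess \<xi>) :: real^'l^'m) \<Omega>"
    by (rule C1_on_compose[OF 1 C1_on_bounded_linear[OF 2] subset_UNIV])
  then show ?thesis
    unfolding projection_def[abs_def] by (rule C1_on_add[OF C1_on_bounded_linear[OF bounded_linear_ident]])
qed

text \<open>\<open>E\<close> is not open in the ambient product, so the chain rule along curves in
  \<open>E\<close> requires an extension of the chart. \<open>\<Phi>\<close> uses the C1 function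
  behind demand wherever prices and income stay positive.\<close>

lemma C1_near_chart:
  obtains W \<Phi> where "open W" "E \<subseteq> W" "C1_on \<Phi> W" "\<And>e. e \<in> E \<Longrightarrow> \<Phi> e = chart e"
proof -
  obtain d where d: "C1_on d commodity_space"
    "\<And>p w. p \<in> price_set n \<Longrightarrow> w \<in> commodity_space \<Longrightarrow>
      price_income n p w \<in> commodity_space \<and> demand (u i0) p w = d (price_income n p w)"
    using consumer.ex_C1_demand_function[OF consumer] by blast
  let ?s = "\<lambda>e :: (real^'l) \<times> (real^'l^'m). price_income n (fst e) (snd e $ i0)"
  let ?W = "?s -` commodity_space"
  define \<Phi> where "\<Phi> e = (\<chi> i. if i = i0 then d (?s e) else snd e $ i)" for e
  have fst: "C1_on fst S" and snd: "C1_on (\<lambda>e. snd e $ i) S" for i and S :: "((real^'l) \<times> (real^'l^'m)) set"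
    by (intro C1_on_bounded_linear bounded_linear_fst)
      (rule C1_on_compose[OF C1_on_bounded_linear[OF bounded_linear_snd] C1_on_nth, where T = UNIV], simp)
  have s: "C1_on ?s S" for S by (intro C1_on_price_income fst snd)
  show ?thesis
  proof
    show "open ?W"
      by (intro open_vimage open_commodity_space C1_on_imp_continuous_on s)
    show "C1_on \<Phi> ?W"
      unfolding \<Phi>_def
    proof (rule C1_on_vec)
      show "C1_on (\<lambda>e. if i = i0 then d (?s e) else snd e $ i) ?W" for i
        using C1_on_compose[OF s[of ?W] d(1)] snd by (cases "i = i0") auto
    qed
    have ds: "?s e \<in> commodity_space \<and> demand (u i0) (fst e) (snd e $ i0) = d (?s e)" if "e \<in> E" for e
      using d(2) that endowment_nth by (auto simp: equilibrium_manifold_def)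
    show "E \<subseteq> ?W" using ds by blast
    show "\<Phi> e = chart e" if "e \<in> E" for e
      using ds[OF that] by (simp add: \<Phi>_def chart_def cong: if_cong)
  qed
qed

lemma continuous_on_chart: "continuous_on E chart"
proof -
  obtain W \<Phi> where "open W" and W: "E \<subseteq> W" "C1_on \<Phi> W" "\<And>e. e \<in> E \<Longrightarrow> \<Phi> e = chart e"
    by (rule C1_near_chart, rule that) assumption+
  have "continuous_on E \<Phi>" by (rule continuous_on_subset[OF C1_on_imp_continuous_on[OF W(2)] W(1)])
  then show ?thesis using W(3) by (simp cong: continuous_on_cong)
qed

lemma continuous_on_chart_inv: "continuous_on \<Omega> chart_inv"
  unfolding chart_inv_def[abs_def]
  by (intro continuous_on_Pair C1_on_imp_continuous_on C1_on_price C1_on_projection)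

text \<open>Only the bundle of \<open>i0\<close> moves under the homotopy, and it moves orthogonally
  to the supporting price. The original bundle is thus at least as good as the moved one, which
  bounds its utility below by the minimum over \<open>K\<close>. It is also at most the aggregate of
  the moved bundles, and the two bounds cut out a compact set.\<close>

lemma proper_homotopy_projection: "proper_homotopy_to_id \<Omega> projection"
  unfolding proper_homotopy_to_id_def
proof (intro allI impI)
  fix K :: "(real^'l^'m) set" assume K: "compact K \<and> K \<subseteq> \<Omega>"
  define A where "A i = (\<lambda>\<zeta>. \<zeta> $ i) ` K" for i
  have A: "compact (A i)" "A i \<subseteq> commodity_space" for i
    using K endowment_nth by (auto simp: A_def intro!: compact_continuous_image continuous_intros)
  have "bounded K" using K compact_imp_bounded by blast
  then obtain b where "\<forall>\<zeta>\<in>K. norm \<zeta> \<le> b" unfolding bounded_iff ..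
  then have b: "norm \<zeta> \<le> b" if "\<zeta> \<in> K" for \<zeta> using that by blast
  show "\<exists>C. compact C \<and> C \<subseteq> \<Omega> \<and>
      (\<forall>\<xi>\<in>\<Omega>. \<forall>t. 0 \<le> t \<and> t \<le> 1 \<and> \<xi> + t *\<^sub>R (projection \<xi> - \<xi>) \<in> K \<longrightarrow> \<xi> \<in> C)"
  proof (cases "K = {}")
    case False
    then have "A i0 \<noteq> {}" by (simp add: A_def)
    then obtain y0 where y0: "y0 \<in> A i0" "\<And>y. y \<in> A i0 \<Longrightarrow> u i0 y0 \<le> u i0 y"
      using continuous_attains_inf[OF A(1) _ continuous_on_subset[OF consumer.continuous_on_utility[OF consumer] A(2)]]
      by blast
    \<comment> \<open>The aggregate of \<open>CARD('m)\<close> bundles, each with coordinates at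
      most \<open>b\<close>.\<close>
    define B where "B = real CARD('m) * b"
    let ?X = "{x \<in> commodity_space. u i0 y0 \<le> u i0 x \<and> (\<forall>j. x $ j \<le> B)}"
    let ?C = "{\<xi>. \<forall>i. \<xi> $ i \<in> (if i = i0 then ?X else A i)}"
    have "compact ?X" using y0(1) A(2) by (intro consumer.compact_upper_contour[OF consumer]) blast
    then have C: "compact ?C" by (intro compact_vec_components) (simp add: A(1))
    have CO: "?C \<subseteq> \<Omega>"
    proof
      fix \<xi> assume "\<xi> \<in> ?C"
      then have "\<xi> $ i \<in> commodity_space" for i using A(2)[of i] by (cases "i = i0") (auto split: if_splits)
      then show "\<xi> \<in> \<Omega>" by (simp add: endowment_space_def)
    qed
    have "\<xi> \<in> ?C" if \<xi>: "\<xi> \<in> \<Omega>" and t: "0 \<le> t" "t \<le> 1" and in_K: "\<xi> + t *\<^sub>R (projection \<xi> - \<xi>) \<in> K" for \<xi> t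
    proof -
      let ?\<zeta> = "\<xi> + t *\<^sub>R (projection \<xi> - \<xi>)" and ?x = "\<xi> $ i0" and ?p = "price (\<xi> $ i0)"
      note X = endowment_nth[OF \<xi>]
      have other: "?\<zeta> $ i = \<xi> $ i" if "i \<noteq> i0" for i using that by (simp add: projection_nth)
      have \<zeta>0: "?\<zeta> $ i0 = ?x + t *\<^sub>R others_excess \<xi>" by (simp add: projection_nth)
      have \<zeta>0A: "?\<zeta> $ i0 \<in> A i0" using in_K unfolding A_def by (rule imageI)
      have "?p \<bullet> (?\<zeta> $ i0 - ?x) = 0" unfolding \<zeta>0 by (simp add: walras[OF \<xi>])
      then have "inverse (gradient (u i0) ?x $ n) * (gradient (u i0) ?x \<bullet> (?\<zeta> $ i0 - ?x)) = 0"
        by (simp only: price_def consumer.supporting_price_def[OF consumer] inner_scaleR_left)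
      moreover have "gradient (u i0) ?x $ n > 0"
        using consumer.gradient_pos[OF consumer X] by (simp add: commodity_space_def)
      ultimately have "gradient (u i0) ?x \<bullet> (?\<zeta> $ i0 - ?x) = 0" by (simp only: mult_eq_0_iff) simp
      then have "u i0 (?\<zeta> $ i0) < u i0 ?x" if "?\<zeta> $ i0 \<noteq> ?x"
        by (intro consumer.utility_less_if_gradient_nonpos[OF consumer X subsetD[OF A(2) \<zeta>0A] that]) (simp only: order_refl)
      then have "u i0 (?\<zeta> $ i0) \<le> u i0 ?x" by fastforce
      then have "u i0 y0 \<le> u i0 ?x" using y0(2)[OF \<zeta>0A] by linarith
      moreover have "?x $ j \<le> B" for j
      proof -
        have dpos: "0 < demand (u i) ?p (\<xi> $ i) $ j" for i
          using consumer.demand_props(1)[OF consumer price_in_price_set[OF X] X] by (simp add: commodity_space_def)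
        \<comment> \<open>Demands are positive, so the others' excess demand is bounded below by
          minus their total endowment. As \<open>t \<le> 1\<close>, the homotopy lowers the bundle
          of \<open>i0\<close> by no more than this total.\<close>
        have "- (\<Sum>i\<in>UNIV - {i0}. \<xi> $ i $ j) \<le> others_excess \<xi> $ j"
          unfolding others_excess_def sum_negf[symmetric] sum_component
          using dpos by (intro sum_mono) (simp add: less_imp_le)
        then have "t * - (\<Sum>i\<in>UNIV - {i0}. \<xi> $ i $ j) \<le> t * others_excess \<xi> $ j"
          using t(1) by (rule mult_left_mono)
        moreover have "t * (\<Sum>i\<in>UNIV - {i0}. \<xi> $ i $ j) \<le> (\<Sum>i\<in>UNIV - {i0}. \<xi> $ i $ j)"
          using t X by (intro mult_left_le_one_le sum_nonneg) (auto simp: commodity_space_def less_imp_le)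
        ultimately have "?x $ j \<le> ?\<zeta> $ i0 $ j + (\<Sum>i\<in>UNIV - {i0}. \<xi> $ i $ j)"
          unfolding \<zeta>0 by simp
        also have "(\<Sum>i\<in>UNIV - {i0}. \<xi> $ i $ j) = (\<Sum>i\<in>UNIV - {i0}. ?\<zeta> $ i $ j)"
          by (intro sum.cong refl arg_cong[where f = "\<lambda>v. v $ j"] other[symmetric]) auto
        also have "?\<zeta> $ i0 $ j + (\<Sum>i\<in>UNIV - {i0}. ?\<zeta> $ i $ j) = (\<Sum>i\<in>UNIV. ?\<zeta> $ i $ j)"
          by (rule sum.remove[symmetric]) auto
        also have "\<dots> \<le> (\<Sum>i\<in>(UNIV :: 'm set). b)"
        proof (rule sum_mono)
          show "?\<zeta> $ i $ j \<le> b" for i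
            using component_le_norm_cart[of "?\<zeta> $ i" j] Finite_Cartesian_Product.norm_nth_le[of ?\<zeta> i] b[OF in_K] by linarith
        qed
        finally show ?thesis by (simp add: B_def)
      qed
      moreover have "\<xi> $ i \<in> A i" if "i \<noteq> i0" for i
        using other[OF that] in_K unfolding A_def by (metis (no_types, lifting) imageI)
      ultimately show ?thesis using X by simp
    qed
    then show ?thesis using C CO by blast
  qed auto
qed

text \<open>A continuous selection followed by the chart is a continuous section \<open>s\<close> of
  \<open>projection\<close>. Being injective between spaces of the same dimension, it has an open
  image, and on this image \<open>projection\<close> is its inverse.\<close>

lemma noncritical_locally_injective:
  assumes e: "e \<in> E - crisis_transitions n u"
  shows "\<exists>V. open V \<and> chart e \<in> V \<and> inj_on projection V"
proof -
  obtain U p where U: "open U" "snd e \<in> U" "U \<subseteq> \<Omega>" "continuous_on U p" "p (snd e) = fst e"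
    "\<And>\<omega>. \<omega> \<in> U \<Longrightarrow> (p \<omega>, \<omega>) \<in> E"
    using e unfolding crisis_transitions_def by (cases e) auto
  define s where "s \<omega> = chart (p \<omega>, \<omega>)" for \<omega>
  have ps: "projection (s \<omega>) = \<omega>" if "\<omega> \<in> U" for \<omega>
    using chart_in_E_coords(2)[OF U(6)[OF that]] by (simp add: s_def)
  have "continuous_on U s"
    unfolding s_def by (rule continuous_on_compose2[OF continuous_on_chart])
      (use U in \<open>auto intro!: continuous_intros\<close>)
  moreover have "inj_on s U" using ps by (metis inj_onI)
  ultimately have "open (s ` U)" using U(1) by (intro invariance_of_domain)
  moreover have "chart e \<in> s ` U" using U(2,5) by (force simp: s_def)
  moreover have "inj_on projection (s ` U)" using ps by (auto simp: inj_on_def)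
  ultimately show ?thesis by blast
qed

section \<open>Fibres of the natural projection\<close>

lemma fibre_eq:
  assumes "\<omega> \<in> \<Omega>"
  shows "equilibrium_fiber n u \<omega> = chart_inv ` {\<xi> \<in> \<Omega>. projection \<xi> = \<omega>}"
proof (intro equalityI subsetI)
  fix e assume "e \<in> equilibrium_fiber n u \<omega>"
  then have e: "e \<in> E" "snd e = \<omega>" by (auto simp: equilibrium_fiber_def)
  then show "e \<in> chart_inv ` {\<xi> \<in> \<Omega>. projection \<xi> = \<omega>}"
    using chart_in_E_coords[OF e(1)] by (intro image_eqI[of _ _ "chart e"]) (auto simp: E_coords_def)
next
  fix e assume "e \<in> chart_inv ` {\<xi> \<in> \<Omega>. projection \<xi> = \<omega>}"
  then obtain \<xi> where "\<xi> \<in> \<Omega>" "projection \<xi> = \<omega>" "e = chart_inv \<xi>" by blast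
  then show "e \<in> equilibrium_fiber n u \<omega>"
    using chart_inv_in_E(1)[of \<xi>] assms by (auto simp: equilibrium_fiber_def E_coords_def chart_inv_def)
qed

lemma fibre_coords:
  assumes conn: "connected (E - crisis_transitions n u)" and dense: "E \<subseteq> closure (E - crisis_transitions n u)"
    and \<omega>: "\<omega> \<in> \<Omega>"
  shows "connected {\<xi> \<in> \<Omega>. projection \<xi> = \<omega>}" "{\<xi> \<in> \<Omega>. projection \<xi> = \<omega>} \<noteq> {}"
proof -
  obtain F' where F': "\<And>x. x \<in> \<Omega> \<Longrightarrow> (projection has_derivative F' x) (at x)" "\<And>v. continuous_on \<Omega> (\<lambda>x. F' x v)"
    using C1_on_projection unfolding C1_on_def by blast
  let ?N = "E - crisis_transitions n u"
  let ?R = "chart ` ?N"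
  have R: "?R \<subseteq> {\<xi> \<in> \<Omega>. projection \<xi> \<in> \<Omega>}"
    using chart_in_E_coords(1) unfolding E_coords_def by blast
  have Rdense: "{\<xi> \<in> \<Omega>. projection \<xi> \<in> \<Omega>} \<subseteq> closure ?R"
  proof
    fix \<xi> assume "\<xi> \<in> {\<xi> \<in> \<Omega>. projection \<xi> \<in> \<Omega>}"
    then have \<xi>: "\<xi> \<in> E_coords" by (simp add: E_coords_def)
    note e = chart_inv_in_E[OF \<xi>]
    have "chart_inv \<xi> \<in> closure ?N" using e(1) dense by blast
    then obtain f where f: "\<And>k. f k \<in> ?N" "f \<longlonglongrightarrow> chart_inv \<xi>"
      unfolding closure_sequential by blast
    then have "(\<lambda>k. chart (f k)) \<longlonglongrightarrow> chart (chart_inv \<xi>)"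
      using continuous_on_tendsto_compose[OF continuous_on_chart f(2) e(1)] by auto
    then have "(\<lambda>k. chart (f k)) \<longlonglongrightarrow> \<xi>" by (simp add: e(2))
    then show "\<xi> \<in> closure ?R"
      unfolding closure_sequential by (intro exI[of _ "\<lambda>k. chart (f k)"] conjI allI imageI f(1))
  qed
  have "continuous_on ?N chart" by (rule continuous_on_subset[OF continuous_on_chart]) blast
  then have Rconn: "connected ?R" using conn by (rule connected_continuous_image)
  have inj: "\<exists>V. open V \<and> \<xi> \<in> V \<and> inj_on projection V" if "\<xi> \<in> ?R" for \<xi>
    using that by (elim imageE) (simp only: noncritical_locally_injective)
  note connected_fibres[OF open_endowment_space F' proper_homotopy_projection R Rdense Rconn inj \<omega>]
  then show "connected {\<xi> \<in> \<Omega>. projection \<xi> = \<omega>}" "{\<xi> \<in> \<Omega>. projection \<xi> = \<omega>} \<noteq> {}"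
    by simp_all
qed

text \<open>Every direction \<open>v\<close> is the endowment component of the velocity of a curve
  in \<open>E\<close>. Along the curve \<open>projection\<close> after the chart is
  \<open>snd\<close>, so \<open>v\<close> lies in the range of the derivative; a surjective linear
  endomorphism is injective.\<close>

lemma regular_isolated:
  assumes e: "regular_equilibrium n u e"
  obtains r where "r > 0" "inj_on projection (ball (chart e) r)"
proof -
  have eE: "e \<in> E" and bij: "bij_betw snd (tangent_space E e) UNIV"
    using e by (auto simp: regular_equilibrium_def)
  obtain F' where F': "\<And>x. x \<in> \<Omega> \<Longrightarrow> (projection has_derivative F' x) (at x)" "\<And>v. continuous_on \<Omega> (\<lambda>x. F' x v)"
    using C1_on_projection unfolding C1_on_def by blast
  obtain W \<Phi> where "open W" and W: "E \<subseteq> W" "C1_on \<Phi> W" "\<And>e. e \<in> E \<Longrightarrow> \<Phi> e = chart e"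
    by (rule C1_near_chart, rule that) assumption+
  obtain \<Phi>' where \<Phi>': "\<And>x. x \<in> W \<Longrightarrow> (\<Phi> has_derivative \<Phi>' x) (at x)"
    using W(2) unfolding C1_on_def by blast
  let ?\<xi> = "chart e"
  have \<xi>: "?\<xi> \<in> \<Omega>" using chart_in_E_coords(1)[OF eE] by (simp add: E_coords_def)
  have "surj (F' ?\<xi>)"
    unfolding surj_def
  proof
    fix v :: "real^'l^'m"
    obtain w where w: "w \<in> tangent_space E e" "snd w = v"
      using bij by (metis UNIV_I bij_betw_imp_surj_on imageE)
    then obtain \<gamma> \<epsilon> where \<gamma>: "\<epsilon> > 0" "\<gamma> ` {-\<epsilon><..<\<epsilon>} \<subseteq> E" "\<gamma> 0 = e" "(\<gamma> has_vector_derivative w) (at (0::real))"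
      unfolding tangent_space_def by blast
    have \<gamma>d: "(\<gamma> has_derivative (\<lambda>h. h *\<^sub>R w)) (at 0)" using \<gamma>(4) by (simp add: has_vector_derivative_def)
    have "e \<in> W" using W(1) eE by blast
    then have "(\<Phi> has_derivative \<Phi>' e) (at (\<gamma> 0))" using \<Phi>'[of e] \<gamma>(3) by simp
    from has_derivative_compose[OF \<gamma>d this]
    have c: "((\<lambda>t. \<Phi> (\<gamma> t)) has_derivative (\<lambda>h. \<Phi>' e (h *\<^sub>R w))) (at 0)" .
    have "\<Phi> (\<gamma> 0) = ?\<xi>" using W(3) \<gamma>(3) eE by simp
    then have "(projection has_derivative F' ?\<xi>) (at (\<Phi> (\<gamma> 0)))" using F'(1)[OF \<xi>] by simp
    from has_derivative_compose[OF c this]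
    have 1: "((\<lambda>t. projection (\<Phi> (\<gamma> t))) has_derivative (\<lambda>h. F' ?\<xi> (\<Phi>' e (h *\<^sub>R w)))) (at 0)" .
    have 2: "((\<lambda>t. projection (\<Phi> (\<gamma> t))) has_derivative (\<lambda>h. snd (h *\<^sub>R w))) (at 0)"
    proof (rule has_derivative_transform_within_open[OF has_derivative_snd[OF \<gamma>d], of "{-\<epsilon><..<\<epsilon>}"])
      fix t assume "t \<in> {-\<epsilon><..<\<epsilon>}"
      then have "\<gamma> t \<in> E" using \<gamma>(2) by blast
      then show "snd (\<gamma> t) = projection (\<Phi> (\<gamma> t))" using W(3) chart_in_E_coords(2) by simp
    qed (use \<gamma>(1) in auto)
    from has_derivative_unique[OF 1 2]
    have "F' ?\<xi> (\<Phi>' e (h *\<^sub>R w)) = snd (h *\<^sub>R w)" for h by (rule fun_cong)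
    from this[of 1] show "\<exists>x. v = F' ?\<xi> x" using w(2) by auto
  qed
  then have "inj (F' ?\<xi>)"
    using linear_surjective_imp_injective has_derivative_linear[OF F'(1)[OF \<xi>]] by blast
  from C1_locally_injective[OF open_endowment_space \<xi> F' this] that show ?thesis by blast
qed

lemma continuum_fibre:
  assumes conn: "connected (E - crisis_transitions n u)" and dense: "E \<subseteq> closure (E - crisis_transitions n u)"
    and \<omega>: "\<omega> \<in> \<Omega>"
  shows "continuum (equilibrium_fiber n u \<omega>)"
proof -
  let ?A = "{\<xi> \<in> \<Omega>. projection \<xi> = \<omega>}"
  have cont: "continuous_on ?A chart_inv" by (rule continuous_on_subset[OF continuous_on_chart_inv]) auto
  have "compact {\<xi> \<in> \<Omega>. projection \<xi> \<in> {\<omega>}}"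
    by (rule compact_preimage_proper[OF proper_homotopy_projection C1_on_imp_continuous_on[OF C1_on_projection]])
      (use \<omega> in auto)
  then have "compact ?A" by simp
  then show ?thesis
    unfolding continuum_def fibre_eq[OF \<omega>]
    using fibre_coords[OF conn dense \<omega>] compact_continuous_image[OF cont] connected_continuous_image[OF cont] by auto
qed

text \<open>A connected set with an isolated point is a singleton, and a regular equilibrium is
  isolated in its fibre.\<close>

lemma fibre_regular_singleton:
  assumes conn: "connected (E - crisis_transitions n u)" and dense: "E \<subseteq> closure (E - crisis_transitions n u)"
    and \<omega>: "\<omega> \<in> \<Omega>" and e: "e \<in> equilibrium_fiber n u \<omega>" "regular_equilibrium n u e"
  shows "equilibrium_fiber n u \<omega> = {e}"
proof -
  let ?A = "{\<xi> \<in> \<Omega>. projection \<xi> = \<omega>}"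
  obtain r where r: "r > 0" "inj_on projection (ball (chart e) r)" using regular_isolated[OF e(2)] by blast
  have eE: "e \<in> E" "snd e = \<omega>" using e(1) by (auto simp: equilibrium_fiber_def)
  have \<xi>: "chart e \<in> ?A" using chart_in_E_coords[OF eE(1)] eE(2) by (auto simp: E_coords_def)
  have sing: "ball (chart e) r \<inter> ?A \<subseteq> {chart e}"
    using r \<xi> by (auto dest: inj_onD)
  \<comment> \<open>The ball and the complement of its centre are open, cover the fibre and share no
    point of it.\<close>
  have "ball (chart e) r \<inter> ?A = {} \<or> (- {chart e}) \<inter> ?A = {}"
    by (rule connectedD[OF fibre_coords(1)[OF conn dense \<omega>]]) (use sing r(1) in \<open>auto simp: open_Compl\<close>)
  moreover have "chart e \<in> ball (chart e) r" using r(1) by simp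
  ultimately have "?A = {chart e}" using \<xi> by blast
  then show ?thesis using fibre_eq[OF \<omega>] chart_in_E_coords(4)[OF eE(1)] by simp
qed

end

theorem theorem1p5:
  fixes n :: "'l::finite"
    and u :: "'m::finite \<Rightarrow> real ^ 'l \<Rightarrow> real"
  assumes smooth: "\<And>i. smooth_on (u i) commodity_space"
    and monotonicity: "\<And>i. monotone_utility (u i)"
    and strict_quasiconcavity: "\<And>i. strictly_quasiconcave_utility (u i)"
    and necessity: "\<And>i. necessity (u i)"
    and connected: "connected (equilibrium_manifold n u - crisis_transitions n u)"
    and dense: "equilibrium_manifold n u \<subseteq> closure (equilibrium_manifold n u - crisis_transitions n u)"
  shows "(\<forall>\<omega>\<in>endowment_space. continuum (equilibrium_fiber n u \<omega>)) \<and>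
         (\<forall>\<omega>\<in>endowment_space. \<forall>e\<in>equilibrium_fiber n u \<omega>.
            regular_equilibrium n u e \<longrightarrow> equilibrium_fiber n u \<omega> = {e})"
proof -
  interpret economy n u
    by unfold_locales (rule smooth monotonicity strict_quasiconcavity necessity)+
  show ?thesis
    using continuum_fibre[OF connected dense] fibre_regular_singleton[OF connected dense] by blast
qed

end
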